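(* Let $p$ be a prime, let $G$ be an abelian $p$-group and let $L$ be a large subgroup of $G$. Then $G$ is $p^{\omega+1}$-projective if and only if $L$ is $p^{\omega+1}$-projective.
   Context: All groups are abelian and written additively. A subgroup $L$ of an abelian $p$-group $G$ is large if $L$ is fully invariant in $G$ (i.e. $f(L)\subseteq L$ for every endomorphism $f$ of $G$) and $G=L+B$ for every basic subgroup $B$ of $G$. $G[p]=\{g\in G: pg=0\}$. An abelian $p$-group $G$ is $p^{\omega+1}$-projective if $p^{\omega+1}\operatorname{Ext}(G,X)=0$ for every abelian group $X$; by a criterion of Nunke this holds if and only if there is a subgroup $E\le G[p]$ such that $G/E$ is a direct sum of cyclic groups. *)

theory Defs
  imports "HOL-Algebra.Product_Groups" "HOL-Computational_Algebra.Primes"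
begin

text \<open>Abelian groups are \<^const>\<open>comm_group\<close>s, hence written multiplicatively: \<open>x [^] n\<close> is the
  multiple \<open>n x\<close>, \<open>\<one>\<close> is \<open>0\<close>, and \<open>L <#> B\<close> is \<open>L + B\<close>.\<close>

definition primary_group :: "nat \<Rightarrow> ('a, 'b) monoid_scheme \<Rightarrow> bool"
  where "primary_group p G \<longleftrightarrow> (\<forall>x\<in>carrier G. \<exists>n::nat. x [^]\<^bsub>G\<^esub> (p ^ n) = \<one>\<^bsub>G\<^esub>)"

definition divisible_group :: "('a, 'b) monoid_scheme \<Rightarrow> bool"
  where "divisible_group G \<longleftrightarrow>
    (\<forall>n::nat. n > 0 \<longrightarrow> (\<forall>x\<in>carrier G. \<exists>y\<in>carrier G. y [^]\<^bsub>G\<^esub> n = x))"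

definition pure_subgroup :: "'a set \<Rightarrow> ('a, 'b) monoid_scheme \<Rightarrow> bool"
  where "pure_subgroup B G \<longleftrightarrow> subgroup B G \<and>
    (\<forall>n::nat. \<forall>x\<in>carrier G. x [^]\<^bsub>G\<^esub> n \<in> B \<longrightarrow> (\<exists>b\<in>B. b [^]\<^bsub>G\<^esub> n = x [^]\<^bsub>G\<^esub> n))"

text \<open>Taking the index set and the cyclic groups inside the carrier type of \<open>G\<close> is no restriction:
  trivial summands can be dropped, and the others are subgroups of \<open>G\<close> indexed by their generators.\<close>

definition direct_sum_of_cyclics :: "('a, 'b) monoid_scheme \<Rightarrow> bool"
  where "direct_sum_of_cyclics G \<longleftrightarrow>
    (\<exists>(I :: 'a set) (C :: 'a \<Rightarrow> 'a monoid).
      (\<forall>i\<in>I. group (C i) \<and> cyclic_group (C i)) \<and> G \<cong> sum_group I C)"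

definition basic_subgroup :: "'a set \<Rightarrow> ('a, 'b) monoid_scheme \<Rightarrow> bool"
  where "basic_subgroup B G \<longleftrightarrow>
    pure_subgroup B G \<and> direct_sum_of_cyclics (G\<lparr>carrier := B\<rparr>) \<and> divisible_group (G Mod B)"

definition fully_invariant :: "'a set \<Rightarrow> ('a, 'b) monoid_scheme \<Rightarrow> bool"
  where "fully_invariant L G \<longleftrightarrow> subgroup L G \<and> (\<forall>f\<in>hom G G. f ` L \<subseteq> L)"

definition large_subgroup :: "'a set \<Rightarrow> ('a, 'b) monoid_scheme \<Rightarrow> bool"
  where "large_subgroup L G \<longleftrightarrow>
    fully_invariant L G \<and> (\<forall>B. basic_subgroup B G \<longrightarrow> carrier G = L <#>\<^bsub>G\<^esub> B)"

text \<open>\<open>Ext(G, X)\<close> is the group of factor sets (normalized symmetric 2-cocycles) modulo the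
  transformation sets (coboundaries of normalized 1-cochains), with pointwise operations.\<close>

definition cocycles :: "('a, 'b) monoid_scheme \<Rightarrow> ('x, 'y) monoid_scheme \<Rightarrow> ('a \<times> 'a \<Rightarrow> 'x) set"
  where "cocycles G X = {f \<in> carrier G \<times> carrier G \<rightarrow>\<^sub>E carrier X.
    (\<forall>a\<in>carrier G. f (a, \<one>\<^bsub>G\<^esub>) = \<one>\<^bsub>X\<^esub> \<and> f (\<one>\<^bsub>G\<^esub>, a) = \<one>\<^bsub>X\<^esub>) \<and>
    (\<forall>a\<in>carrier G. \<forall>b\<in>carrier G. f (a, b) = f (b, a)) \<and>
    (\<forall>a\<in>carrier G. \<forall>b\<in>carrier G. \<forall>c\<in>carrier G.
      f (a, b) \<otimes>\<^bsub>X\<^esub> f (a \<otimes>\<^bsub>G\<^esub> b, c) = f (b, c) \<otimes>\<^bsub>X\<^esub> f (a, b \<otimes>\<^bsub>G\<^esub> c))}"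

definition cochains :: "('a, 'b) monoid_scheme \<Rightarrow> ('x, 'y) monoid_scheme \<Rightarrow> ('a \<Rightarrow> 'x) set"
  where "cochains G X = {g \<in> carrier G \<rightarrow>\<^sub>E carrier X. g \<one>\<^bsub>G\<^esub> = \<one>\<^bsub>X\<^esub>}"

definition coboundary ::
    "('a, 'b) monoid_scheme \<Rightarrow> ('x, 'y) monoid_scheme \<Rightarrow> ('a \<Rightarrow> 'x) \<Rightarrow> 'a \<times> 'a \<Rightarrow> 'x"
  where "coboundary G X g = (\<lambda>(a, b)\<in>carrier G \<times> carrier G.
    g a \<otimes>\<^bsub>X\<^esub> g b \<otimes>\<^bsub>X\<^esub> inv\<^bsub>X\<^esub> (g (a \<otimes>\<^bsub>G\<^esub> b)))"

definition Fact :: "('a, 'b) monoid_scheme \<Rightarrow> ('x, 'y) monoid_scheme \<Rightarrow> ('a \<times> 'a \<Rightarrow> 'x) monoid"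
  where "Fact G X =
    (product_group (carrier G \<times> carrier G) (\<lambda>_. X))\<lparr>carrier := cocycles G X\<rparr>"

definition Ext :: "('a, 'b) monoid_scheme \<Rightarrow> ('x, 'y) monoid_scheme \<Rightarrow> ('a \<times> 'a \<Rightarrow> 'x) set monoid"
  where "Ext G X = Fact G X Mod (coboundary G X ` cochains G X)"

definition p_omega :: "nat \<Rightarrow> ('a, 'b) monoid_scheme \<Rightarrow> 'a set"
  where "p_omega p A = (\<Inter>n::nat. (\<lambda>x. x [^]\<^bsub>A\<^esub> (p ^ n)) ` carrier A)"

definition p_omega_plus_1 :: "nat \<Rightarrow> ('a, 'b) monoid_scheme \<Rightarrow> 'a set"
  where "p_omega_plus_1 p A = (\<lambda>x. x [^]\<^bsub>A\<^esub> p) ` p_omega p A"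

text \<open>A quantifier inside a definition ranges over the groups on one type only. The type of words
  below carries a copy of every group of cardinality at most \<open>max (card G) \<aleph>\<^sub>0\<close>, and this is
  enough for every abelian group on any type to be covered: see
  \<open>p_omega_plus_1_Ext_eq_one\<close> at the end of this theory.\<close>

definition p_omega_plus_1_projective :: "nat \<Rightarrow> ('a, 'b) monoid_scheme \<Rightarrow> bool"
  where "p_omega_plus_1_projective p G \<longleftrightarrow>
    (\<forall>X :: ('a \<times> int) list monoid. comm_group X \<longrightarrow> p_omega_plus_1 p (Ext G X) = {\<one>\<^bsub>Ext G X\<^esub>})"

lemma mem_cocycles:
  "f \<in> cocycles G X \<longleftrightarrow> f \<in> carrier G \<times> carrier G \<rightarrow>\<^sub>E carrier X \<and>
    (\<forall>a\<in>carrier G. f (a, \<one>\<^bsub>G\<^esub>) = \<one>\<^bsub>X\<^esub> \<and> f (\<one>\<^bsub>G\<^esub>, a) = \<one>\<^bsub>X\<^esub>) \<and>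
    (\<forall>a\<in>carrier G. \<forall>b\<in>carrier G. f (a, b) = f (b, a)) \<and>
    (\<forall>a\<in>carrier G. \<forall>b\<in>carrier G. \<forall>c\<in>carrier G.
      f (a, b) \<otimes>\<^bsub>X\<^esub> f (a \<otimes>\<^bsub>G\<^esub> b, c) = f (b, c) \<otimes>\<^bsub>X\<^esub> f (a, b \<otimes>\<^bsub>G\<^esub> c))"
  unfolding cocycles_def by (rule mem_Collect_eq)

lemma cocycle_closed:
  "f \<in> cocycles G X \<Longrightarrow> a \<in> carrier G \<Longrightarrow> b \<in> carrier G \<Longrightarrow> f (a, b) \<in> carrier X"
  unfolding mem_cocycles by blast

lemma cochain_closed: "g \<in> cochains G X \<Longrightarrow> a \<in> carrier G \<Longrightarrow> g a \<in> carrier X"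
  unfolding cochains_def by blast

lemma comm_group_4:
  assumes "comm_group X" "a \<in> carrier X" "b \<in> carrier X" "c \<in> carrier X" "d \<in> carrier X"
  shows "(a \<otimes>\<^bsub>X\<^esub> b) \<otimes>\<^bsub>X\<^esub> (c \<otimes>\<^bsub>X\<^esub> d) = (a \<otimes>\<^bsub>X\<^esub> c) \<otimes>\<^bsub>X\<^esub> (b \<otimes>\<^bsub>X\<^esub> d)"
proof -
  interpret comm_group X by fact
  show ?thesis using assms by (simp add: m_ac)
qed

lemma subgroup_cocycles:
  assumes G: "comm_group G" and X: "comm_group X"
  shows "subgroup (cocycles G X) (product_group (carrier G \<times> carrier G) (\<lambda>_. X))"
    (is "subgroup _ ?P")
proof -
  interpret G: comm_group G by fact
  interpret X: comm_group X by fact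
  interpret P: group ?P by (rule product_group) (rule X.is_group)
  show ?thesis
  proof (rule P.subgroupI)
    show "cocycles G X \<subseteq> carrier ?P" by (auto simp: cocycles_def)
    have "(\<lambda>_\<in>carrier G \<times> carrier G. \<one>\<^bsub>X\<^esub>) \<in> cocycles G X" by (auto simp: cocycles_def)
    then show "cocycles G X \<noteq> {}" by blast
  next
    fix f assume f: "f \<in> cocycles G X"
    then have fP: "f \<in> carrier G \<times> carrier G \<rightarrow>\<^sub>E carrier X" by (simp add: mem_cocycles)
    note fc = cocycle_closed[OF f]
    have "(\<lambda>i\<in>carrier G \<times> carrier G. inv\<^bsub>X\<^esub> f i) \<in> cocycles G X"
      unfolding mem_cocycles using f fc
      by (auto simp: mem_cocycles simp flip: X.inv_mult)
    then show "inv\<^bsub>?P\<^esub> f \<in> cocycles G X"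
      using inv_product_group[OF fP] X.is_group by simp
  next
    fix f g assume f: "f \<in> cocycles G X" and g: "g \<in> cocycles G X"
    note fc = cocycle_closed[OF f] and gc = cocycle_closed[OF g]
    have "(f (a, b) \<otimes>\<^bsub>X\<^esub> g (a, b)) \<otimes>\<^bsub>X\<^esub> (f (a \<otimes>\<^bsub>G\<^esub> b, c) \<otimes>\<^bsub>X\<^esub> g (a \<otimes>\<^bsub>G\<^esub> b, c))
        = (f (b, c) \<otimes>\<^bsub>X\<^esub> g (b, c)) \<otimes>\<^bsub>X\<^esub> (f (a, b \<otimes>\<^bsub>G\<^esub> c) \<otimes>\<^bsub>X\<^esub> g (a, b \<otimes>\<^bsub>G\<^esub> c))"
      if "a \<in> carrier G" "b \<in> carrier G" "c \<in> carrier G" for a b c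
    proof -
      have "f (a, b) \<otimes>\<^bsub>X\<^esub> f (a \<otimes>\<^bsub>G\<^esub> b, c) = f (b, c) \<otimes>\<^bsub>X\<^esub> f (a, b \<otimes>\<^bsub>G\<^esub> c)"
        "g (a, b) \<otimes>\<^bsub>X\<^esub> g (a \<otimes>\<^bsub>G\<^esub> b, c) = g (b, c) \<otimes>\<^bsub>X\<^esub> g (a, b \<otimes>\<^bsub>G\<^esub> c)"
        using f g that unfolding mem_cocycles by blast+
      then show ?thesis
        using that by (subst (1 2) comm_group_4[OF X]) (simp_all add: fc gc)
    qed
    then have "(\<lambda>i\<in>carrier G \<times> carrier G. f i \<otimes>\<^bsub>X\<^esub> g i) \<in> cocycles G X"
      unfolding mem_cocycles using f g fc gc by (auto simp: mem_cocycles)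
    then show "f \<otimes>\<^bsub>?P\<^esub> g \<in> cocycles G X" by simp
  qed
qed

lemma comm_group_Fact:
  assumes G: "comm_group G" and X: "comm_group X"
  shows "comm_group (Fact G X)"
proof (rule group.group_comm_groupI)
  interpret X: comm_group X by fact
  interpret P: group "product_group (carrier G \<times> carrier G) (\<lambda>_. X)"
    by (rule product_group) (rule X.is_group)
  show "group (Fact G X)"
    unfolding Fact_def by (rule P.subgroup_imp_group[OF subgroup_cocycles[OF assms]])
  fix f g assume "f \<in> carrier (Fact G X)" "g \<in> carrier (Fact G X)"
  then show "f \<otimes>\<^bsub>Fact G X\<^esub> g = g \<otimes>\<^bsub>Fact G X\<^esub> f"
    by (auto simp: Fact_def restrict_def fun_eq_iff intro!: X.m_comm dest: cocycle_closed)
qed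

lemma carrier_Fact: "carrier (Fact G X) = cocycles G X"
  by (simp add: Fact_def)

lemma mult_Fact:
  "f \<otimes>\<^bsub>Fact G X\<^esub> g = (\<lambda>i\<in>carrier G \<times> carrier G. f i \<otimes>\<^bsub>X\<^esub> g i)"
  by (simp add: Fact_def)

lemma one_Fact: "\<one>\<^bsub>Fact G X\<^esub> = (\<lambda>i\<in>carrier G \<times> carrier G. \<one>\<^bsub>X\<^esub>)"
  by (simp add: Fact_def)

lemma pow_Fact:
  "f [^]\<^bsub>Fact G X\<^esub> (n::nat) = (\<lambda>i\<in>carrier G \<times> carrier G. f i [^]\<^bsub>X\<^esub> n)"
  by (induction n) (auto simp: mult_Fact one_Fact restrict_def fun_eq_iff)

lemma coboundary_apply:
  "a \<in> carrier G \<Longrightarrow> b \<in> carrier G \<Longrightarrow>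
    coboundary G X g (a, b) = g a \<otimes>\<^bsub>X\<^esub> g b \<otimes>\<^bsub>X\<^esub> inv\<^bsub>X\<^esub> (g (a \<otimes>\<^bsub>G\<^esub> b))"
  by (simp add: coboundary_def)

lemma cocycle_ext:
  assumes "f \<in> carrier G \<times> carrier G \<rightarrow>\<^sub>E A" "g \<in> carrier G \<times> carrier G \<rightarrow>\<^sub>E B"
    and "\<And>a b. a \<in> carrier G \<Longrightarrow> b \<in> carrier G \<Longrightarrow> f (a, b) = g (a, b)"
  shows "f = g"
  using assms by (intro PiE_ext[where k = "carrier G \<times> carrier G"]) (auto simp: PiE_iff extensional_def)

lemma coboundary_cocycle:
  assumes G: "comm_group G" and X: "comm_group X" and g: "g \<in> cochains G X"
  shows "coboundary G X g \<in> cocycles G X"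
proof -
  interpret G: comm_group G by fact
  interpret X: comm_group X by fact
  note gc = cochain_closed[OF g]
  have g1: "g \<one>\<^bsub>G\<^esub> = \<one>\<^bsub>X\<^esub>" using g by (simp add: cochains_def)
  have *: "x \<otimes>\<^bsub>X\<^esub> y \<otimes>\<^bsub>X\<^esub> inv\<^bsub>X\<^esub> u \<otimes>\<^bsub>X\<^esub> (u \<otimes>\<^bsub>X\<^esub> z \<otimes>\<^bsub>X\<^esub> inv\<^bsub>X\<^esub> w) = x \<otimes>\<^bsub>X\<^esub> y \<otimes>\<^bsub>X\<^esub> z \<otimes>\<^bsub>X\<^esub> inv\<^bsub>X\<^esub> w"
    if "x \<in> carrier X" "y \<in> carrier X" "z \<in> carrier X" "u \<in> carrier X" "w \<in> carrier X"
    for x y z u w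
    by (metis (no_types, lifting) that X.inv_closed X.inv_solve_right' X.m_assoc X.m_closed)
  have 1: "coboundary G X g (a, b) \<otimes>\<^bsub>X\<^esub> coboundary G X g (a \<otimes>\<^bsub>G\<^esub> b, c)
      = g a \<otimes>\<^bsub>X\<^esub> g b \<otimes>\<^bsub>X\<^esub> g c \<otimes>\<^bsub>X\<^esub> inv\<^bsub>X\<^esub> (g (a \<otimes>\<^bsub>G\<^esub> b \<otimes>\<^bsub>G\<^esub> c))"
    if "a \<in> carrier G" "b \<in> carrier G" "c \<in> carrier G" for a b c
    using that gc by (simp add: coboundary_apply *)
  have s: "coboundary G X g (a, b) = coboundary G X g (b, a)"
    if "a \<in> carrier G" "b \<in> carrier G" for a b
    using that gc by (simp add: coboundary_apply X.m_comm G.m_comm)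
  have "coboundary G X g (a, b) \<otimes>\<^bsub>X\<^esub> coboundary G X g (a \<otimes>\<^bsub>G\<^esub> b, c)
     = coboundary G X g (b, c) \<otimes>\<^bsub>X\<^esub> coboundary G X g (a, b \<otimes>\<^bsub>G\<^esub> c)"
    if "a \<in> carrier G" "b \<in> carrier G" "c \<in> carrier G" for a b c
    using 1[of a b c] 1[of b c a] s[of a "b \<otimes>\<^bsub>G\<^esub> c"] that gc
    by (simp add: X.m_ac G.m_ac)
  moreover have "coboundary G X g \<in> carrier G \<times> carrier G \<rightarrow>\<^sub>E carrier X"
    using gc by (auto simp: coboundary_def)
  moreover have "coboundary G X g (a, \<one>\<^bsub>G\<^esub>) = \<one>\<^bsub>X\<^esub> \<and> coboundary G X g (\<one>\<^bsub>G\<^esub>, a) = \<one>\<^bsub>X\<^esub>"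
    if "a \<in> carrier G" for a
    using that gc g1 by (simp add: coboundary_apply X.r_inv)
  ultimately show ?thesis unfolding mem_cocycles by (intro conjI ballI s) simp_all
qed

lemma subgroup_coboundaries:
  assumes G: "comm_group G" and X: "comm_group X"
  shows "subgroup (coboundary G X ` cochains G X) (Fact G X)"
proof -
  interpret G: comm_group G by fact
  interpret X: comm_group X by fact
  interpret F: comm_group "Fact G X" by (rule comm_group_Fact[OF assms])
  have cl: "coboundary G X g \<in> carrier (Fact G X)" if "g \<in> cochains G X" for g
    using coboundary_cocycle[OF G X that] by (simp add: carrier_Fact)
  have mult: "coboundary G X g \<otimes>\<^bsub>Fact G X\<^esub> coboundary G X h
      = coboundary G X (\<lambda>a\<in>carrier G. g a \<otimes>\<^bsub>X\<^esub> h a)"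
    if g: "g \<in> cochains G X" and h: "h \<in> cochains G X" for g h
  proof -
    have "(u \<otimes>\<^bsub>X\<^esub> v \<otimes>\<^bsub>X\<^esub> inv\<^bsub>X\<^esub> w) \<otimes>\<^bsub>X\<^esub> (u' \<otimes>\<^bsub>X\<^esub> v' \<otimes>\<^bsub>X\<^esub> inv\<^bsub>X\<^esub> w') =
        (u \<otimes>\<^bsub>X\<^esub> u') \<otimes>\<^bsub>X\<^esub> (v \<otimes>\<^bsub>X\<^esub> v') \<otimes>\<^bsub>X\<^esub> inv\<^bsub>X\<^esub> (w \<otimes>\<^bsub>X\<^esub> w')"
      if "u \<in> carrier X" "v \<in> carrier X" "w \<in> carrier X"
        "u' \<in> carrier X" "v' \<in> carrier X" "w' \<in> carrier X" for u v w u' v' w'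
      using that by (simp add: X.inv_mult X.m_ac)
    then show ?thesis
      using cochain_closed[OF g] cochain_closed[OF h]
      by (auto simp: mult_Fact coboundary_def fun_eq_iff restrict_def)
  qed
  have mem: "(\<lambda>a\<in>carrier G. g a \<otimes>\<^bsub>X\<^esub> h a) \<in> cochains G X"
    if "g \<in> cochains G X" "h \<in> cochains G X" for g h
    using that by (auto simp: cochains_def)
  have memi: "(\<lambda>a\<in>carrier G. inv\<^bsub>X\<^esub> g a) \<in> cochains G X" if "g \<in> cochains G X" for g
    using that by (auto simp: cochains_def)
  have one: "(\<lambda>a\<in>carrier G. \<one>\<^bsub>X\<^esub>) \<in> cochains G X" by (auto simp: cochains_def)
  have cob1: "coboundary G X (\<lambda>a\<in>carrier G. \<one>\<^bsub>X\<^esub>) = \<one>\<^bsub>Fact G X\<^esub>"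
    by (auto simp: one_Fact coboundary_def fun_eq_iff restrict_def)
  show ?thesis
  proof (rule F.subgroupI)
    show "coboundary G X ` cochains G X \<subseteq> carrier (Fact G X)" using cl by blast
    show "coboundary G X ` cochains G X \<noteq> {}" using one by blast
  next
    fix c assume "c \<in> coboundary G X ` cochains G X"
    then obtain g where g: "g \<in> cochains G X" and c: "c = coboundary G X g" by blast
    let ?i = "\<lambda>a\<in>carrier G. inv\<^bsub>X\<^esub> g a"
    have e: "(\<lambda>a\<in>carrier G. ?i a \<otimes>\<^bsub>X\<^esub> g a) = (\<lambda>a\<in>carrier G. \<one>\<^bsub>X\<^esub>)"
      using cochain_closed[OF g] by (auto simp: fun_eq_iff restrict_def X.l_inv)
    have "coboundary G X ?i \<otimes>\<^bsub>Fact G X\<^esub> c = \<one>\<^bsub>Fact G X\<^esub>"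
      unfolding c mult[OF memi[OF g] g] e cob1 ..
    then have "inv\<^bsub>Fact G X\<^esub> c = coboundary G X ?i"
      by (intro F.inv_equality) (use cl g memi c in auto)
    then show "inv\<^bsub>Fact G X\<^esub> c \<in> coboundary G X ` cochains G X" using memi[OF g] by simp
  next
    fix c d assume "c \<in> coboundary G X ` cochains G X" "d \<in> coboundary G X ` cochains G X"
    then show "c \<otimes>\<^bsub>Fact G X\<^esub> d \<in> coboundary G X ` cochains G X"
      using mult mem by fastforce
  qed
qed

lemma comm_group_Ext: "comm_group G \<Longrightarrow> comm_group X \<Longrightarrow> comm_group (Ext G X)"
  unfolding Ext_def
  by (intro comm_group.abelian_FactGroup comm_group_Fact subgroup_coboundaries)

lemma p_omega_plus_1_Ext_iff:
  assumes G: "comm_group G" and X: "comm_group X"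
  shows "p_omega_plus_1 p (Ext G X) = {\<one>\<^bsub>Ext G X\<^esub>} \<longleftrightarrow>
    (\<forall>f h g. f \<in> cocycles G X \<longrightarrow>
      (\<forall>n::nat. h n \<in> cocycles G X \<and> g n \<in> cochains G X \<and>
        (\<forall>a\<in>carrier G. \<forall>b\<in>carrier G.
          f (a, b) = coboundary G X (g n) (a, b) \<otimes>\<^bsub>X\<^esub> h n (a, b) [^]\<^bsub>X\<^esub> (p ^ n))) \<longrightarrow>
      (\<exists>k\<in>cochains G X. \<forall>a\<in>carrier G. \<forall>b\<in>carrier G.
        f (a, b) [^]\<^bsub>X\<^esub> p = coboundary G X k (a, b)))"
    (is "?L \<longleftrightarrow> ?R")
proof -
  interpret X: comm_group X by fact
  interpret F: comm_group "Fact G X" by (rule comm_group_Fact[OF assms])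
  let ?B = "coboundary G X ` cochains G X"
  interpret B: normal ?B "Fact G X"
    by (rule F.subgroup_imp_normal[OF subgroup_coboundaries[OF assms]])
  interpret E: comm_group "Ext G X" by (rule comm_group_Ext[OF assms])
  have sub: "subgroup ?B (Fact G X)" by (rule subgroup_coboundaries[OF assms])
  have powE: "(?B #>\<^bsub>Fact G X\<^esub> f) [^]\<^bsub>Ext G X\<^esub> (n::nat) = ?B #>\<^bsub>Fact G X\<^esub> (f [^]\<^bsub>Fact G X\<^esub> n)"
    if "f \<in> cocycles G X" for f n
    using that B.FactGroup_pow[of f n] by (simp add: Ext_def carrier_Fact)
  have carE: "carrier (Ext G X) = (\<lambda>f. ?B #>\<^bsub>Fact G X\<^esub> f) ` cocycles G X"
    by (simp add: Ext_def carrier_FactGroup carrier_Fact)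
  have powc: "f [^]\<^bsub>Fact G X\<^esub> (n::nat) \<in> cocycles G X" if "f \<in> cocycles G X" for f n
    using F.nat_pow_closed[of f n] that by (simp add: carrier_Fact)
  have coseteq: "?B #>\<^bsub>Fact G X\<^esub> f = ?B #>\<^bsub>Fact G X\<^esub> h \<longleftrightarrow>
      (\<exists>g\<in>cochains G X. \<forall>a\<in>carrier G. \<forall>b\<in>carrier G.
        f (a, b) = coboundary G X g (a, b) \<otimes>\<^bsub>X\<^esub> h (a, b))"
    if f: "f \<in> cocycles G X" and h: "h \<in> cocycles G X" for f h
  proof -
    have "?B #>\<^bsub>Fact G X\<^esub> f = ?B #>\<^bsub>Fact G X\<^esub> h \<longleftrightarrow> f \<in> ?B #>\<^bsub>Fact G X\<^esub> h"
      using F.repr_independence[OF _ _ sub] F.rcos_self[OF _ sub] f h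
      by (metis carrier_Fact)
    also have "\<dots> \<longleftrightarrow> (\<exists>g\<in>cochains G X. f = coboundary G X g \<otimes>\<^bsub>Fact G X\<^esub> h)"
      by (auto simp: r_coset_def)
    also have "\<dots> \<longleftrightarrow> (\<exists>g\<in>cochains G X. \<forall>a\<in>carrier G. \<forall>b\<in>carrier G.
        f (a, b) = coboundary G X g (a, b) \<otimes>\<^bsub>X\<^esub> h (a, b))"
    proof (rule bex_cong[OF refl])
      fix g assume g: "g \<in> cochains G X"
      have "coboundary G X g \<otimes>\<^bsub>Fact G X\<^esub> h \<in> carrier (Fact G X)"
        using coboundary_cocycle[OF G X g] h by (intro F.m_closed) (auto simp: carrier_Fact)
      then have "coboundary G X g \<otimes>\<^bsub>Fact G X\<^esub> h \<in> carrier G \<times> carrier G \<rightarrow>\<^sub>E carrier X"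
        by (simp add: carrier_Fact mem_cocycles)
      moreover have "f \<in> carrier G \<times> carrier G \<rightarrow>\<^sub>E carrier X" using f by (simp add: mem_cocycles)
      ultimately have "f = coboundary G X g \<otimes>\<^bsub>Fact G X\<^esub> h \<longleftrightarrow>
          (\<forall>a\<in>carrier G. \<forall>b\<in>carrier G. f (a, b) = (coboundary G X g \<otimes>\<^bsub>Fact G X\<^esub> h) (a, b))"
        using cocycle_ext by metis
      then show "f = coboundary G X g \<otimes>\<^bsub>Fact G X\<^esub> h \<longleftrightarrow> (\<forall>a\<in>carrier G. \<forall>b\<in>carrier G.
          f (a, b) = coboundary G X g (a, b) \<otimes>\<^bsub>X\<^esub> h (a, b))"
        by (simp add: mult_Fact)
    qed
    finally show ?thesis .
  qed
  have omega: "?B #>\<^bsub>Fact G X\<^esub> f \<in> p_omega p (Ext G X) \<longleftrightarrow>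
      (\<forall>n::nat. \<exists>h\<in>cocycles G X. \<exists>g\<in>cochains G X. \<forall>a\<in>carrier G. \<forall>b\<in>carrier G.
          f (a, b) = coboundary G X g (a, b) \<otimes>\<^bsub>X\<^esub> h (a, b) [^]\<^bsub>X\<^esub> (p ^ n))"
    if f: "f \<in> cocycles G X" for f
  proof -
    have "?B #>\<^bsub>Fact G X\<^esub> f \<in> p_omega p (Ext G X) \<longleftrightarrow>
       (\<forall>n::nat. \<exists>h\<in>cocycles G X. ?B #>\<^bsub>Fact G X\<^esub> f = ?B #>\<^bsub>Fact G X\<^esub> (h [^]\<^bsub>Fact G X\<^esub> (p ^ n)))"
      by (auto simp: p_omega_def carE powE image_iff)
    then show ?thesis using f powc by (simp add: coseteq pow_Fact)
  qed
  have triv: "?B #>\<^bsub>Fact G X\<^esub> (f [^]\<^bsub>Fact G X\<^esub> p) = \<one>\<^bsub>Ext G X\<^esub> \<longleftrightarrow>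
      (\<exists>k\<in>cochains G X. \<forall>a\<in>carrier G. \<forall>b\<in>carrier G. f (a, b) [^]\<^bsub>X\<^esub> p = coboundary G X k (a, b))"
    if f: "f \<in> cocycles G X" for f
  proof -
    have o: "\<one>\<^bsub>Fact G X\<^esub> \<in> cocycles G X" using F.one_closed by (simp add: carrier_Fact)
    have "\<one>\<^bsub>Ext G X\<^esub> = ?B #>\<^bsub>Fact G X\<^esub> \<one>\<^bsub>Fact G X\<^esub>"
      by (simp add: Ext_def F.coset_mult_one B.subset)
    then have "?B #>\<^bsub>Fact G X\<^esub> (f [^]\<^bsub>Fact G X\<^esub> p) = \<one>\<^bsub>Ext G X\<^esub> \<longleftrightarrow>
      (\<exists>k\<in>cochains G X. \<forall>a\<in>carrier G. \<forall>b\<in>carrier G.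
         (f [^]\<^bsub>Fact G X\<^esub> p) (a, b) = coboundary G X k (a, b) \<otimes>\<^bsub>X\<^esub> \<one>\<^bsub>Fact G X\<^esub> (a, b))"
      using coseteq[OF powc[OF f] o] by simp
    moreover have "coboundary G X k (a, b) \<in> carrier X"
      if "k \<in> cochains G X" "a \<in> carrier G" "b \<in> carrier G" for k a b
      using cocycle_closed[OF coboundary_cocycle[OF G X]] that by blast
    ultimately show ?thesis by (simp add: pow_Fact one_Fact cong: bex_cong)
  qed
  have one: "\<one>\<^bsub>Ext G X\<^esub> \<in> p_omega p (Ext G X)"
    unfolding p_omega_def by (auto intro!: image_eqI[where x = "\<one>\<^bsub>Ext G X\<^esub>"])
  have "?L \<longleftrightarrow> (\<forall>x\<in>p_omega p (Ext G X). x [^]\<^bsub>Ext G X\<^esub> p = \<one>\<^bsub>Ext G X\<^esub>)"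
    unfolding p_omega_plus_1_def using one by (auto simp: image_iff)
  also have "\<dots> \<longleftrightarrow> (\<forall>f\<in>cocycles G X. ?B #>\<^bsub>Fact G X\<^esub> f \<in> p_omega p (Ext G X) \<longrightarrow>
      ?B #>\<^bsub>Fact G X\<^esub> (f [^]\<^bsub>Fact G X\<^esub> p) = \<one>\<^bsub>Ext G X\<^esub>)"
  proof -
    have "p_omega p (Ext G X) \<subseteq> carrier (Ext G X)"
      unfolding p_omega_def by (rule order_trans[OF INT_lower[of 0]]) auto
    then show ?thesis using powE by (auto simp: carE)
  qed
  also have "\<dots> \<longleftrightarrow> ?R"
  proof -
    have choice2: "(\<forall>n::nat. \<exists>h\<in>C. \<exists>g\<in>K. P n h g) \<longleftrightarrow>
        (\<exists>h g. \<forall>n. h n \<in> C \<and> g n \<in> K \<and> P n (h n) (g n))" for C K P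
      by (simp only: Bex_def choice_iff flip: ex_simps)
    show ?thesis by (simp add: omega triv choice2 Ball_def)
  qed
  finally show ?thesis .
qed

text \<open>Independence of the type. The values of the factor sets and cochains that witness a
  non-zero element of \<open>p\<^sup>\<omega>\<^sup>+\<^sup>1 Ext(G, Y)\<close> generate a subgroup of \<open>Y\<close> whose elements are named by
  words over \<open>'a \<times> int\<close>; two consecutive letters name one generator.\<close>

context
  fixes Y :: "('y, 'z) monoid_scheme" and s :: "'s \<Rightarrow> 's \<Rightarrow> 'y"
begin

fun eval_word :: "'s list \<Rightarrow> 'y" where
  "eval_word (x # y # w) = s x y \<otimes>\<^bsub>Y\<^esub> eval_word w"
| "eval_word _ = \<one>\<^bsub>Y\<^esub>"

context
  assumes Y: "comm_group Y" and s: "\<And>x y. s x y \<in> carrier Y"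
    and inv: "\<And>x y. \<exists>x' y'. s x' y' = inv\<^bsub>Y\<^esub> (s x y)"
begin

interpretation Y: comm_group Y by (rule Y)

lemma eval_word_closed: "eval_word w \<in> carrier Y"
  by (induction w rule: eval_word.induct) (auto simp: s)

lemma eval_word_append:
  "even (length v) \<Longrightarrow> eval_word (v @ w) = eval_word v \<otimes>\<^bsub>Y\<^esub> eval_word w"
  by (induction v rule: eval_word.induct) (auto simp: s eval_word_closed Y.m_assoc)

lemma eval_word_inv:
  "\<exists>v. even (length v) \<and> eval_word v = inv\<^bsub>Y\<^esub> (eval_word w)"
proof (induction w rule: eval_word.induct)
  case (1 x y w)
  then obtain v where v: "even (length v)" "eval_word v = inv\<^bsub>Y\<^esub> (eval_word w)" by blast
  obtain x' y' where "s x' y' = inv\<^bsub>Y\<^esub> (s x y)" using inv by blast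
  with v have "even (length (x' # y' # v)) \<and> eval_word (x' # y' # v) = inv\<^bsub>Y\<^esub> (eval_word (x # y # w))"
    by (simp add: Y.inv_mult s eval_word_closed)
  then show ?case by blast
qed (auto intro: exI[of _ "[]"])

lemma words_group:
  obtains X :: "'s list monoid" where
    "comm_group X" "eval_word \<in> hom X Y" "inj_on eval_word (carrier X)"
    "\<And>x y. s x y \<in> eval_word ` carrier X"
proof -
  define H where "H = eval_word ` {w. even (length w)}"
  define nm where "nm y = (SOME w. even (length w) \<and> eval_word w = y)" for y
  have nm: "even (length (nm y))" "eval_word (nm y) = y" if "y \<in> H" for y
    using someI_ex[of "\<lambda>w. even (length w) \<and> eval_word w = y"] that
    unfolding H_def nm_def by blast+
  have H: "subgroup H Y"
  proof (rule Y.subgroupI)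
    show "H \<subseteq> carrier Y" by (auto simp: H_def eval_word_closed)
    show "H \<noteq> {}" by (auto simp: H_def intro: exI[of _ "[]"])
    show "inv\<^bsub>Y\<^esub> a \<in> H" if "a \<in> H" for a
    proof -
      from that obtain w where "a = eval_word w" by (auto simp: H_def)
      moreover obtain v where "even (length v)" "eval_word v = inv\<^bsub>Y\<^esub> (eval_word w)"
        using eval_word_inv by blast
      ultimately show ?thesis unfolding H_def by (intro image_eqI[where x = v]) auto
    qed
    show "a \<otimes>\<^bsub>Y\<^esub> b \<in> H" if "a \<in> H" "b \<in> H" for a b
    proof -
      from that obtain v w where "a = eval_word v" "b = eval_word w"
        "even (length v)" "even (length w)" by (auto simp: H_def)
      then have "a \<otimes>\<^bsub>Y\<^esub> b = eval_word (v @ w)" "even (length (v @ w))"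
        by (simp_all add: eval_word_append)
      then show ?thesis unfolding H_def by blast
    qed
  qed
  interpret H: subgroup H Y by (rule H)
  define X where "X = \<lparr>carrier = nm ` H,
    monoid.mult = (\<lambda>u v. nm (eval_word u \<otimes>\<^bsub>Y\<^esub> eval_word v)), one = nm \<one>\<^bsub>Y\<^esub>\<rparr>"
  have "comm_group X"
  proof (rule comm_groupI)
    show "\<exists>y\<in>carrier X. y \<otimes>\<^bsub>X\<^esub> x = \<one>\<^bsub>X\<^esub>" if "x \<in> carrier X" for x
    proof -
      from that obtain a where a: "a \<in> H" "x = nm a" by (auto simp: X_def)
      then have "nm (inv\<^bsub>Y\<^esub> a) \<otimes>\<^bsub>X\<^esub> x = \<one>\<^bsub>X\<^esub>" by (simp add: X_def nm)
      then show ?thesis using a by (auto simp: X_def)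
    qed
  qed (auto simp: X_def nm Y.m_ac)
  moreover have "eval_word \<in> hom X Y" by (auto simp: hom_def X_def nm eval_word_closed)
  moreover have "inj_on eval_word (carrier X)" by (auto simp: inj_on_def X_def nm)
  moreover have "s x y \<in> eval_word ` carrier X" for x y
  proof -
    have "s x y = eval_word [x, y]" by (simp add: s)
    then have "s x y \<in> H" unfolding H_def by (intro image_eqI[where x = "[x, y]"]) auto
    then show ?thesis by (auto simp: X_def nm image_image)
  qed
  ultimately show thesis by (rule that)
qed

end

end

lemma p_omega_plus_1_Ext_eq_one:
  fixes G :: "('a, 'b) monoid_scheme" and Y :: "('y, 'z) monoid_scheme"
  assumes G: "comm_group G" and Y: "comm_group Y" and proj: "p_omega_plus_1_projective p G"
  shows "p_omega_plus_1 p (Ext G Y) = {\<one>\<^bsub>Ext G Y\<^esub>}"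
  unfolding p_omega_plus_1_Ext_iff[OF G Y]
proof (intro allI impI)
  interpret G: comm_group G by fact
  interpret Y: comm_group Y by fact
  fix f and h :: "nat \<Rightarrow> 'a \<times> 'a \<Rightarrow> 'y" and g :: "nat \<Rightarrow> 'a \<Rightarrow> 'y"
  assume f: "f \<in> cocycles G Y"
    and hg: "\<forall>n::nat. h n \<in> cocycles G Y \<and> g n \<in> cochains G Y \<and>
        (\<forall>a\<in>carrier G. \<forall>b\<in>carrier G.
          f (a, b) = coboundary G Y (g n) (a, b) \<otimes>\<^bsub>Y\<^esub> h n (a, b) [^]\<^bsub>Y\<^esub> (p ^ n))"
  define t where "t a i b k = (if a \<in> carrier G \<and> b \<in> carrier G then
      (if k = 0 then f (a, b) else if k = 1 then h (nat i) (a, b) else g (nat i) a) else \<one>\<^bsub>Y\<^esub>)"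
    for a :: 'a and i :: int and b :: 'a and k :: int
  have t: "t a i b k \<in> carrier Y" for a i b k
    using cocycle_closed[OF f] cocycle_closed[of "h _" G Y] cochain_closed[of "g _" G Y] hg
    by (auto simp: t_def)
  define s where "s x y = (if snd y \<ge> 0 then t (fst x) (snd x) (fst y) (snd y)
      else inv\<^bsub>Y\<^esub> (t (fst x) (snd x) (fst y) (- 1 - snd y)))" for x y :: "'a \<times> int"
  have sc: "s x y \<in> carrier Y" for x y by (simp add: s_def t)
  have si: "\<exists>x' y'. s x' y' = inv\<^bsub>Y\<^esub> (s x y)" for x y
  proof -
    have "s x (fst y, - 1 - snd y) = inv\<^bsub>Y\<^esub> (s x y)" by (auto simp: s_def t)
    then show ?thesis by blast
  qed
  obtain X :: "('a \<times> int) list monoid" where X: "comm_group X"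
    and hom: "eval_word Y s \<in> hom X Y" and inj: "inj_on (eval_word Y s) (carrier X)"
    and im: "\<And>x y. s x y \<in> eval_word Y s ` carrier X"
    using words_group[OF Y sc si] by blast
  interpret X: comm_group X by (rule X)
  define e where "e = eval_word Y s"
  interpret e: group_hom X Y e
    using hom by unfold_locales (simp add: e_def)
  define d where "d = the_inv_into (carrier X) e"
  have ti: "t a i b k \<in> e ` carrier X" if "k \<ge> 0" for a i b k
    using im[of "(a, i)" "(b, k)"] that by (simp add: s_def e_def)
  have dc: "d y \<in> carrier X" if "y \<in> e ` carrier X" for y
    unfolding d_def using the_inv_into_into[OF _ that, of "carrier X"] inj by (auto simp: e_def)
  have ed: "e (d y) = y" if "y \<in> e ` carrier X" for y
    unfolding d_def using f_the_inv_into_f[of e "carrier X"] that inj by (auto simp: e_def)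
  have eI: "x = y" if "e x = e y" "x \<in> carrier X" "y \<in> carrier X" for x y
    using inj that by (auto simp: e_def inj_on_def)
  have fi: "f (a, b) \<in> e ` carrier X" if "a \<in> carrier G" "b \<in> carrier G" for a b
    using ti[of 0 a 0 b] that by (simp add: t_def)
  have hi: "h n (a, b) \<in> e ` carrier X" if "a \<in> carrier G" "b \<in> carrier G" for n a b
    using ti[of 1 a "int n" b] that by (simp add: t_def)
  have gi: "g n a \<in> e ` carrier X" if "a \<in> carrier G" for n a
    using ti[of 2 a "int n" a] that by (simp add: t_def)
  define lift where "lift c = (\<lambda>z\<in>carrier G \<times> carrier G. d (c z))" for c :: "'a \<times> 'a \<Rightarrow> 'y"
  define lift1 where "lift1 c = (\<lambda>a\<in>carrier G. d (c a))" for c :: "'a \<Rightarrow> 'y"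
  have lift: "lift c \<in> cocycles G X"
    if c: "c \<in> cocycles G Y"
      and ci: "\<And>a b. a \<in> carrier G \<Longrightarrow> b \<in> carrier G \<Longrightarrow> c (a, b) \<in> e ` carrier X" for c
    unfolding mem_cocycles
  proof (intro conjI ballI)
    show "lift c \<in> carrier G \<times> carrier G \<rightarrow>\<^sub>E carrier X" using ci by (auto simp: lift_def dc)
    show "lift c (a, \<one>\<^bsub>G\<^esub>) = \<one>\<^bsub>X\<^esub>" "lift c (\<one>\<^bsub>G\<^esub>, a) = \<one>\<^bsub>X\<^esub>" if "a \<in> carrier G" for a
      using that ci[of a "\<one>\<^bsub>G\<^esub>"] ci[of "\<one>\<^bsub>G\<^esub>" a] c
      by (auto simp: lift_def dc ed mem_cocycles intro!: eI)
    show "lift c (a, b) = lift c (b, a)" if "a \<in> carrier G" "b \<in> carrier G" for a b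
      using that c by (auto simp: lift_def mem_cocycles)
    show "lift c (a, b) \<otimes>\<^bsub>X\<^esub> lift c (a \<otimes>\<^bsub>G\<^esub> b, x) = lift c (b, x) \<otimes>\<^bsub>X\<^esub> lift c (a, b \<otimes>\<^bsub>G\<^esub> x)"
      if "a \<in> carrier G" "b \<in> carrier G" "x \<in> carrier G" for a b x
    proof -
      have "c (a, b) \<otimes>\<^bsub>Y\<^esub> c (a \<otimes>\<^bsub>G\<^esub> b, x) = c (b, x) \<otimes>\<^bsub>Y\<^esub> c (a, b \<otimes>\<^bsub>G\<^esub> x)"
        using c that unfolding mem_cocycles by blast
      then show ?thesis using that ci by (intro eI) (simp_all add: lift_def dc ed)
    qed
  qed
  have lift1: "lift1 (g n) \<in> cochains G X" for n
  proof -
    have "g n \<one>\<^bsub>G\<^esub> = \<one>\<^bsub>Y\<^esub>" using hg by (simp add: cochains_def)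
    then have "d (g n \<one>\<^bsub>G\<^esub>) = \<one>\<^bsub>X\<^esub>" using gi[of "\<one>\<^bsub>G\<^esub>" n] by (intro eI) (simp_all add: ed dc)
    then show ?thesis using gi by (auto simp: cochains_def lift1_def dc)
  qed
  have cob: "e (coboundary G X k (a, b)) = coboundary G Y (\<lambda>a\<in>carrier G. e (k a)) (a, b)"
    if "k \<in> cochains G X" "a \<in> carrier G" "b \<in> carrier G" for k a b
    using that cochain_closed[OF that(1)] by (simp add: coboundary_apply)
  have cobc: "coboundary G X k (a, b) \<in> carrier X"
    if "k \<in> cochains G X" "a \<in> carrier G" "b \<in> carrier G" for k a b
    using cocycle_closed[OF coboundary_cocycle[OF G X]] that by blast
  have "lift f (a, b) = coboundary G X (lift1 (g n)) (a, b) \<otimes>\<^bsub>X\<^esub> lift (h n) (a, b) [^]\<^bsub>X\<^esub> (p ^ n)"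
    if ab: "a \<in> carrier G" "b \<in> carrier G" for n a b
  proof (rule eI)
    have "e (coboundary G X (lift1 (g n)) (a, b)) = coboundary G Y (g n) (a, b)"
      using ab gi by (simp add: coboundary_apply lift1_def ed dc)
    moreover have "e (lift (h n) (a, b) [^]\<^bsub>X\<^esub> (p ^ n)) = h n (a, b) [^]\<^bsub>Y\<^esub> (p ^ n)"
      using ab hi by (simp add: e.hom_nat_pow lift_def dc ed)
    moreover have "e (lift f (a, b)) = f (a, b)" using ab fi by (simp add: lift_def ed)
    moreover have "f (a, b) = coboundary G Y (g n) (a, b) \<otimes>\<^bsub>Y\<^esub> h n (a, b) [^]\<^bsub>Y\<^esub> (p ^ n)"
      using hg ab by blast
    ultimately show "e (lift f (a, b)) =
        e (coboundary G X (lift1 (g n)) (a, b) \<otimes>\<^bsub>X\<^esub> lift (h n) (a, b) [^]\<^bsub>X\<^esub> (p ^ n))"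
      using ab hi by (simp add: cobc[OF lift1] lift_def dc)
  qed (use ab fi hi in \<open>simp_all add: cobc[OF lift1] lift_def dc\<close>)
  moreover have "lift f \<in> cocycles G X" by (rule lift[OF f fi])
  moreover have "lift (h n) \<in> cocycles G X" for n using hg by (intro lift hi) blast
  moreover have "p_omega_plus_1 p (Ext G X) = {\<one>\<^bsub>Ext G X\<^esub>}"
    using proj X unfolding p_omega_plus_1_projective_def by blast
  ultimately have "\<exists>k\<in>cochains G X. \<forall>a\<in>carrier G. \<forall>b\<in>carrier G.
      lift f (a, b) [^]\<^bsub>X\<^esub> p = coboundary G X k (a, b)"
    using lift1
    by (intro p_omega_plus_1_Ext_iff[OF G X, THEN iffD1, THEN spec, THEN spec, THEN spec,
        THEN mp, THEN mp, of p "lift f" "\<lambda>n. lift (h n)" "\<lambda>n. lift1 (g n)"]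
        allI conjI ballI)
  then obtain k where k: "k \<in> cochains G X"
    and keq: "\<And>a b. a \<in> carrier G \<Longrightarrow> b \<in> carrier G \<Longrightarrow>
      lift f (a, b) [^]\<^bsub>X\<^esub> p = coboundary G X k (a, b)"
    by blast
  have "(\<lambda>a\<in>carrier G. e (k a)) \<in> cochains G Y"
    using k cochain_closed[OF k] by (auto simp: cochains_def)
  moreover have "f (a, b) [^]\<^bsub>Y\<^esub> p = coboundary G Y (\<lambda>a\<in>carrier G. e (k a)) (a, b)"
    if ab: "a \<in> carrier G" "b \<in> carrier G" for a b
  proof -
    have "e (lift f (a, b) [^]\<^bsub>X\<^esub> p) = f (a, b) [^]\<^bsub>Y\<^esub> p"
      using ab fi by (simp add: e.hom_nat_pow lift_def dc ed)
    then show ?thesis using keq[OF ab] cob[OF k ab] by simp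
  qed
  ultimately show "\<exists>k\<in>cochains G Y. \<forall>a\<in>carrier G. \<forall>b\<in>carrier G.
      f (a, b) [^]\<^bsub>Y\<^esub> p = coboundary G Y k (a, b)" by blast
qed

end

theory Submission
  imports Defs "HOL-Algebra.Free_Abelian_Groups" "HOL-Algebra.Multiplicative_Group"
begin

text \<open>Nunke's criterion is used in the following elementwise form: \<open>G\<close> is \<open>p\<^bsup>\<omega>+1\<^esup>\<close>-projective iff for some
  \<open>E \<le> G[p]\<close> the socle of \<open>G/E\<close> is the union of an ascending chain of subgroups with bounded heights
  (Kulikov). If so, \<open>G/E\<close> is a direct sum of cyclic groups, hence multiplication by \<open>p\<close>, as a map
  \<open>G \<rightarrow> G/E \<rightarrow> G\<close>, lifts to every extension of \<open>G\<close> whose class lies in \<open>p\<^sup>\<omega> Ext\<close>. Conversely, embed \<open>G\<close> in a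
  divisible group \<open>D\<close>; the pullback of \<open>0 \<rightarrow> \<Oplus>\<^sub>i D[p\<^sup>i] \<rightarrow> \<Oplus>\<^sub>i D \<rightarrow> \<Oplus>\<^sub>i D \<rightarrow> 0\<close>, with \<open>p\<^sup>i\<close> in the
  \<open>i\<close>-th component, along \<open>g \<mapsto> (p\<^sup>i g)\<^sub>i\<close> lies in \<open>p\<^sup>\<omega> Ext\<close>, and a splitting of its \<open>p\<close>-fold gives \<open>E\<close> and
  the chain.

  The criterion passes to subgroups. It passes from a large subgroup \<open>L\<close> to \<open>G\<close>, with the same \<open>E\<close>, since by
  Pierce \<open>(p\<^sup>k G)[p\<^sup>n] \<subseteq> L\<close> for all \<open>n\<close> and large \<open>k\<close>: elements of large height in the socle of \<open>G/E\<close>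
  already belong to \<open>L/E\<close>, with heights that are large there.\<close>

text \<open>The hypothesis \<open>G = L + B\<close> says nothing until basic subgroups are at hand,
  and they must contain prescribed elements. Therefore everything rests on one notion of finite
  character, \<open>pure_independent\<close>: a maximal such set generates a basic subgroup, a
  spanning one decomposes the group into cyclic summands, and in both cases a generator can be
  mapped to any element whose order divides its own.

  The role of \<open>p\<close> in the projectivity argument is that the \<open>p\<close>-fold of an
  extension is its pullback along multiplication by \<open>p\<close>, a map that kills
  \<open>E\<close>. In the other direction, splitting the \<open>p\<close>-fold of the test
  extension gives homomorphisms that agree with \<open>p j\<close> only up to
  \<open>p^i\<close>-torsion in component \<open>i\<close>. Consecutive differences cancel the
  common part \<open>p j\<close> and leave maps with bounded image; these are what bounds the
  heights.

  For the step from \<open>L\<close> to \<open>G\<close>, the chain of \<open>L\<close> does not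
  exhaust the socle of \<open>G/E\<close>. What is missing is a complement, inside that socle, of
  the elements of large height; it meets them trivially, so adding it to every member of the chain
  keeps the heights bounded.\<close>

section \<open>Maximality arguments and cyclic summands of p-groups\<close>

text \<open>The Teichmueller-Tukey lemma: a finite subset of the union of a chain already lies in
  one member. Maximality is stated for adding a single element, the form in which it is always
  applied.\<close>

lemma finite_character_maximal:
  assumes fin: "\<And>S. P S \<longleftrightarrow> (\<forall>F. finite F \<longrightarrow> F \<subseteq> S \<longrightarrow> P F)" and S: "P S"
  obtains T where "S \<subseteq> T" "P T" "\<And>x. P (insert x T) \<Longrightarrow> x \<in> T"
proof -
  let ?A = "{T. S \<subseteq> T \<and> P T}"
  have "\<exists>M\<in>?A. \<forall>X\<in>?A. M \<subseteq> X \<longrightarrow> X = M"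
  proof (rule subset_Zorn_nonempty)
    fix C assume C: "C \<noteq> {}" "subset.chain ?A C"
    have "P F" if F: "finite F" "F \<subseteq> \<Union>C" for F
    proof -
      obtain B where "B \<in> C" "F \<subseteq> B"
        using finite_subset_Union_chain[OF F C] by blast
      moreover have "P B" using \<open>B \<in> C\<close> C(2) by (auto simp: subset_chain_def)
      ultimately show ?thesis using fin[of B] F by blast
    qed
    then have "P (\<Union>C)" using fin[of "\<Union>C"] by blast
    moreover have "S \<subseteq> \<Union>C" using C unfolding subset_chain_def by blast
    ultimately show "\<Union>C \<in> ?A" by blast
  qed (use S in auto)
  then obtain T where T: "S \<subseteq> T" "P T" "\<And>X. S \<subseteq> X \<Longrightarrow> P X \<Longrightarrow> T \<subseteq> X \<Longrightarrow> X = T"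
    by auto
  then have "x \<in> T" if "P (insert x T)" for x
    using T(3)[of "insert x T"] that by blast
  with T show thesis using that by blast
qed

lemma generate_mono:
  assumes "x \<in> generate G S" "S \<subseteq> T" shows "x \<in> generate G T"
  using assms by induction (auto intro: generate.intros)

lemma generate_finite:
  assumes "x \<in> generate G S"
  obtains F where "finite F" "F \<subseteq> S" "x \<in> generate G F"
proof -
  from assms have "\<exists>F. finite F \<and> F \<subseteq> S \<and> x \<in> generate G F"
  proof induction
    case (eng x y)
    then obtain A B where "finite A" "A \<subseteq> S" "x \<in> generate G A"
      "finite B" "B \<subseteq> S" "y \<in> generate G B" by blast
    moreover have "generate G A \<subseteq> generate G (A \<union> B)" "generate G B \<subseteq> generate G (A \<union> B)"
      using generate_mono[of _ G A "A \<union> B"] generate_mono[of _ G B "A \<union> B"] by blast+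
    ultimately show ?case
      by (intro exI[of _ "A \<union> B"]) (auto intro: generate.eng)
  qed (auto intro: exI[of _ "{}"] exI[of _ "{_}"] generate.intros)
  then show thesis using that by blast
qed

context comm_group
begin

lemma subgroup_powers: "subgroup ((\<lambda>x. x [^] (n::nat)) ` carrier G) G"
proof (rule subgroupI)
  fix a b assume "a \<in> (\<lambda>x. x [^] n) ` carrier G" "b \<in> (\<lambda>x. x [^] n) ` carrier G"
  then obtain x y where "x \<in> carrier G" "y \<in> carrier G" "a = x [^] n" "b = y [^] n" by blast
  then have "inv a = inv x [^] n" "a \<otimes> b = (x \<otimes> y) [^] n" "inv x \<in> carrier G" "x \<otimes> y \<in> carrier G"
    by (simp_all add: nat_pow_inv nat_pow_distrib)
  then show "inv a \<in> (\<lambda>x. x [^] n) ` carrier G" "a \<otimes> b \<in> (\<lambda>x. x [^] n) ` carrier G" by blast+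
qed auto

lemma generate_insert:
  assumes "c \<in> carrier G" "S \<subseteq> carrier G" "x \<in> generate G (insert c S)"
  obtains b j where "b \<in> generate G S" "x = b \<otimes> c [^] (j::int)"
proof -
  note S = generate_is_subgroup[OF assms(2)]
  have sub: "subgroup (generate G S <#> generate G {c}) G"
    using assms by (intro mult_subgroups S generate_is_subgroup) auto
  have "insert c S \<subseteq> generate G S <#> generate G {c}"
  proof
    fix y assume "y \<in> insert c S"
    then have "y = \<one> \<otimes> c \<or> y \<in> S \<and> y = y \<otimes> \<one>" using assms by auto
    moreover have "\<one> \<in> generate G S" "c \<in> generate G {c}" "\<one> \<in> generate G {c}"
      "y \<in> S \<Longrightarrow> y \<in> generate G S"
      by (auto intro: generate.one generate.incl)
    ultimately show "y \<in> generate G S <#> generate G {c}"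
      unfolding set_mult_def by blast
  qed
  then have "x \<in> generate G S <#> generate G {c}"
    using generate_subgroup_incl[OF _ sub] assms(3) by blast
  then obtain b k where "b \<in> generate G S" "k \<in> generate G {c}" "x = b \<otimes> k"
    unfolding set_mult_def by blast
  moreover from this obtain j where "k = c [^] (j::int)"
    using generate_pow[OF assms(1)] by blast
  ultimately show thesis using that by blast
qed

lemma coprime_pow_mem:
  assumes M: "subgroup M G" and x: "x \<in> carrier G"
    and a: "x [^] (a::int) \<in> M" and b: "x [^] (b::int) \<in> M" and ab: "coprime a b"
  shows "x \<in> M"
proof -
  obtain u v where uv: "u * a + v * b = 1"
    using bezout_int[of a b] ab by (metis coprime_imp_gcd_eq_1)
  have "(x [^] a) [^] u \<otimes> (x [^] b) [^] v \<in> M"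
    by (rule subgroup.m_closed[OF M subgroup_int_pow_closed[OF M a] subgroup_int_pow_closed[OF M b]])
  also have "(x [^] a) [^] u \<otimes> (x [^] b) [^] v = x [^] (u * a + v * b)"
    using x by (simp add: int_pow_pow int_pow_mult mult.commute)
  finally show ?thesis using uv x by simp
qed

end

lemma hom_eq_on_generate:
  assumes "group_hom G H f" "group_hom G H g" and S: "S \<subseteq> carrier G"
    and eq: "\<And>s. s \<in> S \<Longrightarrow> f s = g s" and x: "x \<in> generate G S"
  shows "f x = g x"
proof -
  interpret f: group_hom G H f by fact
  interpret g: group_hom G H g by fact
  have "x \<in> carrier G \<and> f x = g x" using x
  proof induction
  qed (use S eq in auto)
  then show ?thesis by simp
qed

locale primary_comm_group = comm_group G for G (structure) +
  fixes p :: nat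
  assumes prime: "prime p" and primary: "primary_group p G"
begin

lemma torsion:
  assumes "x \<in> carrier G" obtains n where "x [^] (p ^ n) = \<one>"
  using primary assms unfolding primary_group_def by blast

lemma pow_prime_power_mono:
  assumes "x \<in> carrier G" "x [^] (p ^ m) = \<one>" "m \<le> n"
  shows "x [^] (p ^ n) = \<one>"
proof -
  have "x [^] (p ^ n) = (x [^] (p ^ m)) [^] (p ^ (n - m))"
    using assms(1,3) by (simp add: nat_pow_pow flip: power_add)
  then show ?thesis using assms by simp
qed

lemma pow_pow_prime: "x \<in> carrier G \<Longrightarrow> (x [^] (p ^ m)) [^] (p ^ n) = x [^] (p ^ (m + n))"
  by (simp add: nat_pow_pow power_add)

text \<open>In a p-group an integer prime to \<open>p\<close> acts invertibly on the cyclic group of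
  \<open>x\<close>. This is how coefficients prime to \<open>p\<close> are cancelled below.\<close>

lemma pow_prime_mem:
  assumes M: "subgroup M G" and x: "x \<in> carrier G"
    and c: "x [^] (c::int) \<in> M" "\<not> int p dvd c"
  shows "x \<in> M"
proof -
  obtain n where n: "x [^] (p ^ n) = \<one>" using torsion[OF x] .
  have "coprime (int p) c"
    using prime c(2) by (intro prime_imp_coprime) auto
  then have "coprime c (int (p ^ n))"
    by (simp add: coprime_commute)
  moreover have "x [^] int (p ^ n) \<in> M"
    using n subgroup.one_closed[OF M] int_pow_int[of G x "p ^ n"] by simp
  ultimately show ?thesis using coprime_pow_mem[OF M x c(1)] by blast
qed

lemma ex_order:
  assumes "x \<in> carrier G" "x \<noteq> \<one>"
  obtains m where "x [^] (p ^ m) \<noteq> \<one>" "x [^] (p ^ Suc m) = \<one>"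
proof -
  obtain n where "x [^] (p ^ n) = \<one>" using torsion[OF assms(1)] .
  then have "\<exists>m. x [^] (p ^ m) \<noteq> \<one> \<and> x [^] (p ^ Suc m) = \<one>"
  proof (induction n)
    case (Suc n) then show ?case by metis
  qed (use assms in simp)
  then show thesis using that by blast
qed

lemma ord_eq:
  assumes x: "x \<in> carrier G" and m: "x [^] (p ^ m) \<noteq> \<one>" "x [^] (p ^ Suc m) = \<one>"
  shows "ord x = p ^ Suc m"
proof -
  have "ord x dvd p ^ Suc m" using pow_eq_id[OF x, of "p ^ Suc m"] m by simp
  then obtain i where i: "i \<le> Suc m" "ord x = p ^ i"
    using divides_primepow_nat[OF prime] by blast
  have "\<not> i \<le> m"
    using pow_eq_id[OF x, of "p ^ m"] m i le_imp_power_dvd[of i m p] by auto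
  then show ?thesis using i by (simp add: le_Suc_eq)
qed

lemma int_pow_eq_one_iff:
  assumes "x \<in> carrier G" "x [^] (p ^ m) \<noteq> \<one>" "x [^] (p ^ Suc m) = \<one>"
  shows "x [^] (c::int) = \<one> \<longleftrightarrow> int p ^ Suc m dvd c"
  using int_pow_eq_id[of x c] ord_eq[of x m] assms by (simp del: power_Suc)

lemma not_dvd_prime_power_cases:
  assumes "\<not> int p ^ Suc m dvd c"
  obtains j d where "j \<le> m" "c = int p ^ j * d" "\<not> int p dvd d"
proof -
  have "c \<noteq> 0" using assms by auto
  then have "\<not> is_unit (int p)" using prime by (metis not_prime_unit prime_nat_int_transfer)
  with \<open>c \<noteq> 0\<close> obtain d where "c = int p ^ multiplicity (int p) c * d" "\<not> int p dvd d"
    using multiplicity_decompose' by blast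
  moreover from this assms have "multiplicity (int p) c \<le> m"
    by (metis dvd_mult2 le_imp_power_dvd not_less_eq_eq)
  ultimately show thesis using that by blast
qed

end

lemma int_pow_of_nat_power: "x [^]\<^bsub>G\<^esub> (int p ^ n) = x [^]\<^bsub>G\<^esub> (p ^ n)"
  using int_pow_int[of G x "p ^ n"] by simp

lemma (in group) subgroup_nat_pow_closed:
  assumes "subgroup M G" "x \<in> M" shows "x [^] (n::nat) \<in> M"
  using subgroup_int_pow_closed[OF assms, of "int n"] by (simp add: int_pow_int)

context comm_group
begin

lemma mult_inv_cancel:
  assumes "x \<in> carrier G" "a \<in> carrier G" "b \<in> carrier G"
  shows "(inv x \<otimes> a) \<otimes> (x \<otimes> b) = a \<otimes> b"
proof -
  have "(inv x \<otimes> a) \<otimes> (x \<otimes> b) = (inv x \<otimes> x) \<otimes> (a \<otimes> b)"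
    using assms by (simp only: m_ac m_closed inv_closed)
  then show ?thesis using assms by simp
qed

text \<open>One Zorn argument for two purposes: with \<open>W\<close> a single element and
  \<open>E\<close> empty it yields a complement of a cyclic summand; with \<open>W\<close> the part
  of large height in a socle it yields a complement modulo \<open>E\<close>. The maximal object is
  sought among generating sets \<open>A\<close>, for which the condition has finite
  character.\<close>

lemma maximal_avoiding_subgroup:
  assumes R: "subgroup R G" and RW: "R \<inter> W \<subseteq> E"
  obtains M where "subgroup M G" "R \<subseteq> M" "M \<inter> W \<subseteq> E"
    "\<And>x. x \<in> carrier G \<Longrightarrow> x \<notin> M \<Longrightarrow> \<exists>y\<in>M. \<exists>j::int. y \<otimes> x [^] j \<in> W - E"
proof -
  let ?P = "\<lambda>A. A \<subseteq> carrier G \<and> generate G (R \<union> A) \<inter> W \<subseteq> E"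
  note Rc = subgroup.subset[OF R]
  obtain T where T: "?P T" "\<And>x. ?P (insert x T) \<Longrightarrow> x \<in> T"
  proof (rule finite_character_maximal[of ?P "{}"])
    show "?P {}"
      using RW generate_subgroup_incl[OF _ R, of R] by auto
    show "?P S \<longleftrightarrow> (\<forall>F. finite F \<longrightarrow> F \<subseteq> S \<longrightarrow> ?P F)" for S
    proof (intro iffI allI impI)
      fix F assume S: "?P S" and F: "F \<subseteq> S"
      have "generate G (R \<union> F) \<subseteq> generate G (R \<union> S)" using F by (intro mono_generate) auto
      then show "?P F" using S F by blast
    next
      assume fin: "\<forall>F. finite F \<longrightarrow> F \<subseteq> S \<longrightarrow> ?P F"
      have "x \<in> carrier G" if "x \<in> S" for x using fin[rule_format, of "{x}"] that by auto
      moreover have "w \<in> E" if w: "w \<in> generate G (R \<union> S)" "w \<in> W" for w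
      proof -
        obtain F where F: "finite F" "F \<subseteq> R \<union> S" "w \<in> generate G F"
          using generate_finite[OF w(1)] .
        have "w \<in> generate G (R \<union> (F \<inter> S))" using generate_mono[OF F(3), of "R \<union> (F \<inter> S)"] F(2) by blast
        then show ?thesis using fin[rule_format, of "F \<inter> S"] F(1) w(2) by blast
      qed
      ultimately show "?P S" by blast
    qed
  qed blast
  let ?M = "generate G (R \<union> T)"
  have RT: "R \<union> T \<subseteq> carrier G" using Rc T by blast
  show thesis
  proof (rule that[of ?M])
    show "subgroup ?M G" using generate_is_subgroup[OF RT] .
    show "R \<subseteq> ?M" by (auto intro: generate.incl)
    show "?M \<inter> W \<subseteq> E" using T by blast
    fix x assume x: "x \<in> carrier G" "x \<notin> ?M"
    then have "x \<notin> T" by (auto intro: generate.incl)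
    then have "\<not> ?P (insert x T)" using T(2) by blast
    then obtain w where w: "w \<in> generate G (insert x (R \<union> T))" "w \<in> W" "w \<notin> E"
      using x T by auto
    then show "\<exists>y\<in>?M. \<exists>j::int. y \<otimes> x [^] j \<in> W - E"
      using generate_insert[OF x(1) RT w(1)] by blast
  qed
qed

end

context primary_comm_group
begin

text \<open>The hypothesis on \<open>e\<close> says that \<open>\<langle>e\<rangle>\<close> meets \<open>R + p\<^bsup>m + 1\<^esup> G\<close> trivially. A maximal subgroup \<open>M\<close> with
  this property is a complement of \<open>\<langle>e\<rangle>\<close>.\<close>

lemma cyclic_summand_hom:
  assumes e: "e \<in> carrier G" "e [^] (p ^ Suc m) = \<one>" and R: "subgroup R G"
    and ht: "\<And>r x. r \<in> R \<Longrightarrow> x \<in> carrier G \<Longrightarrow> e [^] (p ^ m) \<noteq> r \<otimes> x [^] (p ^ Suc m)"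
    and K: "group K" and z: "z \<in> carrier K" "z [^]\<^bsub>K\<^esub> (p ^ Suc m) = \<one>\<^bsub>K\<^esub>"
  obtains \<tau> where "\<tau> \<in> hom G K" "\<tau> e = z" "\<And>r. r \<in> R \<Longrightarrow> \<tau> r = \<one>\<^bsub>K\<^esub>"
    "\<And>x. x \<in> carrier G \<Longrightarrow> \<exists>c::int. \<tau> x = z [^]\<^bsub>K\<^esub> c"
proof -
  interpret K: group K by fact
  let ?N = "R <#> (\<lambda>x. x [^] (p ^ Suc m)) ` carrier G"
  have "subgroup ?N G" by (intro mult_subgroups R subgroup_powers)
  moreover have "e [^] (p ^ m) \<notin> ?N" using ht by (auto simp: set_mult_def)
  ultimately obtain M where M: "subgroup M G" "?N \<subseteq> M" "e [^] (p ^ m) \<notin> M"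
    and max: "\<And>x. x \<in> carrier G \<Longrightarrow> x \<notin> M \<Longrightarrow> \<exists>y\<in>M. \<exists>j::int. y \<otimes> x [^] j = e [^] (p ^ m)"
    using maximal_avoiding_subgroup[of ?N "{e [^] (p ^ m)}" "{}"] by auto
  interpret M: subgroup M G by fact
  have RM: "R \<subseteq> M"
  proof
    fix r assume r: "r \<in> R"
    then have "r = r \<otimes> \<one> [^] (p ^ Suc m)" using subgroup.mem_carrier[OF R] by simp
    then show "r \<in> M" using r M(2) unfolding set_mult_def by blast
  qed
  have PM: "x [^] (p ^ Suc m) \<in> M" if "x \<in> carrier G" for x
  proof -
    have "x [^] (p ^ Suc m) = \<one> \<otimes> x [^] (p ^ Suc m)" using that by simp
    then show ?thesis using that M(2) subgroup.one_closed[OF R] unfolding set_mult_def by blast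
  qed
  \<comment> \<open>The socle of the cyclic group on \<open>e\<close> is generated by
    \<open>e [^] (p ^ m)\<close>, so keeping this one element out of \<open>M\<close> makes the
    whole intersection trivial.\<close>
  have eM: "int p ^ Suc m dvd c" if "e [^] (c::int) \<in> M" for c
  proof (rule ccontr)
    assume "\<not> ?thesis"
    then obtain j d where j: "j \<le> m" "c = int p ^ j * d" "\<not> int p dvd d"
      using not_dvd_prime_power_cases by blast
    have "(e [^] (p ^ j)) [^] d = e [^] c"
      using e int_pow_pow[OF e(1), of "int (p ^ j)" d] by (simp add: j(2) int_pow_int flip: of_nat_power)
    then have "e [^] (p ^ j) \<in> M"
      using pow_prime_mem[OF M(1) _ _ j(3), of "e [^] (p ^ j)"] e that by simp
    then have "(e [^] (p ^ j)) [^] (p ^ (m - j)) \<in> M"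
      by (rule subgroup_nat_pow_closed[OF M(1)])
    then show False using M(3) j(1) e by (simp add: pow_pow_prime)
  qed
  let ?MC = "M <#> generate G {e}"
  have MC: "subgroup ?MC G" using e by (intro mult_subgroups M generate_is_subgroup) auto
  have MC_iff: "x \<in> ?MC \<longleftrightarrow> (\<exists>y\<in>M. \<exists>c::int. x = y \<otimes> e [^] c)" for x
    by (auto simp: set_mult_def generate_pow[OF e(1)])
  have M_MC: "x \<in> ?MC" if "x \<in> M" for x
    unfolding MC_iff using that by (intro bexI[of _ x] exI[of _ "0::int"]) auto
  \<comment> \<open>\<open>?MC\<close> is closed under division by \<open>p\<close>, hence
    everything in a p-group. Multiplying \<open>p x = y + c e\<close> by \<open>p^m\<close> puts
    \<open>c p^m e\<close> into \<open>M\<close>, which forces \<open>p\<close> to divide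
    \<open>c\<close>; removing the \<open>e\<close>-part leaves \<open>x'\<close> with
    \<open>p x'\<close> in \<open>M\<close>. If \<open>x'\<close> is not in \<open>M\<close>,
    maximality gives \<open>y' + j x' = p^m e\<close>, and \<open>p\<close> cannot divide
    \<open>j\<close>, since otherwise \<open>p^m e\<close> would lie in \<open>M\<close>.\<close>
  have step: "x \<in> ?MC" if x: "x \<in> carrier G" "x [^] p \<in> ?MC" for x
  proof -
    obtain y c where y: "y \<in> M" "x [^] p = y \<otimes> e [^] (c::int)" using x MC_iff by blast
    have "(x [^] p) [^] (p ^ m) \<in> M" using PM[OF x(1)] x(1) by (simp add: nat_pow_pow)
    moreover have "(x [^] p) [^] (p ^ m) = y [^] (p ^ m) \<otimes> e [^] (c * int (p ^ m))"
      using y e int_pow_pow[OF e(1), of c "int (p ^ m)"]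
        int_pow_int[of G "e [^] c" "p ^ m"] by (simp add: nat_pow_distrib)
    moreover have "y [^] (p ^ m) \<in> M" using y(1) by (rule subgroup_nat_pow_closed[OF M(1)])
    ultimately have "e [^] (c * int (p ^ m)) \<in> M"
      using e by (metis M.m_closed M.m_inv_closed M.mem_carrier int_pow_closed inv_solve_left)
    then have "int p * int p ^ m dvd c * int p ^ m" using eM by fastforce
    then have "int p dvd c" using prime by (simp add: prime_gt_0_nat)
    then obtain c' where c': "c = int p * c'" by blast
    define x' where "x' = x \<otimes> e [^] (- c')"
    have x'c: "x' \<in> carrier G" using x e by (simp add: x'_def)
    have "x' [^] p = y \<otimes> e [^] c \<otimes> e [^] (- c' * int p)"
      using x e y int_pow_pow[OF e(1), of "- c'" "int p"] int_pow_int[of G "e [^] (- c')" p]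
      by (simp add: x'_def nat_pow_distrib)
    also have "\<dots> = y" using e y(1) by (simp add: c' m_assoc mult.commute flip: int_pow_mult)
    finally have x'p: "x' [^] p = y" .
    have "x' \<in> ?MC"
    proof (cases "x' \<in> M")
      case False
      then obtain y' j where y': "y' \<in> M" "y' \<otimes> x' [^] (j::int) = e [^] (p ^ m)"
        using max x'c by blast
      have "\<not> int p dvd j"
      proof
        assume "int p dvd j"
        then obtain j' where "j = int p * j'" by blast
        then have "x' [^] j = y [^] j'"
          using x'c x'p int_pow_pow[OF x'c, of "int p" j'] by (simp add: int_pow_int)
        then have "x' [^] j \<in> M" using y(1) subgroup_int_pow_closed[OF M(1)] by simp
        then show False using y' M(3) M.m_closed by metis
      qed
      moreover have "x' [^] j = inv y' \<otimes> e [^] int (p ^ m)"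
        using y' x'c e by (simp add: int_pow_of_nat_power inv_solve_left)
      then have "x' [^] j \<in> ?MC" unfolding MC_iff using y'(1) by blast
      ultimately show ?thesis using pow_prime_mem[OF MC x'c] by blast
    qed (rule M_MC)
    moreover have "e [^] c' \<in> ?MC"
      unfolding MC_iff using e by (intro bexI[of _ \<one>] exI[of _ c']) auto
    moreover have "x = x' \<otimes> e [^] c'"
      using x e by (simp add: x'_def m_assoc flip: int_pow_mult)
    ultimately show ?thesis using subgroup.m_closed[OF MC] by metis
  qed
  have all: "x \<in> ?MC" if x: "x \<in> carrier G" for x
  proof -
    obtain n where "x [^] (p ^ n) = \<one>" using torsion[OF x] .
    then have "x [^] (p ^ n) \<in> ?MC" using subgroup.one_closed[OF MC] by simp
    then show ?thesis
    proof (induction n)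
      case (Suc n)
      then have "(x [^] (p ^ n)) [^] p \<in> ?MC" using x by (simp add: nat_pow_pow mult.commute)
      then show ?case using step[of "x [^] (p ^ n)"] Suc.IH x by simp
    qed (use x in simp)
  qed
  \<comment> \<open>The coefficient of \<open>e\<close> in \<open>x\<close> modulo \<open>M\<close>
    is determined only modulo \<open>p^(m+1)\<close>. The choice is harmless because
    \<open>z\<close> is killed by \<open>p^(m+1)\<close>.\<close>
  define \<gamma> where "\<gamma> x = (SOME c::int. x \<otimes> e [^] (- c) \<in> M)" for x
  have \<gamma>: "x \<otimes> e [^] (- \<gamma> x) \<in> M" if x: "x \<in> carrier G" for x
  proof -
    obtain y c where "y \<in> M" "x = y \<otimes> e [^] (c::int)" using all[OF x] MC_iff by blast
    then have "x \<otimes> e [^] (- c) \<in> M" using e by (simp add: m_assoc flip: int_pow_mult)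
    then show ?thesis unfolding \<gamma>_def by (rule someI)
  qed
  have \<gamma>_eq: "z [^]\<^bsub>K\<^esub> \<gamma> x = z [^]\<^bsub>K\<^esub> c" if x: "x \<in> carrier G" and c: "x \<otimes> e [^] (- c) \<in> M"
    for x and c :: int
  proof -
    have "inv (x \<otimes> e [^] (- \<gamma> x)) \<otimes> (x \<otimes> e [^] (- c)) \<in> M"
      using \<gamma>[OF x] c by blast
    also have "inv (x \<otimes> e [^] (- \<gamma> x)) \<otimes> (x \<otimes> e [^] (- c)) = e [^] \<gamma> x \<otimes> e [^] (- c)"
      using x e mult_inv_cancel[of x "e [^] \<gamma> x" "e [^] (- c)"] by (simp add: inv_mult int_pow_neg)
    finally have "int p ^ Suc m dvd \<gamma> x - c" using eM e by (simp flip: int_pow_mult)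
    then obtain k where "\<gamma> x = int (p ^ Suc m) * k + c" by (metis diff_add_cancel dvd_def of_nat_power)
    then show ?thesis
      using z K.int_pow_pow[OF z(1), of "int (p ^ Suc m)" k] int_pow_int[of K z "p ^ Suc m"]
      by (simp add: K.int_pow_mult)
  qed
  show thesis
  proof (rule that[of "\<lambda>x. z [^]\<^bsub>K\<^esub> \<gamma> x"])
    show "(\<lambda>x. z [^]\<^bsub>K\<^esub> \<gamma> x) \<in> hom G K"
    proof (rule homI)
      fix x y assume xy: "x \<in> carrier G" "y \<in> carrier G"
      have "(x \<otimes> e [^] (- \<gamma> x)) \<otimes> (y \<otimes> e [^] (- \<gamma> y)) \<in> M" using \<gamma> xy by blast
      also have "(x \<otimes> e [^] (- \<gamma> x)) \<otimes> (y \<otimes> e [^] (- \<gamma> y)) = (x \<otimes> y) \<otimes> e [^] (- (\<gamma> x + \<gamma> y))"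
        using xy e by (simp add: int_pow_mult int_pow_diff int_pow_neg inv_mult m_ac)
      finally have "z [^]\<^bsub>K\<^esub> \<gamma> (x \<otimes> y) = z [^]\<^bsub>K\<^esub> (\<gamma> x + \<gamma> y)"
        by (rule \<gamma>_eq[rotated]) (use xy in simp)
      then show "z [^]\<^bsub>K\<^esub> \<gamma> (x \<otimes> y) = z [^]\<^bsub>K\<^esub> \<gamma> x \<otimes>\<^bsub>K\<^esub> z [^]\<^bsub>K\<^esub> \<gamma> y"
        using z by (simp add: K.int_pow_mult)
    qed (use z in auto)
    show "z [^]\<^bsub>K\<^esub> \<gamma> e = z" using \<gamma>_eq[of e 1] e z by (simp add: int_pow_neg)
    show "z [^]\<^bsub>K\<^esub> \<gamma> r = \<one>\<^bsub>K\<^esub>" if "r \<in> R" for r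
      using \<gamma>_eq[of r 0] that RM M.mem_carrier by auto
  qed auto
qed

end

section \<open>Pure independent sets\<close>

text \<open>Each element of \<open>S\<close> generates a cyclic direct summand with a complement containing the rest of
  \<open>S\<close>; the condition is on the socle and of finite character.\<close>

definition pure_independent :: "nat \<Rightarrow> ('a, 'b) monoid_scheme \<Rightarrow> 'a set \<Rightarrow> bool"
  where "pure_independent p G S \<longleftrightarrow> S \<subseteq> carrier G - {\<one>\<^bsub>G\<^esub>} \<and>
    (\<forall>s\<in>S. \<forall>m. s [^]\<^bsub>G\<^esub> (p ^ m) \<noteq> \<one>\<^bsub>G\<^esub> \<longrightarrow> s [^]\<^bsub>G\<^esub> (p ^ Suc m) = \<one>\<^bsub>G\<^esub> \<longrightarrow>
      (\<forall>r\<in>generate G (S - {s}). \<forall>x\<in>carrier G.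
        s [^]\<^bsub>G\<^esub> (p ^ m) \<noteq> r \<otimes>\<^bsub>G\<^esub> x [^]\<^bsub>G\<^esub> (p ^ Suc m)))"

lemma pure_independent_subset:
  assumes "pure_independent p G T" "S \<subseteq> T"
  shows "pure_independent p G S"
proof -
  have "r \<in> generate G (T - {s})" if "r \<in> generate G (S - {s})" for r s
    by (rule generate_mono[OF that]) (use assms(2) in blast)
  moreover have "S \<subseteq> carrier G - {\<one>\<^bsub>G\<^esub>}" using assms by (auto simp: pure_independent_def)
  ultimately show ?thesis
    using assms unfolding pure_independent_def by (meson subsetD)
qed

lemma pure_independent_finite:
  "pure_independent p G S \<longleftrightarrow> (\<forall>F. finite F \<longrightarrow> F \<subseteq> S \<longrightarrow> pure_independent p G F)"
proof (intro iffI allI impI)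
  assume fin: "\<forall>F. finite F \<longrightarrow> F \<subseteq> S \<longrightarrow> pure_independent p G F"
  show "pure_independent p G S" unfolding pure_independent_def
  proof (intro conjI ballI allI impI)
    have "s \<in> carrier G - {\<one>\<^bsub>G\<^esub>}" if "s \<in> S" for s
      using fin[rule_format, of "{s}"] that by (auto simp: pure_independent_def)
    then show "S \<subseteq> carrier G - {\<one>\<^bsub>G\<^esub>}" by blast
  next
    fix s m r x
    assume s: "s \<in> S" "s [^]\<^bsub>G\<^esub> (p ^ m) \<noteq> \<one>\<^bsub>G\<^esub>" "s [^]\<^bsub>G\<^esub> (p ^ Suc m) = \<one>\<^bsub>G\<^esub>"
      and r: "r \<in> generate G (S - {s})" and x: "x \<in> carrier G"
    obtain F where F: "finite F" "F \<subseteq> S - {s}" "r \<in> generate G F"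
      using generate_finite[OF r] .
    then have "pure_independent p G (insert s F)" using fin s(1) by blast
    moreover have "insert s F - {s} = F" using F by blast
    ultimately show "s [^]\<^bsub>G\<^esub> (p ^ m) \<noteq> r \<otimes>\<^bsub>G\<^esub> x [^]\<^bsub>G\<^esub> (p ^ Suc m)"
      using s(2,3) x F(3) unfolding pure_independent_def by (metis insertI1)
  qed
qed (rule pure_independent_subset)

lemma pure_independent_carrier: "pure_independent p G S \<Longrightarrow> S \<subseteq> carrier G"
  by (auto simp: pure_independent_def)

lemma (in group) generate_hom_trivial:
  assumes "group_hom G K f" "F \<subseteq> carrier G" "\<And>s. s \<in> F \<Longrightarrow> f s = \<one>\<^bsub>K\<^esub>" "x \<in> generate G F"
  shows "f x = \<one>\<^bsub>K\<^esub>"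
proof -
  interpret f: group_hom G K f by fact
  have "generate G F \<subseteq> kernel G K f"
    using assms by (intro generate_subgroup_incl f.subgroup_kernel) (auto simp: kernel_def)
  then show ?thesis using assms(4) by (auto simp: kernel_def)
qed

text \<open>Homomorphisms that kill each other's generators can be added even over an infinite
  \<open>S\<close>, since an element of the span involves only finitely many generators. With
  \<open>K = G\<close> this gives coordinates; with \<open>K\<close> an extension it assembles a
  lift from lifts of the generators.\<close>

locale orthogonal_homs = G: group G + K: comm_group K for G (structure) and K (structure) +
  fixes S :: "'a set" and \<theta> :: "'a \<Rightarrow> 'a \<Rightarrow> 'c"
  assumes S: "S \<subseteq> carrier G" and hom: "s \<in> S \<Longrightarrow> \<theta> s \<in> hom G K"
    and orth: "s \<in> S \<Longrightarrow> t \<in> S \<Longrightarrow> s \<noteq> t \<Longrightarrow> \<theta> s t = \<one>\<^bsub>K\<^esub>"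
begin

abbreviation "\<Theta> x \<equiv> gfinprod K (\<lambda>s. \<theta> s x) S"

lemma group_hom: "s \<in> S \<Longrightarrow> group_hom G K (\<theta> s)"
  using hom by unfold_locales

lemma finite_support:
  assumes "x \<in> generate G S" shows "finite {s\<in>S. \<theta> s x \<noteq> \<one>\<^bsub>K\<^esub>}"
proof -
  obtain F where F: "finite F" "F \<subseteq> S" "x \<in> generate G F" using generate_finite[OF assms] .
  have "\<theta> s x = \<one>\<^bsub>K\<^esub>" if "s \<in> S - F" for s
    using that S F(2) orth by (intro G.generate_hom_trivial[OF group_hom _ _ F(3)]) auto
  then have "{s\<in>S. \<theta> s x \<noteq> \<one>\<^bsub>K\<^esub>} \<subseteq> F" by blast
  then show ?thesis using F(1) finite_subset by blast
qed

lemma carr: "x \<in> carrier G \<Longrightarrow> (\<lambda>s. \<theta> s x) \<in> S \<rightarrow> carrier K"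
  using hom by (auto simp: hom_def)

lemma sum_hom: "\<Theta> \<in> hom (G\<lparr>carrier := generate G S\<rparr>) K"
proof (rule homI)
  fix x y assume "x \<in> carrier (G\<lparr>carrier := generate G S\<rparr>)" "y \<in> carrier (G\<lparr>carrier := generate G S\<rparr>)"
  then have xy: "x \<in> generate G S" "y \<in> generate G S" and c: "x \<in> carrier G" "y \<in> carrier G"
    using G.generate_in_carrier[OF S] by auto
  have "\<Theta> (x \<otimes>\<^bsub>G\<^esub> y) = gfinprod K (\<lambda>s. \<theta> s x \<otimes>\<^bsub>K\<^esub> \<theta> s y) S"
    by (rule K.gfinprod_cong) (use carr[OF c(1)] carr[OF c(2)] carr[OF G.m_closed[OF c]] hom c in \<open>auto simp: hom_mult simp_implies_def\<close>)
  also have "\<dots> = \<Theta> x \<otimes>\<^bsub>K\<^esub> \<Theta> y"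
    by (intro K.gfinprod_distrib finite_support xy carr c)
  finally show "\<Theta> (x \<otimes>\<^bsub>G\<lparr>carrier := generate G S\<rparr>\<^esub> y) = \<Theta> x \<otimes>\<^bsub>K\<^esub> \<Theta> y" by simp
qed (use carr G.generate_in_carrier[OF S] in simp)

lemma sum_apply:
  assumes "t \<in> S" shows "\<Theta> t = \<theta> t t"
proof -
  have "\<Theta> t = gfinprod K (\<lambda>s. \<theta> s t) {t}"
    using assms orth S by (intro K.gfinprod_mono_neutral_cong_right carr) auto
  also have "\<dots> = \<theta> t t"
    using carr[of t] S assms by (subst K.gfinprod_eq_finprod) (auto simp: Pi_iff)
  finally show ?thesis .
qed

end

context comm_group
begin

lemma finprod_mem_subgroup:
  assumes "subgroup M G" "finite F" "\<And>s. s \<in> F \<Longrightarrow> f s \<in> M"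
  shows "finprod G f F \<in> M"
  using assms(2,3)
proof (induction F)
  case (insert s F)
  then show ?case using subgroup.mem_carrier[OF assms(1)]
    by (subst finprod_insert) (auto intro: subgroup.m_closed[OF assms(1)])
qed (simp add: subgroup.one_closed[OF assms(1)])

lemma finprod_hom:
  assumes "group_hom G K h" "comm_group K" "finite F" "\<And>s. s \<in> F \<Longrightarrow> f s \<in> carrier G"
  shows "h (finprod G f F) = finprod K (\<lambda>s. h (f s)) F"
proof -
  interpret K: comm_group K by fact
  interpret h: group_hom G K h by fact
  show ?thesis using assms(3,4)
  proof (induction F)
    case (insert s F)
    then have "finprod G f (insert s F) = f s \<otimes> finprod G f F"
      "finprod K (\<lambda>s. h (f s)) (insert s F) = h (f s) \<otimes>\<^bsub>K\<^esub> finprod K (\<lambda>s. h (f s)) F"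
      by (auto intro!: finprod_insert K.finprod_insert)
    then show ?case using insert by (simp add: Pi_def)
  qed simp
qed

lemma nat_pow_group_hom: "group_hom G G (\<lambda>x. x [^] (n::nat))"
  by unfold_locales (auto simp: hom_def nat_pow_distrib)

end

context primary_comm_group
begin

text \<open>The assumption on \<open>z\<close> says that its order divides that of \<open>s\<close>;
  since \<open>s\<close> splits off with a complement containing the other generators, no further
  condition is necessary to map it there.\<close>

lemma pure_independent_hom:
  assumes S: "pure_independent p G S" "s \<in> S" and K: "group K" "z \<in> carrier K"
    and z: "\<And>n. s [^] (p ^ n) = \<one> \<Longrightarrow> z [^]\<^bsub>K\<^esub> (p ^ n) = \<one>\<^bsub>K\<^esub>"
  obtains \<tau> where "\<tau> \<in> hom G K" "\<tau> s = z" "\<And>r. r \<in> generate G (S - {s}) \<Longrightarrow> \<tau> r = \<one>\<^bsub>K\<^esub>"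
    "\<And>x. x \<in> carrier G \<Longrightarrow> \<exists>c::int. \<tau> x = z [^]\<^bsub>K\<^esub> c"
proof -
  have s: "s \<in> carrier G" "s \<noteq> \<one>" and Sc: "S - {s} \<subseteq> carrier G"
    using S by (auto simp: pure_independent_def)
  obtain m where m: "s [^] (p ^ m) \<noteq> \<one>" "s [^] (p ^ Suc m) = \<one>"
    using ex_order[OF s] .
  show thesis
    by (rule cyclic_summand_hom[OF s(1) m(2) generate_is_subgroup[OF Sc] _ K z[OF m(2)]])
      (use S m in \<open>auto simp del: power_Suc simp: pure_independent_def intro: that\<close>)
qed

lemma pure_independent_projections:
  assumes S: "pure_independent p G S"
  obtains \<tau> where "orthogonal_homs G G S \<tau>" "\<forall>s\<in>S. \<tau> s s = s"
    "\<forall>s\<in>S. \<forall>r\<in>generate G (S - {s}). \<tau> s r = \<one>"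
    "\<forall>s\<in>S. \<forall>x\<in>carrier G. \<tau> s x \<in> generate G {s}"
    "\<forall>x\<in>generate G S. gfinprod G (\<lambda>s. \<tau> s x) S = x"
proof -
  have Sc: "S \<subseteq> carrier G" using S by (rule pure_independent_carrier)
  have "\<forall>s\<in>S. \<exists>\<tau>. \<tau> \<in> hom G G \<and> \<tau> s = s \<and> (\<forall>r\<in>generate G (S - {s}). \<tau> r = \<one>) \<and>
      (\<forall>x\<in>carrier G. \<exists>c::int. \<tau> x = s [^] c)"
  proof
    fix s assume s: "s \<in> S"
    show "\<exists>\<tau>. \<tau> \<in> hom G G \<and> \<tau> s = s \<and> (\<forall>r\<in>generate G (S - {s}). \<tau> r = \<one>) \<and>
      (\<forall>x\<in>carrier G. \<exists>c::int. \<tau> x = s [^] c)"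
      by (rule pure_independent_hom[OF S s is_group, of s]) (use s Sc in blast)+
  qed
  then obtain \<tau> where \<tau>: "\<And>s. s \<in> S \<Longrightarrow> \<tau> s \<in> hom G G" "\<And>s. s \<in> S \<Longrightarrow> \<tau> s s = s"
    "\<And>s r. s \<in> S \<Longrightarrow> r \<in> generate G (S - {s}) \<Longrightarrow> \<tau> s r = \<one>"
    "\<And>s x. s \<in> S \<Longrightarrow> x \<in> carrier G \<Longrightarrow> \<exists>c::int. \<tau> s x = s [^] c"
    unfolding bchoice_iff by blast
  interpret \<tau>: orthogonal_homs G G S \<tau>
    by unfold_locales (use Sc \<tau>(1) \<tau>(3)[OF _ generate.incl] in auto)
  have B: "subgroup (generate G S) G" using Sc by (rule generate_is_subgroup)
  have dec: "gfinprod G (\<lambda>s. \<tau> s x) S = x" if x: "x \<in> generate G S" for x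
  proof (rule hom_eq_on_generate[where G = "G\<lparr>carrier := generate G S\<rparr>" and H = G and S = S])
    have B': "group (G\<lparr>carrier := generate G S\<rparr>)" using subgroup_imp_group[OF B] .
    then show "group_hom (G\<lparr>carrier := generate G S\<rparr>) G \<tau>.\<Theta>"
      by (simp add: group_hom_def group_hom_axioms_def is_group \<tau>.sum_hom)
    show "group_hom (G\<lparr>carrier := generate G S\<rparr>) G (\<lambda>x. x)"
      using B' Sc by (auto simp: group_hom_def group_hom_axioms_def is_group hom_def generate_in_carrier)
    have "S \<subseteq> generate G S" by (auto intro: generate.incl)
    then show "S \<subseteq> carrier (G\<lparr>carrier := generate G S\<rparr>)"
      and "x \<in> generate (G\<lparr>carrier := generate G S\<rparr>) S"
      using generate_consistent[OF _ B] x by simp_all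
  qed (use \<tau>.sum_apply \<tau> in simp)
  show thesis
  proof (rule that[OF \<tau>.orthogonal_homs_axioms])
    show "\<forall>s\<in>S. \<forall>x\<in>carrier G. \<tau> s x \<in> generate G {s}"
      using \<tau>(4) Sc generate_pow by blast
  qed (use \<tau>(2,3) dec in simp_all)
qed

text \<open>Purity of the span: the root \<open>g\<close> is replaced by the sum of its
  coordinates.\<close>

lemma pure_independent_pure:
  assumes S: "pure_independent p G S" and g: "g \<in> carrier G" "g [^] (n::nat) \<in> generate G S"
  obtains b where "b \<in> generate G S" "b [^] n = g [^] n"
proof -
  have Sc: "S \<subseteq> carrier G" using S by (rule pure_independent_carrier)
  obtain \<tau> where \<tau>: "orthogonal_homs G G S \<tau>"
    and gen: "\<And>s x. s \<in> S \<Longrightarrow> x \<in> carrier G \<Longrightarrow> \<tau> s x \<in> generate G {s}"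
    and dec: "\<And>x. x \<in> generate G S \<Longrightarrow> gfinprod G (\<lambda>s. \<tau> s x) S = x"
    using pure_independent_projections[OF S] by metis
  interpret \<tau>: orthogonal_homs G G S \<tau> by fact
  \<comment> \<open>The support is that of \<open>g [^] n\<close>, which lies in the span and has
    finitely many coordinates. The element \<open>g\<close> itself may have infinitely many, but
    outside \<open>F\<close> they vanish after taking the \<open>n\<close>-th power.\<close>
  define F where "F = {s\<in>S. \<tau> s (g [^] n) \<noteq> \<one>}"
  have F: "finite F" "F \<subseteq> S" using \<tau>.finite_support[OF g(2)] by (auto simp: F_def)
  have gc: "\<tau> s g \<in> carrier G" if "s \<in> S" for s using \<tau>.carr[OF g(1)] that by blast
  let ?b = "finprod G (\<lambda>s. \<tau> s g) F"
  have "?b \<in> generate G S"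
  proof (rule finprod_mem_subgroup[OF generate_is_subgroup[OF Sc] F(1)])
    show "\<tau> s g \<in> generate G S" if "s \<in> F" for s
      using generate_mono[OF gen[OF _ g(1), of s], of S] that F(2) by blast
  qed
  moreover have "?b [^] n = g [^] n"
  proof -
    have "?b [^] n = finprod G (\<lambda>s. \<tau> s g [^] n) F"
      using F gc by (intro finprod_hom[OF nat_pow_group_hom comm_group_axioms]) auto
    also have "\<dots> = finprod G (\<lambda>s. \<tau> s (g [^] n)) F"
      using F gc by (intro finprod_cong) (auto simp: simp_implies_def group_hom.hom_nat_pow[OF \<tau>.group_hom] g(1))
    also have "\<dots> = gfinprod G (\<lambda>s. \<tau> s (g [^] n)) S"
      using F by (simp add: gfinprod_def F_def)
    finally show ?thesis using dec g(2) by simp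
  qed
  ultimately show thesis using that by blast
qed

text \<open>For \<open>c\<close> the condition is the assumption \<open>ht\<close>. For an old
  \<open>s\<close>, suppose \<open>p^k s = b + j c + p^(k+1) x\<close>. The homomorphism
  \<open>\<tau>\<close>, which fixes \<open>c\<close> and kills the old span, turns this into
  \<open>j c = - p^(k+1) (\<tau> x)\<close>, so the \<open>c\<close>-part is absorbed into
  \<open>x\<close> and the independence of the old set is contradicted.\<close>

lemma pure_independent_insert:
  assumes S: "pure_independent p G S" and c: "c \<in> carrier G" "c [^] (p ^ Suc m) = \<one>"
    and ht: "\<And>b x. b \<in> generate G S \<Longrightarrow> x \<in> carrier G \<Longrightarrow> c [^] (p ^ m) \<noteq> b \<otimes> x [^] (p ^ Suc m)"
  shows "pure_independent p G (insert c S)"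
proof -
  have Sc: "S \<subseteq> carrier G" using S by (rule pure_independent_carrier)
  note B = generate_is_subgroup[OF Sc]
  obtain \<tau> where \<tau>: "\<tau> \<in> hom G G" "\<tau> c = c" "\<And>r. r \<in> generate G S \<Longrightarrow> \<tau> r = \<one>"
    using cyclic_summand_hom[OF c B ht is_group c] by metis
  interpret \<tau>: group_hom G G \<tau> using \<tau>(1) by unfold_locales
  have cm: "c [^] (p ^ m) \<noteq> \<one>"
    using ht[OF generate.one one_closed] by simp
  have cS: "c \<notin> S"
  proof
    assume "c \<in> S"
    then have "c [^] (p ^ m) \<in> generate G S"
      by (intro subgroup_nat_pow_closed[OF B] generate.incl)
    then show False using ht[OF _ one_closed, of "c [^] (p ^ m)"] c by simp
  qed
  show ?thesis unfolding pure_independent_def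
  proof (intro conjI ballI allI impI)
    show "insert c S \<subseteq> carrier G - {\<one>}" using S c cm by (auto simp: pure_independent_def)
    fix s k r x
    assume s: "s \<in> insert c S" "s [^] (p ^ k) \<noteq> \<one>" "s [^] (p ^ Suc k) = \<one>"
      and r: "r \<in> generate G (insert c S - {s})" and x: "x \<in> carrier G"
    show "s [^] (p ^ k) \<noteq> r \<otimes> x [^] (p ^ Suc k)"
    proof (cases "s = c")
      case True
      then have "p ^ Suc k = p ^ Suc m"
        using ord_eq[OF c(1) cm c(2)] ord_eq[of s k] s c True by metis
      then have "k = m" using prime_gt_1_nat[OF prime] power_inject_exp[of p "Suc k" "Suc m"] by blast
      moreover have "r \<in> generate G S" using r True cS by simp
      ultimately show ?thesis using ht x True by blast
    next
      case False
      then have sS: "s \<in> S" using s by simp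
      have "insert c S - {s} = insert c (S - {s})" using False by auto
      then have "r \<in> generate G (insert c (S - {s}))" using r by simp
      moreover have "S - {s} \<subseteq> carrier G" using Sc by blast
      ultimately obtain b j where b: "b \<in> generate G (S - {s})" "r = b \<otimes> c [^] (j::int)"
        using generate_insert[OF c(1)] by metis
      have bS: "b \<in> generate G S" by (rule generate_mono[OF b(1)]) blast
      then have bc: "b \<in> carrier G" using Sc generate_in_carrier by blast
      show ?thesis
      proof
        assume eq: "s [^] (p ^ k) = r \<otimes> x [^] (p ^ Suc k)"
        have "s [^] (p ^ k) \<in> generate G S"
          using sS by (intro subgroup_nat_pow_closed[OF B] generate.incl)
        then have "\<one> = \<tau> (r \<otimes> x [^] (p ^ Suc k))" using \<tau>(3) eq by metis
        also have "\<dots> = c [^] j \<otimes> (\<tau> x) [^] (p ^ Suc k)"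
          using b bc c x \<tau> bS by (simp add: \<tau>.hom_nat_pow \<tau>.hom_int_pow del: power_Suc)
        finally have "c [^] j = inv (\<tau> x) [^] (p ^ Suc k)"
          using c x by (metis \<tau>.hom_closed int_pow_closed inv_equality nat_pow_closed nat_pow_inv)
        then have "s [^] (p ^ k) = b \<otimes> (inv (\<tau> x) \<otimes> x) [^] (p ^ Suc k)"
          using eq b(2) bc x by (simp add: m_assoc nat_pow_distrib del: power_Suc)
        then show False
          using S sS s(2,3) b(1) x unfolding pure_independent_def by (metis \<tau>.hom_closed inv_closed m_closed)
      qed
    qed
  qed
qed

section \<open>Basic subgroups\<close>

lemma pure_independent_direct_sum:
  assumes S: "pure_independent p G S"
  shows "direct_sum_of_cyclics (G\<lparr>carrier := generate G S\<rparr>)"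
proof -
  have Sc: "S \<subseteq> carrier G" using S by (rule pure_independent_carrier)
  obtain \<tau> where "orthogonal_homs G G S \<tau>" and \<tau>: "\<forall>s\<in>S. \<tau> s s = s"
    "\<forall>s\<in>S. \<forall>r\<in>generate G (S - {s}). \<tau> s r = \<one>"
    "\<forall>s\<in>S. \<forall>x\<in>carrier G. \<tau> s x \<in> generate G {s}"
    "\<forall>x\<in>generate G S. gfinprod G (\<lambda>s. \<tau> s x) S = x"
    using pure_independent_projections[OF S] by blast
  interpret \<tau>: orthogonal_homs G G S \<tau> by fact
  \<comment> \<open>The summands are plain records of type \<open>'a monoid\<close>, as
    \<open>direct_sum_of_cyclics\<close> requires, whereas \<open>G\<close> may carry further
    fields.\<close>
  define C where "C s = \<lparr>carrier = generate G {s}, monoid.mult = (\<otimes>), one = \<one>\<rparr>" for s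
  have cyc: "subgroup (generate G {s}) G" if "s \<in> S" for s
    using that Sc by (intro generate_is_subgroup) auto
  have C: "group (C s)" if s: "s \<in> S" for s
  proof (rule groupI)
    interpret s: subgroup "generate G {s}" G by (rule cyc[OF s])
    show "\<exists>y\<in>carrier (C s). y \<otimes>\<^bsub>C s\<^esub> x = \<one>\<^bsub>C s\<^esub>" if "x \<in> carrier (C s)" for x
      using that by (auto simp: C_def intro!: bexI[of _ "inv x"])
  qed (use subgroup.m_closed[OF cyc[OF s]] subgroup.one_closed[OF cyc[OF s]]
      subgroup.mem_carrier[OF cyc[OF s]] in \<open>auto simp: C_def m_assoc\<close>)
  have "cyclic_group (C s)" if s: "s \<in> S" for s
  proof -
    have "carrier (subgroup_generated G {s}) = generate G {s}"
      using s Sc by (simp add: carrier_subgroup_generated Int_absorb1 subset_eq)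
    then have "(\<lambda>x. x) \<in> iso (C s) (subgroup_generated G {s})"
      by (auto simp: C_def iso_def hom_def bij_betw_def intro: subgroup.m_closed[OF cyc[OF s]])
    then have "C s \<cong> subgroup_generated G {s}" by (auto simp: is_iso_def)
    then show ?thesis
      using isomorphic_group_cyclicity[of "C s"] C[OF s] cyclic_group_generated
        group_subgroup_generated by metis
  qed
  moreover have "G\<lparr>carrier := generate G S\<rparr> \<cong> sum_group S C"
  proof -
    let ?\<phi> = "\<lambda>x. \<lambda>s\<in>S. \<tau> s x"
    have Bc: "generate G S \<subseteq> carrier G" using generate_in_carrier[OF Sc] by blast
    have "?\<phi> \<in> hom (G\<lparr>carrier := generate G S\<rparr>) (sum_group S C)"
    proof (rule homI)
      show "?\<phi> x \<in> carrier (sum_group S C)" if x: "x \<in> carrier (G\<lparr>carrier := generate G S\<rparr>)" for x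
      proof -
        have "{i \<in> S. ?\<phi> x i \<noteq> \<one>\<^bsub>C i\<^esub>} = {i\<in>S. \<tau> i x \<noteq> \<one>}" by (auto simp: C_def)
        then show ?thesis
          using x \<tau>.finite_support[of x] Bc \<tau>(3) by (auto simp: carrier_sum_group[OF C] C_def)
      qed
      show "?\<phi> (x \<otimes>\<^bsub>G\<lparr>carrier := generate G S\<rparr>\<^esub> y) = ?\<phi> x \<otimes>\<^bsub>sum_group S C\<^esub> ?\<phi> y"
        if "x \<in> carrier (G\<lparr>carrier := generate G S\<rparr>)" "y \<in> carrier (G\<lparr>carrier := generate G S\<rparr>)" for x y
        using that Bc \<tau>.hom by (auto simp: C_def hom_mult fun_eq_iff subset_eq)
    qed
    moreover have "inj_on ?\<phi> (generate G S)"
    proof (rule inj_onI)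
      fix x y assume xy: "x \<in> generate G S" "y \<in> generate G S" "?\<phi> x = ?\<phi> y"
      then have "\<tau> s x = \<tau> s y" if "s \<in> S" for s using that by (metis restrict_apply')
      then have "gfinprod G (\<lambda>s. \<tau> s x) S = gfinprod G (\<lambda>s. \<tau> s y) S"
        using \<tau>.carr[OF subsetD[OF Bc xy(2)]] by (intro gfinprod_cong) (auto simp: simp_implies_def)
      then show "x = y" using \<tau>(4) xy by simp
    qed
    moreover have "y \<in> ?\<phi> ` generate G S" if y: "y \<in> carrier (sum_group S C)" for y
    proof -
      define F where "F = {s\<in>S. y s \<noteq> \<one>}"
      have F: "finite F" "F \<subseteq> S" and ys: "\<And>s. s \<in> S \<Longrightarrow> y s \<in> generate G {s}" and ext: "y \<in> extensional S"
        using y by (auto simp: carrier_sum_group[OF C] F_def C_def PiE_iff)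
      have yc: "y s \<in> carrier G" if "s \<in> S" for s
        using ys[OF that] Sc that generate_in_carrier[of "{s}"] by blast
      have mem: "finprod G y F \<in> generate G S"
      proof (rule finprod_mem_subgroup[OF generate_is_subgroup[OF Sc] F(1)])
        show "y s \<in> generate G S" if "s \<in> F" for s
          by (rule generate_mono[OF ys]) (use that F(2) in auto)
      qed
      have "\<tau> s (finprod G y F) = y s" if s: "s \<in> S" for s
      proof -
        have t: "\<tau> s (y t) = (if s = t then y s else \<one>)" if "t \<in> S" for t
        proof (cases "s = t")
          case True
          obtain c where c: "y s = s [^] (c::int)" using ys[OF s] generate_pow[of s] s Sc by blast
          then show ?thesis
            using True group_hom.hom_int_pow[OF \<tau>.group_hom[OF s], of s c] \<tau>(1) s Sc by auto
        next
          case False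
          have "y t \<in> generate G (S - {s})"
            by (rule generate_mono[OF ys[OF that]]) (use False that in auto)
          then show ?thesis using \<tau>(2) s False by simp
        qed
        have "\<tau> s (finprod G y F) = finprod G (\<lambda>t. \<tau> s (y t)) F"
          using F yc by (intro finprod_hom[OF \<tau>.group_hom[OF s] comm_group_axioms]) auto
        also have "\<dots> = finprod G (\<lambda>t. if s = t then y s else \<one>) F"
          using F yc s by (intro finprod_cong) (auto simp: simp_implies_def t Pi_iff)
        also have "\<dots> = y s"
        proof (cases "s \<in> F")
          case True
          then show ?thesis using F yc s finprod_singleton[of s F "\<lambda>_. y s"] by simp
        next
          case False
          then have "finprod G (\<lambda>t. if s = t then y s else \<one>) F = \<one>"
            by (intro finprod_one_eqI) auto
          then show ?thesis using False s by (simp add: F_def)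
        qed
        finally show ?thesis .
      qed
      then have "?\<phi> (finprod G y F) = y" using ext by (auto simp: fun_eq_iff extensional_def)
      then show ?thesis using mem by (metis image_eqI)
    qed
    ultimately have "?\<phi> \<in> iso (G\<lparr>carrier := generate G S\<rparr>) (sum_group S C)"
      unfolding iso_def bij_betw_def by (auto simp: hom_def)
    then show ?thesis unfolding is_iso_def by blast
  qed
  ultimately show ?thesis using C unfolding direct_sum_of_cyclics_def
    by (intro exI[of _ S] exI[of _ C]) auto
qed

text \<open>An element violating the last conclusion could be inserted by
  \<open>pure_independent_insert\<close>; but elements of \<open>T\<close> themselves satisfy it
  with \<open>x = \<one>\<close>.\<close>

lemma maximal_pure_independent:
  assumes "pure_independent p G S"
  obtains T where "S \<subseteq> T" "pure_independent p G T"
    "\<And>c m. c \<in> carrier G \<Longrightarrow> c [^] (p ^ Suc m) = \<one> \<Longrightarrow>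
      \<exists>b\<in>generate G T. \<exists>x\<in>carrier G. c [^] (p ^ m) = b \<otimes> x [^] (p ^ Suc m)"
proof -
  obtain T where T: "S \<subseteq> T" "pure_independent p G T"
    "\<And>x. pure_independent p G (insert x T) \<Longrightarrow> x \<in> T"
    using finite_character_maximal[of "pure_independent p G" S, OF pure_independent_finite assms]
    by blast
  note B = generate_is_subgroup[OF pure_independent_carrier[OF T(2)]]
  show thesis
  proof (rule that[OF T(1,2)], rule ccontr)
    fix c m assume c: "c \<in> carrier G" "c [^] (p ^ Suc m) = \<one>"
      and neg: "\<not> (\<exists>b\<in>generate G T. \<exists>x\<in>carrier G. c [^] (p ^ m) = b \<otimes> x [^] (p ^ Suc m))"
    then have "c \<in> T"
      by (intro T(3) pure_independent_insert[OF T(2) c]) blast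
    then have "c [^] (p ^ m) \<in> generate G T"
      by (intro subgroup_nat_pow_closed[OF B] generate.incl)
    moreover have "c [^] (p ^ m) = c [^] (p ^ m) \<otimes> \<one> [^] (p ^ Suc m)" using c by simp
    ultimately show False using neg by blast
  qed
qed

lemma pure_independent_basic:
  assumes S: "pure_independent p G S"
    and max: "\<And>c m. c \<in> carrier G \<Longrightarrow> c [^] (p ^ Suc m) = \<one> \<Longrightarrow>
      \<exists>b\<in>generate G S. \<exists>x\<in>carrier G. c [^] (p ^ m) = b \<otimes> x [^] (p ^ Suc m)"
  shows "basic_subgroup (generate G S) G"
proof -
  let ?B = "generate G S"
  have Sc: "S \<subseteq> carrier G" using S by (rule pure_independent_carrier)
  have B: "subgroup ?B G" by (rule generate_is_subgroup[OF Sc])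
  interpret B: subgroup ?B G by (rule B)
  interpret N: normal ?B G by (rule subgroup_imp_normal[OF B])
  let ?N = "?B <#> (\<lambda>x. x [^] p) ` carrier G"
  have Nsub: "subgroup ?N G" by (intro mult_subgroups B subgroup_powers)
  have BN: "b \<in> ?N" if "b \<in> ?B" for b
  proof -
    have "b = b \<otimes> \<one> [^] p" using that by simp
    then show ?thesis using that unfolding set_mult_def by blast
  qed
  have PN: "x [^] p \<in> ?N" if "x \<in> carrier G" for x
  proof -
    have "x [^] p = \<one> \<otimes> x [^] p" using that by simp
    then show ?thesis using that B.one_closed unfolding set_mult_def by blast
  qed
  interpret N: subgroup ?N G by (rule Nsub)
  have "x \<in> ?N" if x: "x \<in> carrier G" for x
  proof (rule ccontr)
    assume xN: "x \<notin> ?N"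
    \<comment> \<open>The claim is \<open>G = B + p G\<close>. Among the counterexamples take
      \<open>y\<close> with \<open>p^m y\<close> in \<open>B\<close> and \<open>m\<close> minimal.
      Purity corrects \<open>y\<close> by an element of \<open>B\<close> so that \<open>p^m\<close>
      kills it, and maximality of \<open>S\<close> then allows subtracting a multiple of
      \<open>p\<close> so that already \<open>p^(m-1)\<close> maps the result into \<open>B\<close>.
      Neither correction leaves the complement of \<open>B + p G\<close>.\<close>
    let ?Q = "\<lambda>m. \<exists>y\<in>carrier G - ?N. y [^] (p ^ m) \<in> ?B"
    obtain n where "x [^] (p ^ n) = \<one>" using torsion[OF x] .
    then have "?Q n" using x xN B.one_closed by (intro bexI[of _ x]) auto
    then have Q: "?Q (LEAST m. ?Q m)" by (rule LeastI)
    define m where "m = (LEAST m. ?Q m)"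
    obtain y where y: "y \<in> carrier G" "y \<notin> ?N" "y [^] (p ^ m) \<in> ?B" using Q m_def by blast
    have "y \<in> ?B" if "m = 0" using that y(1,3) by simp
    then have "m \<noteq> 0" using y(2) BN by blast
    then obtain k where k: "m = Suc k" by (cases m) auto
    obtain b where b: "b \<in> ?B" "b [^] (p ^ m) = y [^] (p ^ m)"
      using pure_independent_pure[OF S y(1,3)] .
    define c where "c = y \<otimes> inv b"
    have c: "c \<in> carrier G" "c [^] (p ^ Suc k) = \<one>"
      using y b B.mem_carrier k by (simp_all add: c_def nat_pow_distrib nat_pow_inv)
    obtain b' z where z: "b' \<in> ?B" "z \<in> carrier G" "c [^] (p ^ k) = b' \<otimes> z [^] (p ^ Suc k)"
      using max[OF c] by blast
    define y' where "y' = c \<otimes> inv (z [^] p)"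
    have "(y' \<otimes> z [^] p) \<otimes> b = y"
      using y(1) z b by (simp add: y'_def c_def m_assoc)
    then have "y' \<notin> ?N" using y(2) PN[OF z(2)] BN[OF b(1)] N.m_closed by metis
    moreover have "y' [^] (p ^ k) = b'"
      using c z by (simp add: y'_def nat_pow_distrib nat_pow_inv nat_pow_pow m_assoc)
    moreover have "y' \<in> carrier G" using c z by (simp add: y'_def)
    ultimately have "?Q k" using z(1) by blast
    then have "m \<le> k" unfolding m_def by (rule Least_le)
    then show False using k by simp
  qed
  then have one: "\<exists>b\<in>?B. \<exists>y\<in>carrier G. x = b \<otimes> y [^] p" if "x \<in> carrier G" for x
    using that unfolding set_mult_def by blast
  have dec: "\<exists>b\<in>?B. \<exists>y\<in>carrier G. x = b \<otimes> y [^] (p ^ k)" if "x \<in> carrier G" for x k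
    using that
  proof (induction k arbitrary: x)
    case 0
    then have "x = \<one> \<otimes> x [^] (p ^ 0)" by simp
    then show ?case using 0 B.one_closed by blast
  next
    case (Suc k)
    obtain b y where yb: "b \<in> ?B" "y \<in> carrier G" "x = b \<otimes> y [^] p" using one Suc.prems by blast
    obtain b' z where z: "b' \<in> ?B" "z \<in> carrier G" "y = b' \<otimes> z [^] (p ^ k)" using Suc.IH yb(2) by blast
    have "x = (b \<otimes> b' [^] p) \<otimes> z [^] (p ^ Suc k)"
      using yb z by (simp add: nat_pow_distrib nat_pow_pow m_assoc mult.commute)
    moreover have "b \<otimes> b' [^] p \<in> ?B" using yb z subgroup_nat_pow_closed[OF B] by blast
    ultimately show ?case using z(2) by blast
  qed
  have "divisible_group (G Mod ?B)"
    unfolding divisible_group_def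
  proof (intro allI impI ballI)
    fix n :: nat and X assume n: "0 < n" and X: "X \<in> carrier (G Mod ?B)"
    obtain x where x: "x \<in> carrier G" "X = ?B #> x" using X by (auto simp: carrier_FactGroup)
    have "n \<noteq> 0" "\<not> is_unit p" using n prime by auto
    \<comment> \<open>The \<open>p\<close>-part of \<open>n\<close> is handled by
      \<open>G = B + p^k G\<close>, the part prime to \<open>p\<close> by inverting it modulo the
      order of \<open>y\<close>.\<close>
    then obtain n' where n': "n = p ^ multiplicity p n * n'" "\<not> p dvd n'"
      using multiplicity_decompose' by blast
    obtain b y where yb: "b \<in> ?B" "y \<in> carrier G" "x = b \<otimes> y [^] (p ^ multiplicity p n)"
      using dec[OF x(1)] by blast
    obtain j where j: "y [^] (p ^ j) = \<one>" using torsion[OF yb(2)] .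
    have "coprime (int n') (int (p ^ j))"
      using prime_imp_coprime[OF prime n'(2)] by (simp add: coprime_commute)
    then obtain u v where uv: "u * int n' + v * int (p ^ j) = 1"
      using bezout_int[of "int n'" "int (p ^ j)"] by (metis coprime_imp_gcd_eq_1)
    have "y = y [^] (u * int n' + v * int (p ^ j))" using uv yb(2) by simp
    also have "\<dots> = (y [^] u) [^] n' \<otimes> (y [^] int (p ^ j)) [^] v"
      using yb(2) int_pow_int[of G "y [^] u" n'] int_pow_pow[of y u "int n'"]
        int_pow_pow[of y "int (p ^ j)" v] by (simp add: int_pow_mult mult.commute)
    also have "\<dots> = (y [^] u) [^] n'" using j yb(2) int_pow_int[of G y "p ^ j"] by simp
    finally have "(y [^] u) [^] n = y [^] (p ^ multiplicity p n)"
      using yb(2) n'(1) by (metis int_pow_closed mult.commute nat_pow_pow)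
    then have "x = b \<otimes> (y [^] u) [^] n" using yb(3) by simp
    then have "X = (?B #> b) #> (y [^] u) [^] n"
      using x(2) yb(1,2) by (simp add: coset_mult_assoc[OF B.subset])
    also have "\<dots> = ?B #> (y [^] u) [^] n" using B.rcos_const[OF is_group yb(1)] by simp
    also have "\<dots> = (?B #> (y [^] u)) [^]\<^bsub>G Mod ?B\<^esub> n" using N.FactGroup_pow yb(2) by simp
    finally show "\<exists>Y\<in>carrier (G Mod ?B). Y [^]\<^bsub>G Mod ?B\<^esub> n = X"
      using yb(2) by (auto simp: carrier_FactGroup)
  qed
  moreover have "pure_subgroup ?B G" unfolding pure_subgroup_def
    using B pure_independent_pure[OF S] by metis
  ultimately show ?thesis
    using pure_independent_direct_sum[OF S] by (simp add: basic_subgroup_def)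
qed

section \<open>Large subgroups\<close>

text \<open>The bounded case: \<open>p\<^sup>k G\<close> is divisible, so \<open>p\<^sup>k B = 0\<close> for a basic subgroup \<open>B\<close>, and
  \<open>G = L + B\<close> gives \<open>p\<^sup>k G = p\<^sup>k L\<close>.\<close>

lemma large_of_bounded_basic:
  assumes large: "large_subgroup L G"
    and bd: "\<And>m x. k \<le> m \<Longrightarrow> x \<in> carrier G \<Longrightarrow> x [^] (p ^ Suc m) = \<one> \<Longrightarrow>
      \<exists>u\<in>carrier G. x [^] (p ^ m) = u [^] (p ^ Suc m)"
    and z: "z \<in> carrier G"
  shows "z [^] (p ^ k) \<in> L"
proof -
  have socle: "\<exists>u\<in>carrier G. x [^] (p ^ k) = u [^] (p ^ (k + j))"
    if x: "x \<in> carrier G" "(x [^] (p ^ k)) [^] p = \<one>" for x j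
  proof (induction j)
    case (Suc j)
    then obtain u where u: "u \<in> carrier G" "x [^] (p ^ k) = u [^] (p ^ (k + j))" by blast
    then have "u [^] (p ^ Suc (k + j)) = \<one>" using x by (simp add: nat_pow_pow mult.commute)
    then show ?case using bd[of "k + j" u] u by auto
  qed (use x in auto)
  \<comment> \<open>Induction on the exponent: \<open>p^j (p^k w)\<close> lies in the socle, so it
    equals \<open>p^(k+j+1) u\<close> for some \<open>u\<close>; subtracting \<open>p u\<close> from
    \<open>w\<close> lowers the exponent by one.\<close>
  have step: "\<exists>u\<in>carrier G. w [^] (p ^ k) = u [^] (p ^ Suc k)"
    if "w \<in> carrier G" "w [^] (p ^ (k + j)) = \<one>" for w j
    using that
  proof (induction j arbitrary: w)
    case 0
    then show ?case by (auto intro!: bexI[of _ \<one>])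
  next
    case (Suc j)
    let ?x = "w [^] (p ^ j)"
    have "(?x [^] (p ^ k)) [^] p = \<one>"
      using Suc.prems by (simp add: nat_pow_pow ac_simps flip: power_add)
    then obtain u where u: "u \<in> carrier G" "?x [^] (p ^ k) = u [^] (p ^ (k + Suc j))"
      using socle[of ?x "Suc j"] Suc.prems by auto
    define w' where "w' = w \<otimes> inv (u [^] p)"
    have w': "w' \<in> carrier G" using u Suc.prems by (simp add: w'_def)
    have "w' [^] (p ^ (k + j)) = ?x [^] (p ^ k) \<otimes> inv (u [^] (p ^ (k + Suc j)))"
      using u(1) Suc.prems by (simp add: w'_def nat_pow_distrib nat_pow_inv nat_pow_pow power_add ac_simps)
    also have "\<dots> = \<one>" using u by simp
    finally obtain v where v: "v \<in> carrier G" "w' [^] (p ^ k) = v [^] (p ^ Suc k)"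
      using Suc.IH[OF w'] by blast
    have "w = w' \<otimes> u [^] p" using u(1) Suc.prems by (simp add: w'_def m_assoc)
    then have "w [^] (p ^ k) = (v \<otimes> u) [^] (p ^ Suc k)"
      using v u(1) w' by (simp add: nat_pow_distrib nat_pow_pow)
    then show ?case using v(1) u(1) by blast
  qed
  have div: "\<exists>u\<in>carrier G. w [^] (p ^ k) = u [^] (p ^ (k + j))" if w: "w \<in> carrier G" for w j
  proof (induction j)
    case (Suc j)
    then obtain u where u: "u \<in> carrier G" "w [^] (p ^ k) = u [^] (p ^ (k + j))" by blast
    obtain i where "u [^] (p ^ i) = \<one>" using torsion[OF u(1)] .
    then have "u [^] (p ^ (k + i)) = \<one>" using u(1) pow_prime_power_mono by simp
    then obtain v where v: "v \<in> carrier G" "u [^] (p ^ k) = v [^] (p ^ Suc k)"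
      using step u(1) by blast
    have "w [^] (p ^ k) = (u [^] (p ^ k)) [^] (p ^ j)" using u by (simp add: nat_pow_pow power_add)
    also have "\<dots> = v [^] (p ^ (k + Suc j))" using v by (simp add: nat_pow_pow power_add ac_simps)
    finally show ?case using v(1) by blast
  qed (use w in auto)
  have "pure_independent p G {}" by (simp add: pure_independent_def)
  then obtain S where S: "pure_independent p G S"
    "\<And>c m. c \<in> carrier G \<Longrightarrow> c [^] (p ^ Suc m) = \<one> \<Longrightarrow>
      \<exists>b\<in>generate G S. \<exists>x\<in>carrier G. c [^] (p ^ m) = b \<otimes> x [^] (p ^ Suc m)"
    by (rule maximal_pure_independent) blast
  have Sc: "S \<subseteq> carrier G" using S(1) by (rule pure_independent_carrier)
  obtain \<tau> where "orthogonal_homs G G S \<tau>" and \<tau>: "\<forall>s\<in>S. \<forall>x\<in>carrier G. \<tau> s x \<in> generate G {s}"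
    "\<forall>x\<in>generate G S. gfinprod G (\<lambda>s. \<tau> s x) S = x"
    using pure_independent_projections[OF S(1)] by metis
  interpret \<tau>: orthogonal_homs G G S \<tau> by fact
  \<comment> \<open>For every \<open>j\<close>, \<open>p^k b\<close> equals \<open>p^(k+j) u\<close>
    for some \<open>u\<close>. Choosing \<open>j\<close> such that \<open>p^j\<close> kills
    \<open>s\<close> makes the coordinate at \<open>s\<close> vanish.\<close>
  have bounded: "b [^] (p ^ k) = \<one>" if b: "b \<in> generate G S" for b
  proof -
    have bc: "b \<in> carrier G" using generate_in_carrier[OF Sc b] .
    have "\<tau> s (b [^] (p ^ k)) = \<one>" if s: "s \<in> S" for s
    proof -
      obtain j where j: "s [^] (p ^ j) = \<one>" using torsion Sc s by blast
      obtain u where u: "u \<in> carrier G" "b [^] (p ^ k) = u [^] (p ^ (k + j))" using div[OF bc] by blast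
      obtain c where c: "\<tau> s u = s [^] (c::int)" using \<tau>(1) s u(1) generate_pow[of s] Sc by blast
      have "\<tau> s (b [^] (p ^ k)) = (s [^] c) [^] (p ^ (k + j))"
        using u c group_hom.hom_nat_pow[OF \<tau>.group_hom[OF s] u(1)] by simp
      also have "\<dots> = (s [^] (p ^ (k + j))) [^] c"
        using s Sc int_pow_int[of G "s [^] c" "p ^ (k + j)"] int_pow_int[of G s "p ^ (k + j)"]
          int_pow_pow[of s c "int (p ^ (k + j))"] int_pow_pow[of s "int (p ^ (k + j))" c]
        by (auto simp: mult.commute)
      also have "s [^] (p ^ (k + j)) = \<one>" using j s Sc pow_prime_power_mono by auto
      finally show ?thesis by simp
    qed
    then have "{s \<in> S. \<tau> s (b [^] (p ^ k)) \<noteq> \<one>} = {}" by blast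
    then have "gfinprod G (\<lambda>s. \<tau> s (b [^] (p ^ k))) S = \<one>" by (simp only: gfinprod_def finprod_empty) simp
    then show ?thesis
      using \<tau>(2) subgroup_nat_pow_closed[OF generate_is_subgroup[OF Sc] b] by simp
  qed
  have "carrier G = L <#> generate G S"
    using large pure_independent_basic[OF S] by (auto simp: large_subgroup_def)
  then obtain l b where lb: "l \<in> L" "b \<in> generate G S" "z = l \<otimes> b"
    using z unfolding set_mult_def by blast
  have L: "subgroup L G" using large by (simp add: large_subgroup_def fully_invariant_def)
  have "z [^] (p ^ k) = l [^] (p ^ k)"
    using lb bounded[OF lb(2)] subgroup.mem_carrier[OF L] generate_in_carrier[OF Sc]
    by (simp add: nat_pow_distrib)
  then show ?thesis using subgroup_nat_pow_closed[OF L lb(1)] by simp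
qed

text \<open>The span of the earlier elements is killed by \<open>p^(e n)\<close>. If
  \<open>p^(e n) c n = b + p^(e n + 1) x\<close> with \<open>b\<close> in that span, then
  \<open>b\<close> is \<open>p^(e n)\<close> times an element of \<open>G\<close>, by purity also of
  an element of the span, hence zero; this contradicts the height of
  \<open>p^(e n) c n\<close>.\<close>

lemma pure_independent_increasing_orders:
  fixes c :: "nat \<Rightarrow> 'a"
  assumes e: "strict_mono e" and c: "\<And>i. c i \<in> carrier G" "\<And>i. c i [^] (p ^ Suc (e i)) = \<one>"
    and ht: "\<And>i x. x \<in> carrier G \<Longrightarrow> c i [^] (p ^ e i) \<noteq> x [^] (p ^ Suc (e i))"
  shows "pure_independent p G (range c)"
proof -
  have fin: "pure_independent p G (c ` {..<n})" for n
  proof (induction n)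
    case 0
    show ?case by (simp add: pure_independent_def)
  next
    case (Suc n)
    let ?B = "generate G (c ` {..<n})"
    have Cc: "c ` {..<n} \<subseteq> carrier G" using c by blast
    have B: "b [^] (p ^ e n) = \<one>" if "b \<in> ?B" for b
    proof (rule generate_hom_trivial[OF nat_pow_group_hom Cc _ that])
      show "s [^] (p ^ e n) = \<one>" if s: "s \<in> c ` {..<n}" for s
      proof -
        obtain i where "s = c i" "i < n" using s by blast
        moreover from this have "Suc (e i) \<le> e n" using e by (simp add: Suc_le_eq strict_mono_less)
        ultimately show ?thesis using c pow_prime_power_mono by blast
      qed
    qed
    have "pure_independent p G (insert (c n) (c ` {..<n}))"
    proof (rule pure_independent_insert[OF Suc c])
      fix b x assume b: "b \<in> ?B" and x: "x \<in> carrier G"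
      have bc: "b \<in> carrier G" using generate_in_carrier[OF Cc b] .
      show "c n [^] (p ^ e n) \<noteq> b \<otimes> x [^] (p ^ Suc (e n))"
      proof
        assume eq: "c n [^] (p ^ e n) = b \<otimes> x [^] (p ^ Suc (e n))"
        define g where "g = c n \<otimes> inv (x [^] p)"
        have g: "g \<in> carrier G" "g [^] (p ^ e n) = b"
          using eq c x bc by (simp_all add: g_def nat_pow_distrib nat_pow_inv nat_pow_pow m_assoc)
        then obtain b0 where b0: "b0 \<in> ?B" "b0 [^] (p ^ e n) = b"
          using pure_independent_pure[OF Suc g(1), of "p ^ e n"] b by metis
        then have "b = \<one>" using B by simp
        then show False using ht x eq by simp
      qed
    qed
    then show ?case by (simp add: lessThan_Suc)
  qed
  show ?thesis
  proof (rule pure_independent_finite[THEN iffD2], intro allI impI)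
    fix F assume F: "finite F" "F \<subseteq> range c"
    then obtain I where I: "finite I" "F = c ` I" by (metis finite_subset_image subset_UNIV)
    obtain n where "I \<subseteq> {..<n}" using finite_nat_iff_bounded I(1) by blast
    then show "pure_independent p G F" using pure_independent_subset[OF fin[of n]] I(2) by blast
  qed
qed

text \<open>The unbounded case: choose \<open>b i\<close> of order \<open>p\<^bsup>e i + 1\<^esup>\<close> generating cyclic summands with \<open>e\<close>
  increasing, and a basic subgroup that contains all \<open>c i = b i - p\<^bsup>d i\<^esup> b (i + 1)\<close>. Modulo the \<open>c i\<close> with
  \<open>i < N\<close>, \<open>b 0\<close> is \<open>p\<^bsup>e N - e 0\<^esup> b N\<close>. Writing \<open>b 0 = l + \<beta>\<close> and taking \<open>c N\<close> outside the support of \<open>\<beta>\<close>,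
  an endomorphism that sends \<open>c N\<close> to \<open>z\<close> and kills the other generators takes \<open>l \<in> L\<close> to a unit multiple of
  \<open>p\<^bsup>e N - e 0\<^esup> z\<close>.\<close>

lemma large_of_unbounded:
  assumes large: "large_subgroup L G"
    and unbd: "\<And>k. \<exists>m\<ge>k. \<exists>x\<in>carrier G. x [^] (p ^ Suc m) = \<one> \<and>
      (\<forall>u\<in>carrier G. x [^] (p ^ m) \<noteq> u [^] (p ^ Suc m))"
  obtains k where "\<And>z. z \<in> carrier G \<Longrightarrow> z [^] (p ^ (n + k)) = \<one> \<Longrightarrow> z [^] (p ^ k) \<in> L"
proof -
  have L: "subgroup L G" and inv_L: "\<And>f. f \<in> hom G G \<Longrightarrow> f ` L \<subseteq> L"
    using large by (auto simp: large_subgroup_def fully_invariant_def)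
  obtain M X where MX: "\<And>k. k \<le> M k" "\<And>k. X k \<in> carrier G" "\<And>k. X k [^] (p ^ Suc (M k)) = \<one>"
    "\<And>k u. u \<in> carrier G \<Longrightarrow> X k [^] (p ^ M k) \<noteq> u [^] (p ^ Suc (M k))"
    using unbd by metis
  \<comment> \<open>Starting from \<open>n\<close> gives \<open>e 0 >= n\<close>, so that an element
    killed by \<open>p^(n + e N - e 0)\<close> is killed by \<open>p^(e N + 1)\<close>, the order of
    \<open>c N\<close>. The successor makes \<open>e\<close> strictly increasing.\<close>
  define a where "a = rec_nat n (\<lambda>_ k. Suc (M k))"
  define e where "e i = M (a i)" for i
  define b where "b i = X (a i)" for i
  have aSuc: "a (Suc i) = Suc (e i)" for i by (simp add: a_def e_def)
  have e_Suc: "e i < e (Suc i)" for i using MX(1)[of "a (Suc i)"] by (simp add: aSuc e_def[of "Suc i"])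
  then have e: "strict_mono e" by (rule strict_mono_Suc_iff[THEN iffD2, rule_format])
  have e0: "n \<le> e 0" using MX(1)[of n] by (simp add: e_def a_def)
  have b: "b i \<in> carrier G" "b i [^] (p ^ Suc (e i)) = \<one>"
    "\<And>u. u \<in> carrier G \<Longrightarrow> b i [^] (p ^ e i) \<noteq> u [^] (p ^ Suc (e i))" for i
    using MX by (simp_all add: b_def e_def)
  define d where "d i = e (Suc i) - e i" for i
  have d: "e (Suc i) = e i + d i" "d i = Suc (d i - 1)" for i using e_Suc[of i] by (simp_all add: d_def)
  define c where "c i = b i \<otimes> inv (b (Suc i) [^] (p ^ d i))" for i
  have c: "c i \<in> carrier G" for i using b by (simp add: c_def)
  have bc: "b i = c i \<otimes> b (Suc i) [^] (p ^ d i)" for i using b by (simp add: c_def m_assoc)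
  have c_pow: "c i [^] (p ^ e i) = b i [^] (p ^ e i) \<otimes> inv (b (Suc i) [^] (p ^ e (Suc i)))" for i
    using b by (simp add: c_def nat_pow_distrib nat_pow_inv pow_pow_prime d(1) add.commute)
  have c_ord: "c i [^] (p ^ Suc (e i)) = \<one>" for i
  proof -
    have "c i [^] (p ^ Suc (e i)) = (c i [^] (p ^ e i)) [^] p"
      using c by (simp add: nat_pow_pow mult.commute)
    also have "\<dots> = b i [^] (p ^ Suc (e i)) \<otimes> inv (b (Suc i) [^] (p ^ Suc (e (Suc i))))"
      using b(1) by (simp add: c_pow nat_pow_distrib nat_pow_inv nat_pow_pow mult.commute)
    finally show ?thesis using b(2) by simp
  qed
  \<comment> \<open>The correction term contributes \<open>p^(e (i+1)) b (i+1)\<close>, which is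
    divisible by \<open>p^(e i + 1)\<close>; thus the obstruction for \<open>b i\<close> passes to
    \<open>c i\<close>.\<close>
  have c_ht: "c i [^] (p ^ e i) \<noteq> x [^] (p ^ Suc (e i))" if x: "x \<in> carrier G" for i x
  proof
    assume eq: "c i [^] (p ^ e i) = x [^] (p ^ Suc (e i))"
    have "e (Suc i) = (d i - 1) + Suc (e i)" using d[of i] by simp
    then have "b (Suc i) [^] (p ^ e (Suc i)) = (b (Suc i) [^] (p ^ (d i - 1))) [^] (p ^ Suc (e i))"
      using b(1) by (simp only: pow_pow_prime)
    moreover have "b i [^] (p ^ e i) = c i [^] (p ^ e i) \<otimes> b (Suc i) [^] (p ^ e (Suc i))"
      using b(1) by (simp add: c_pow m_assoc)
    ultimately have "b i [^] (p ^ e i) = (x \<otimes> b (Suc i) [^] (p ^ (d i - 1))) [^] (p ^ Suc (e i))"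
      using eq x b(1) by (simp add: nat_pow_distrib del: power_Suc)
    then show False using b(1,3) x by blast
  qed
  have c_neq: "c i \<noteq> c j" if "i < j" for i j
  proof
    assume "c i = c j"
    have "Suc (e i) \<le> e j" using e that by (simp add: Suc_le_eq strict_mono_less)
    then have "c j [^] (p ^ e j) = \<one>"
      using pow_prime_power_mono[OF c c_ord] \<open>c i = c j\<close> by metis
    then show False using c_ht[OF one_closed, of j] by simp
  qed
  then have inj: "inj c" by (metis injI linorder_neqE_nat)
  have "pure_independent p G (range c)"
    by (rule pure_independent_increasing_orders[OF e c c_ord c_ht])
  then obtain S where rS: "range c \<subseteq> S" and S: "pure_independent p G S"
    "\<And>c m. c \<in> carrier G \<Longrightarrow> c [^] (p ^ Suc m) = \<one> \<Longrightarrow>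
      \<exists>b\<in>generate G S. \<exists>x\<in>carrier G. c [^] (p ^ m) = b \<otimes> x [^] (p ^ Suc m)"
    by (rule maximal_pure_independent) blast
  have Sc: "S \<subseteq> carrier G" using S(1) by (rule pure_independent_carrier)
  have "carrier G = L <#> generate G S"
    using large pure_independent_basic[OF S] by (auto simp: large_subgroup_def)
  then obtain l \<beta> where l: "l \<in> L" "\<beta> \<in> generate G S" "b 0 = l \<otimes> \<beta>"
    using b(1)[of 0] unfolding set_mult_def by blast
  have lc: "l \<in> carrier G" "\<beta> \<in> carrier G"
    using subgroup.mem_carrier[OF L l(1)] generate_in_carrier[OF Sc l(2)] by auto
  obtain F where F: "finite F" "F \<subseteq> S" "\<beta> \<in> generate G F" using generate_finite[OF l(2)] .
  have "infinite (range c)" using inj by (simp add: finite_image_iff)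
  then obtain N where N: "c N \<notin> F" using F(1) by (metis finite_subset image_subsetI rangeI)
  have \<beta>: "\<beta> \<in> generate G (S - {c N})" by (rule generate_mono[OF F(3)]) (use F(2) N in blast)
  have eN: "e 0 \<le> e N" using e by (simp add: strict_mono_less_eq)
  \<comment> \<open>\<open>N\<close> was chosen from \<open>\<beta>\<close> alone, so this exponent
    serves all \<open>z\<close> at once.\<close>
  show thesis
  proof (rule that[of "e N - e 0"])
    fix z assume z: "z \<in> carrier G" "z [^] (p ^ (n + (e N - e 0))) = \<one>"
    have zN: "z [^] (p ^ Suc (e N)) = \<one>"
      by (rule pow_prime_power_mono[OF z]) (use e0 eN in simp)
    have zj: "z [^] (p ^ j) = \<one>" if "c N [^] (p ^ j) = \<one>" for j
    proof -
      have "\<not> j \<le> e N" using pow_prime_power_mono[OF c that] c_ht[OF one_closed, of N] by auto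
      then show ?thesis using pow_prime_power_mono[OF z(1) zN] by simp
    qed
    have "c N \<in> S" using rS by blast
    from pure_independent_hom[OF S(1) this is_group z(1) zj]
    obtain \<tau> where \<tau>: "\<tau> \<in> hom G G" "\<tau> (c N) = z"
      "\<And>r. r \<in> generate G (S - {c N}) \<Longrightarrow> \<tau> r = \<one>"
      "\<And>x. x \<in> carrier G \<Longrightarrow> \<exists>c::int. \<tau> x = z [^] c"
      by metis
    interpret \<tau>: group_hom G G \<tau> using \<tau>(1) by unfold_locales
    have \<tau>c: "\<tau> (c i) = \<one>" if "i \<noteq> N" for i
      using rS inj that by (intro \<tau>(3) generate.incl) (auto simp: inj_eq)
    have \<tau>b: "\<tau> (b 0) = \<tau> (b i) [^] (p ^ (e i - e 0))" if "i \<le> N" for i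
      using that
    proof (induction i)
      case (Suc i)
      have "\<tau> (b i) = \<tau> (b (Suc i)) [^] (p ^ d i)"
        using \<tau>c[of i] Suc.prems b(1) c by (subst bc) (simp add: \<tau>.hom_nat_pow)
      then have "\<tau> (b 0) = \<tau> (b (Suc i)) [^] (p ^ (d i + (e i - e 0)))"
        using Suc b(1) by (simp add: pow_pow_prime)
      moreover have "e 0 \<le> e i" using e by (simp add: strict_mono_less_eq)
      ultimately show ?case using d(1)[of i] by (simp add: add.commute)
    qed (use b in simp)
    \<comment> \<open>Of the image of \<open>b (N+1)\<close> only its being a multiple of
      \<open>z\<close> is known. It enters multiplied by \<open>p^(d N)\<close> with
      \<open>d N >= 1\<close>, so the coefficient \<open>1 + j p^(d N)\<close> is prime to
      \<open>p\<close> and can be cancelled.\<close>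
    obtain j where j: "\<tau> (b (Suc N)) = z [^] (j::int)" using \<tau>(4) b(1) by blast
    have "\<tau> (b N) = z \<otimes> (z [^] j) [^] (p ^ d N)"
      using j b(1) c \<tau>(2) by (subst bc) (simp add: \<tau>.hom_nat_pow)
    also have "\<dots> = z [^] (1 + j * int (p ^ d N))"
      using z(1) int_pow_pow[of z j "int (p ^ d N)"] int_pow_int[of G "z [^] j" "p ^ d N"]
      by (simp add: int_pow_mult)
    finally have \<tau>bN: "\<tau> (b N) = z [^] (1 + j * int (p ^ d N))" .
    have "\<tau> l = \<tau> (b 0)" using l \<tau>(3)[OF \<beta>] lc by simp
    also have "\<dots> = (z [^] (p ^ (e N - e 0))) [^] (1 + j * int (p ^ d N))"
      using \<tau>b[of N] \<tau>bN z(1) int_pow_int[of G "z [^] (1 + j * int (p ^ d N))" "p ^ (e N - e 0)"]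
        int_pow_int[of G z "p ^ (e N - e 0)"]
        int_pow_pow[of z "1 + j * int (p ^ d N)" "int (p ^ (e N - e 0))"]
        int_pow_pow[of z "int (p ^ (e N - e 0))" "1 + j * int (p ^ d N)"]
      by (simp add: mult.commute)
    finally have "(z [^] (p ^ (e N - e 0))) [^] (1 + j * int (p ^ d N)) \<in> L"
      using inv_L[OF \<tau>(1)] l(1) by auto
    moreover have "\<not> int p dvd 1 + j * int (p ^ d N)"
    proof
      assume "int p dvd 1 + j * int (p ^ d N)"
      moreover have "int p dvd j * int (p ^ d N)" using d(2)[of N] by (metis dvd_mult dvd_triv_left int_dvd_int_iff power_Suc)
      ultimately have "int p dvd 1" by (simp only: dvd_add_left_iff)
      then show False using prime by (simp add: prime_nat_iff)
    qed
    ultimately show "z [^] (p ^ (e N - e 0)) \<in> L"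
      using pow_prime_mem[OF L] z(1) by blast
  qed
qed

text \<open>Pierce's description of large subgroups, in the form \<open>p\<^sup>k G[p\<^sup>n\<^sup>+\<^sup>k] = (p\<^sup>k G)[p\<^sup>n] \<subseteq> L\<close>.\<close>

lemma large_subgroup_torsion:
  assumes "large_subgroup L G"
  obtains k where "\<forall>j\<ge>k. \<forall>z\<in>carrier G. z [^] (p ^ (n + j)) = \<one> \<longrightarrow> z [^] (p ^ j) \<in> L"
proof -
  have "\<exists>k. \<forall>z\<in>carrier G. z [^] (p ^ (n + k)) = \<one> \<longrightarrow> z [^] (p ^ k) \<in> L"
  proof (cases "\<exists>k. \<forall>m\<ge>k. \<forall>x\<in>carrier G. x [^] (p ^ Suc m) = \<one> \<longrightarrow>
      (\<exists>u\<in>carrier G. x [^] (p ^ m) = u [^] (p ^ Suc m))")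
    case True
    then show ?thesis using large_of_bounded_basic[OF assms] by metis
  next
    case False
    show ?thesis by (rule large_of_unbounded[OF assms, of n]) (use False in blast)+
  qed
  then obtain k where k: "\<And>z. z \<in> carrier G \<Longrightarrow> z [^] (p ^ (n + k)) = \<one> \<Longrightarrow> z [^] (p ^ k) \<in> L"
    by blast
  show thesis
  proof (rule that[of k], intro allI impI ballI)
    fix j z assume j: "k \<le> j" and z: "z \<in> carrier G" "z [^] (p ^ (n + j)) = \<one>"
    have "(z [^] (p ^ (j - k))) [^] (p ^ (n + k)) = \<one>" "(z [^] (p ^ (j - k))) [^] (p ^ k) = z [^] (p ^ j)"
      using j z by (simp_all add: pow_pow_prime add.commute)
    then show "z [^] (p ^ j) \<in> L" using k[of "z [^] (p ^ (j - k))"] z(1) by simp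
  qed
qed

end

text \<open>The preimage in \<open>G\<close> of a chain witnessing Kulikov's criterion for \<open>G/E\<close> with \<open>E \<le> G[p]\<close>:
  the \<open>Q n / E\<close> exhaust the socle of \<open>G/E\<close>, and each has bounded heights.\<close>

definition kulikov_chain :: "nat \<Rightarrow> ('a, 'b) monoid_scheme \<Rightarrow> 'a set \<Rightarrow> (nat \<Rightarrow> 'a set) \<Rightarrow> bool"
  where "kulikov_chain p G E Q \<longleftrightarrow> subgroup E G \<and> (\<forall>e\<in>E. e [^]\<^bsub>G\<^esub> p = \<one>\<^bsub>G\<^esub>) \<and>
    (\<forall>n. subgroup (Q n) G \<and> E \<subseteq> Q n \<and> Q n \<subseteq> Q (Suc n) \<and>
      (\<exists>k. \<forall>x\<in>carrier G. x [^]\<^bsub>G\<^esub> (p ^ k) \<in> Q n \<longrightarrow> x [^]\<^bsub>G\<^esub> (p ^ k) \<in> E)) \<and>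
    (\<Union>n. Q n) = {x \<in> carrier G. x [^]\<^bsub>G\<^esub> p \<in> E}"

section \<open>Kulikov chains of subgroups and of large subgroups\<close>

text \<open>Intersecting with \<open>L\<close> suffices, because heights computed in a subgroup
  never exceed those in the group.\<close>

lemma (in group) kulikov_chain_subgroup:
  assumes L: "subgroup L G" and ch: "kulikov_chain p G E Q"
  shows "kulikov_chain p (G\<lparr>carrier := L\<rparr>) (E \<inter> L) (\<lambda>n. Q n \<inter> L)"
proof -
  have Lc: "L \<subseteq> carrier G" using subgroup.subset[OF L] .
  have sub: "subgroup (A \<inter> L) (G\<lparr>carrier := L\<rparr>)" if "subgroup A G" for A
    using that L by (intro subgroup_incl subgroup_Int) auto
  have pow: "x [^] (n::nat) \<in> L" if "x \<in> L" for x n using subgroup_nat_pow_closed[OF L that] .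
  have bound: "\<exists>k. \<forall>x\<in>L. x [^] (p ^ k) \<in> Q n \<inter> L \<longrightarrow> x [^] (p ^ k) \<in> E \<inter> L" for n
    using ch Lc unfolding kulikov_chain_def by (meson IntD1 IntI pow subsetD)
  have "(\<Union>n. Q n \<inter> L) = {x \<in> L. x [^] p \<in> E \<inter> L}"
  proof -
    have "(\<Union>n. Q n \<inter> L) = (\<Union>n. Q n) \<inter> L" by blast
    also have "\<dots> = {x \<in> carrier G. x [^] p \<in> E} \<inter> L"
      using ch by (simp add: kulikov_chain_def)
    finally show ?thesis using Lc pow by blast
  qed
  then show ?thesis
    using ch sub bound unfolding kulikov_chain_def by (auto simp flip: nat_pow_consistent)
qed

lemma set_mult_memI: "a \<in> A \<Longrightarrow> b \<in> B \<Longrightarrow> a \<otimes>\<^bsub>G\<^esub> b \<in> A <#>\<^bsub>G\<^esub> B"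
  by (auto simp: set_mult_def)

context primary_comm_group
begin

text \<open>\<open>V/E\<close> is the socle of \<open>G/E\<close> and \<open>W/E\<close> its part of
  large height; \<open>W\<close> lies in \<open>L\<close>, where the given chain exhausts it. A
  subgroup \<open>C\<close> of \<open>V\<close> with \<open>C + W = V\<close> and \<open>C\<close>
  meeting \<open>W\<close> in \<open>E\<close> supplies the rest, and the new chain is
  \<open>C + (Q n \<inter> W)\<close>.\<close>

lemma kulikov_chain_large:
  assumes large: "large_subgroup L G" and ch: "kulikov_chain p (G\<lparr>carrier := L\<rparr>) E Q"
  shows "\<exists>Q'. kulikov_chain p G E Q'"
proof -
  have L: "subgroup L G" using large by (simp add: large_subgroup_def fully_invariant_def)
  interpret L: subgroup L G by (rule L)
  have E: "subgroup E G" and EL: "E \<subseteq> L" and Ep: "\<And>e. e \<in> E \<Longrightarrow> e [^] p = \<one>"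
    and Q: "\<And>n. subgroup (Q n) G" "\<And>n. E \<subseteq> Q n" "\<And>n. Q n \<subseteq> Q (Suc n)"
    and bd: "\<And>n. \<exists>k. \<forall>x\<in>L. x [^] (p ^ k) \<in> Q n \<longrightarrow> x [^] (p ^ k) \<in> E"
    and UQ: "(\<Union>n. Q n) = {x \<in> L. x [^] p \<in> E}"
    using ch incl_subgroup[OF L] subgroup.subset[of E "G\<lparr>carrier := L\<rparr>"]
    unfolding kulikov_chain_def by (simp_all flip: nat_pow_consistent)
  interpret E: subgroup E G by (rule E)
  define V where "V = {x \<in> carrier G. x [^] p \<in> E}"
  have V: "subgroup V G"
  proof (rule subgroupI)
    show "V \<subseteq> carrier G" by (auto simp: V_def)
    have "\<one> \<in> V" using E.one_closed by (simp add: V_def)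
    then show "V \<noteq> {}" by blast
    show "inv x \<in> V" if "x \<in> V" for x
      using that E.m_inv_closed by (simp add: V_def nat_pow_inv)
    show "x \<otimes> y \<in> V" if "x \<in> V" "y \<in> V" for x y
      using that E.m_closed by (simp add: V_def nat_pow_distrib)
  qed
  note Vc = subgroup.mem_carrier[OF V]
  have EV: "E \<subseteq> V"
  proof
    show "e \<in> V" if "e \<in> E" for e using Ep[OF that] that by (simp add: V_def)
  qed
  \<comment> \<open>The \<open>2\<close> arises because \<open>V\<close> is killed by
    \<open>p^2\<close>: \<open>p V\<close> lies in \<open>E\<close>, and
    \<open>p E = 0\<close>.\<close>
  obtain K where K: "\<forall>j\<ge>K. \<forall>z\<in>carrier G. z [^] (p ^ (2 + j)) = \<one> \<longrightarrow> z [^] (p ^ j) \<in> L"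
    using large_subgroup_torsion[OF large, of 2] .
  define W where "W = V \<inter> (E <#> (\<lambda>x. x [^] (p ^ K)) ` carrier G)"
  have W: "subgroup W G"
    unfolding W_def by (intro subgroup_Int V mult_subgroups E subgroup_powers)
  note Wc = subgroup.mem_carrier[OF W]
  have WL: "x \<in> L" if x: "x \<in> W" for x
  proof -
    obtain e z where ez: "e \<in> E" "z \<in> carrier G" "x = e \<otimes> z [^] (p ^ K)"
      using x unfolding W_def set_mult_def by blast
    have "x [^] p = (z [^] (p ^ K)) [^] p" using ez Ep by (simp add: nat_pow_distrib)
    moreover have "x [^] p \<in> E" using x by (simp add: W_def V_def)
    ultimately have "((z [^] (p ^ K)) [^] p) [^] p = \<one>" using Ep by simp
    then have "z [^] (p ^ (2 + K)) = \<one>"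
      using ez(2) by (simp add: nat_pow_pow power2_eq_square ac_simps)
    then have "z [^] (p ^ K) \<in> L" using K ez(2) by blast
    then show ?thesis using ez(1,3) EL by auto
  qed
  \<comment> \<open>\<open>M\<close> is enlarged inside all of \<open>G\<close>, but only its trace
    \<open>C\<close> on \<open>V\<close> is used; maximality of \<open>M\<close> still makes
    \<open>C\<close> a complement of \<open>W\<close> in \<open>V\<close> modulo
    \<open>E\<close>.\<close>
  have "E \<inter> W \<subseteq> E" by blast
  then obtain M where M: "subgroup M G" "E \<subseteq> M" "M \<inter> W \<subseteq> E"
    and max: "\<And>x. x \<in> carrier G \<Longrightarrow> x \<notin> M \<Longrightarrow> \<exists>y\<in>M. \<exists>j::int. y \<otimes> x [^] j \<in> W - E"
    using maximal_avoiding_subgroup[OF E] by metis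
  interpret M: subgroup M G by (rule M)
  define C where "C = M \<inter> V"
  have C: "subgroup C G" unfolding C_def using M(1) V by (rule subgroup_Int)
  note Cc = subgroup.mem_carrier[OF C]
  have EC: "E \<subseteq> C" using M EV by (simp add: C_def)
  have CW: "subgroup (C <#> W) G" by (intro mult_subgroups C W)
  have CWV: "C <#> W \<subseteq> V" unfolding set_mult_def C_def W_def using subgroup.m_closed[OF V] by blast
  have V_CW: "x \<in> C <#> W" if x: "x \<in> V" for x
  proof (cases "x \<in> M")
    case True
    then have "x \<in> C" "x = x \<otimes> \<one>" using x Vc[OF x] by (simp_all add: C_def)
    then show ?thesis unfolding set_mult_def using subgroup.one_closed[OF W] by blast
  next
    case False
    have xc: "x \<in> carrier G" using Vc[OF x] .
    obtain y j where y: "y \<in> M" "y \<otimes> x [^] (j::int) \<in> W" "y \<otimes> x [^] j \<notin> E"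
      using max[OF xc False] by blast
    define w where "w = y \<otimes> x [^] j"
    have xj: "x [^] j \<in> V" using subgroup_int_pow_closed[OF V x] .
    have w: "w \<in> W" "w \<in> V" using y(2) by (simp_all add: w_def W_def)
    have "y = w \<otimes> inv (x [^] j)" using y(1) xc by (simp add: w_def m_assoc)
    then have "y \<in> V" using subgroup.m_closed[OF V w(2) subgroup.m_inv_closed[OF V xj]] by simp
    then have yC: "y \<in> C" using y(1) by (simp add: C_def)
    have "\<not> int p dvd j"
    proof
      assume "int p dvd j"
      then obtain i where "j = int p * i" by blast
      then have "x [^] j = (x [^] p) [^] i" using xc int_pow_pow[OF xc, of "int p" i] by (simp add: int_pow_int)
      then have "x [^] j \<in> E" using x subgroup_int_pow_closed[OF E] by (simp add: V_def)
      then have "w \<in> M" using y(1) M(2) by (auto simp: w_def)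
      then show False using w(1) M(3) y(3) by (auto simp: w_def)
    qed
    moreover have "x [^] j = inv y \<otimes> w" using y(1) xc by (simp add: w_def m_assoc[symmetric])
    then have "x [^] j \<in> C <#> W" using subgroup.m_inv_closed[OF C yC] w(1) unfolding set_mult_def by blast
    ultimately show ?thesis using pow_prime_mem[OF CW xc] by blast
  qed
  \<comment> \<open>All of \<open>C\<close> can enter every member: an element of \<open>V\<close>
    divisible by \<open>p^K\<close> lies in \<open>W\<close>, so its \<open>C\<close>-component lies
    in both \<open>C\<close> and \<open>W\<close>, hence in \<open>E\<close>.\<close>
  define Q' where "Q' n = C <#> (Q n \<inter> W)" for n
  have "kulikov_chain p G E Q'"
    unfolding kulikov_chain_def
  proof (intro conjI allI ballI E)
    show "e [^] p = \<one>" if "e \<in> E" for e using Ep that .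
    show "subgroup (Q' n) G" for n
      unfolding Q'_def by (intro mult_subgroups C subgroup_Int Q W)
    show "E \<subseteq> Q' n" for n
    proof
      fix e assume "e \<in> E"
      then have "e \<in> C" "e = e \<otimes> \<one>" using EC by auto
      moreover have "\<one> \<in> Q n \<inter> W" using subgroup.one_closed[OF Q(1)] subgroup.one_closed[OF W] by simp
      ultimately show "e \<in> Q' n" unfolding Q'_def set_mult_def by blast
    qed
    show "Q' n \<subseteq> Q' (Suc n)" for n
      using Q(3)[of n] unfolding Q'_def by (intro mono_set_mult) auto
    show "\<exists>k. \<forall>x\<in>carrier G. x [^] (p ^ k) \<in> Q' n \<longrightarrow> x [^] (p ^ k) \<in> E" for n
    proof -
      obtain k where k: "\<And>x. x \<in> L \<Longrightarrow> x [^] (p ^ k) \<in> Q n \<Longrightarrow> x [^] (p ^ k) \<in> E" using bd by blast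
      \<comment> \<open>For \<open>p^(K+k') z\<close> to lie in \<open>L\<close> it must be killed
        by \<open>p^(k+2)\<close>: multiplying by \<open>p^k\<close> gives an element of
        \<open>V\<close>, which \<open>p^2\<close> kills. The reserved factor \<open>p^k\<close> is
        the height then available inside \<open>L\<close>.\<close>
      obtain k' where k': "\<forall>j\<ge>k'. \<forall>z\<in>carrier G. z [^] (p ^ (k + 2 + j)) = \<one> \<longrightarrow> z [^] (p ^ j) \<in> L"
        using large_subgroup_torsion[OF large, of "k + 2"] .
      have "z [^] (p ^ (K + k' + k)) \<in> E"
        if z: "z \<in> carrier G" and zQ: "z [^] (p ^ (K + k' + k)) \<in> Q' n" for z
      proof -
        let ?z = "z [^] (p ^ (K + k' + k))"
        obtain c s where cs: "c \<in> C" "s \<in> Q n" "s \<in> W" "?z = c \<otimes> s"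
          using zQ unfolding Q'_def set_mult_def by blast
        have "c \<otimes> s \<in> C <#> W" using cs unfolding set_mult_def by blast
        then have zV: "?z \<in> V" using CWV cs(4) by auto
        moreover have "?z = \<one> \<otimes> (z [^] (p ^ (k' + k))) [^] (p ^ K)"
          using z by (simp add: pow_pow_prime ac_simps)
        moreover have "(z [^] (p ^ (k' + k))) [^] (p ^ K) \<in> (\<lambda>x. x [^] (p ^ K)) ` carrier G"
          using z by simp
        ultimately have zW: "?z \<in> W"
          using set_mult_memI[OF E.one_closed] unfolding W_def by (metis IntI)
        have "c = ?z \<otimes> inv s" using cs Cc Wc by (simp add: m_assoc)
        then have "c \<in> W" using subgroup.m_closed[OF W zW subgroup.m_inv_closed[OF W cs(3)]] by simp
        then have "c \<in> E" using cs(1) M(3) by (auto simp: C_def)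
        then have "?z \<in> Q n" using cs Q(2)[of n] subgroup.m_closed[OF Q(1)] by auto
        moreover have "(z [^] (p ^ (K + k'))) [^] (p ^ k) = ?z" using z by (simp add: pow_pow_prime)
        moreover have "z [^] (p ^ (K + k')) \<in> L"
        proof (rule k'[rule_format])
          have "(?z [^] p) [^] p = \<one>" using zV Ep by (simp add: V_def)
          then show "z [^] (p ^ (k + 2 + (K + k'))) = \<one>"
            using z by (simp add: nat_pow_pow power_add power2_eq_square ac_simps)
        qed (use z in auto)
        ultimately show ?thesis using k by metis
      qed
      then show ?thesis by blast
    qed
    show "(\<Union>n. Q' n) = {x \<in> carrier G. x [^] p \<in> E}"
    proof
      have "Q' n \<subseteq> V" for n using CWV unfolding Q'_def set_mult_def by blast
      then show "(\<Union>n. Q' n) \<subseteq> {x \<in> carrier G. x [^] p \<in> E}" unfolding V_def by blast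
      show "{x \<in> carrier G. x [^] p \<in> E} \<subseteq> (\<Union>n. Q' n)"
      proof
        fix x assume "x \<in> {x \<in> carrier G. x [^] p \<in> E}"
        then have "x \<in> C <#> W" using V_CW by (simp add: V_def)
        then obtain c w where cw: "c \<in> C" "w \<in> W" "x = c \<otimes> w" unfolding set_mult_def by blast
        have "w [^] p \<in> E" using cw(2) by (simp add: W_def V_def)
        then have "w \<in> (\<Union>n. Q n)" using UQ WL[OF cw(2)] by simp
        then obtain n where "w \<in> Q n" by blast
        then have "x \<in> Q' n" unfolding Q'_def cw(3) using cw(1,2) by (intro set_mult_memI) auto
        then show "x \<in> (\<Union>n. Q' n)" by blast
      qed
    qed
  qed
  then show ?thesis by blast
qed

end

section \<open>Kulikov's criterion\<close>

context primary_comm_group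
begin

text \<open>If \<open>T\<close> is maximal and \<open>v \<in> P\<close> lies outside of its span, then an element of maximal height in the
  coset of \<open>v\<close> modulo the socle of the span is \<open>p\<^sup>h c\<close> for some \<open>c\<close> that can be added to \<open>T\<close>.\<close>

lemma pure_independent_extend_socle:
  assumes S: "pure_independent p G S" "\<forall>x\<in>generate G S. x [^] p = \<one> \<longrightarrow> x \<in> P"
    and P: "subgroup P G" "\<forall>x\<in>P. x [^] p = \<one>"
    and bd: "\<forall>x\<in>carrier G. x [^] (p ^ k) \<in> P \<longrightarrow> x [^] (p ^ k) = \<one>"
  obtains T where "S \<subseteq> T" "pure_independent p G T"
    "\<forall>x\<in>generate G T. x [^] p = \<one> \<longrightarrow> x \<in> P" "P \<subseteq> generate G T"
proof -
  let ?\<Phi> = "\<lambda>T. pure_independent p G T \<and> (\<forall>x\<in>generate G T. x [^] p = \<one> \<longrightarrow> x \<in> P)"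
  have "?\<Phi> T \<longleftrightarrow> (\<forall>F. finite F \<longrightarrow> F \<subseteq> T \<longrightarrow> ?\<Phi> F)" for T
  proof (intro iffI allI impI)
    fix F assume T: "?\<Phi> T" and F: "F \<subseteq> T"
    have "generate G F \<subseteq> generate G T" using F by (rule mono_generate)
    then show "?\<Phi> F" using T pure_independent_subset[OF _ F] by blast
  next
    assume fin: "\<forall>F. finite F \<longrightarrow> F \<subseteq> T \<longrightarrow> ?\<Phi> F"
    have "x \<in> P" if x: "x \<in> generate G T" "x [^] p = \<one>" for x
    proof -
      obtain F where "finite F" "F \<subseteq> T" "x \<in> generate G F" using generate_finite[OF x(1)] .
      then show ?thesis using fin x(2) by blast
    qed
    moreover have "pure_independent p G T" using fin pure_independent_finite[of p G T] by blast
    ultimately show "?\<Phi> T" by blast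
  qed
  then obtain T where T: "S \<subseteq> T" "?\<Phi> T" "\<And>x. ?\<Phi> (insert x T) \<Longrightarrow> x \<in> T"
    by (rule finite_character_maximal[of ?\<Phi> S]) (use S in blast)+
  let ?B = "generate G T"
  have PT: "pure_independent p G T" using T(2) by blast
  have Tc: "T \<subseteq> carrier G" using PT by (rule pure_independent_carrier)
  have B: "subgroup ?B G" by (rule generate_is_subgroup[OF Tc])
  note Bc = subgroup.mem_carrier[OF B] and Pc = subgroup.mem_carrier[OF P(1)]
  have "P \<subseteq> ?B"
  proof (rule ccontr)
    assume "\<not> P \<subseteq> ?B"
    then obtain v where v: "v \<in> P" "v \<notin> ?B" by blast
    \<comment> \<open>\<open>A h\<close> says that some representative of the coset of
      \<open>v\<close> has height at least \<open>h\<close>. It holds at 0 and fails at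
      \<open>k\<close>, since every representative is a nonzero element of \<open>P\<close>; so
      there is a last \<open>h\<close>.\<close>
    define A where "A = (\<lambda>h. \<exists>b\<in>?B. b [^] p = \<one> \<and> (\<exists>w\<in>carrier G. v \<otimes> b = w [^] (p ^ h)))"
    have vb: "v \<otimes> b \<noteq> \<one>" if "b \<in> ?B" for b
    proof
      assume "v \<otimes> b = \<one>"
      then have "v = inv b" using v(1) that Pc Bc by (metis inv_equality inv_inv)
      then show False using v(2) subgroup.m_inv_closed[OF B that] by simp
    qed
    have "A 0" unfolding A_def using v(1) Pc by (intro bexI[of _ \<one>]) (auto intro: generate.one)
    moreover have "\<not> A k"
    proof
      assume "A k"
      then obtain b w where b: "b \<in> ?B" "b [^] p = \<one>" "w \<in> carrier G" "v \<otimes> b = w [^] (p ^ k)"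
        unfolding A_def by blast
      then have "v \<otimes> b \<in> P" using T(2) v(1) subgroup.m_closed[OF P(1)] by blast
      then show False using bd b vb by metis
    qed
    ultimately obtain h where h: "A h" "\<not> A (Suc h)" using nat_induct[of A k] by blast
    obtain b c where bc: "b \<in> ?B" "b [^] p = \<one>" "c \<in> carrier G" "v \<otimes> b = c [^] (p ^ h)"
      using h(1) unfolding A_def by blast
    have vbP: "v \<otimes> b \<in> P" using T(2) bc v(1) subgroup.m_closed[OF P(1)] by blast
    have c: "c [^] (p ^ Suc h) = \<one>"
    proof -
      have "c [^] (p ^ Suc h) = (c [^] (p ^ h)) [^] p" using bc(3) by (simp add: nat_pow_pow mult.commute)
      then show ?thesis using P(2) vbP bc(4) by simp
    qed
    \<comment> \<open>If \<open>p^h c = b' + p^(h+1) x\<close>, then \<open>p b'\<close> is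
      divisible by \<open>p^(h+2)\<close>, and purity provides \<open>b2\<close> in the span with
      \<open>p b' = p^(h+2) b2\<close>. Then \<open>d = b' - p^(h+1) b2\<close> lies in the socle,
      and the representative \<open>v + b - d = p^(h+1) (x + b2)\<close> has greater height, against
      the choice of \<open>h\<close>.\<close>
    have ht: "c [^] (p ^ h) \<noteq> b' \<otimes> x [^] (p ^ Suc h)" if b': "b' \<in> ?B" and x: "x \<in> carrier G" for b' x
    proof
      assume eq: "c [^] (p ^ h) = b' \<otimes> x [^] (p ^ Suc h)"
      have "b' [^] p \<otimes> x [^] (p ^ Suc (Suc h)) = (c [^] (p ^ h)) [^] p"
        unfolding eq using x Bc[OF b'] by (simp add: nat_pow_distrib nat_pow_pow ac_simps)
      also have "\<dots> = \<one>" using P(2) vbP bc(4) by simp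
      finally have "b' [^] p = (inv x) [^] (p ^ Suc (Suc h))"
        using x Bc[OF b'] by (metis inv_equality inv_inv nat_pow_closed nat_pow_inv)
      then obtain b2 where b2: "b2 \<in> ?B" "b2 [^] (p ^ Suc (Suc h)) = b' [^] p"
        using pure_independent_pure[OF PT, of "inv x" "p ^ Suc (Suc h)"] x
          subgroup_nat_pow_closed[OF B b', of p] by (metis inv_closed)
      define d where "d = b' \<otimes> inv (b2 [^] (p ^ Suc h))"
      have dB: "d \<in> ?B" unfolding d_def
        by (intro subgroup.m_closed[OF B] subgroup.m_inv_closed[OF B] subgroup_nat_pow_closed[OF B] b' b2)
      have "d [^] p = b' [^] p \<otimes> inv (b2 [^] (p ^ Suc (Suc h)))"
        using Bc[OF b'] Bc[OF b2(1)]
        by (simp add: d_def nat_pow_distrib nat_pow_inv nat_pow_pow ac_simps)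
      then have dp: "d [^] p = \<one>" using b2(2) Bc[OF b'] by simp
      have inv_d: "inv d = inv b' \<otimes> b2 [^] (p ^ Suc h)"
        using Bc[OF b'] Bc[OF b2(1)] by (simp add: d_def inv_mult)
      have "v \<otimes> (b \<otimes> inv d) = (b' \<otimes> x [^] (p ^ Suc h)) \<otimes> inv d"
        using eq bc(1,4) Bc[OF dB] v(1) Pc Bc by (simp add: m_assoc[symmetric])
      also have "\<dots> = (x \<otimes> b2) [^] (p ^ Suc h)"
        unfolding inv_d using mult_inv_cancel[of "inv b'" "x [^] (p ^ Suc h)" "b2 [^] (p ^ Suc h)"]
          Bc[OF b'] Bc[OF b2(1)] x by (simp add: nat_pow_distrib)
      finally have "v \<otimes> (b \<otimes> inv d) = (x \<otimes> b2) [^] (p ^ Suc h)" .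
      moreover have "b \<otimes> inv d \<in> ?B"
        by (intro subgroup.m_closed[OF B] subgroup.m_inv_closed[OF B] bc dB)
      moreover have "(b \<otimes> inv d) [^] p = \<one>"
        using bc(1,2) dp Bc dB by (simp add: nat_pow_distrib nat_pow_inv)
      moreover have "x \<otimes> b2 \<in> carrier G" using x Bc[OF b2(1)] by simp
      ultimately show False using h(2) unfolding A_def by blast
    qed
    have PI: "pure_independent p G (insert c T)"
      by (rule pure_independent_insert[OF PT bc(3) c ht])
    obtain \<tau> where \<tau>: "\<tau> \<in> hom G G" "\<tau> c = c" "\<And>r. r \<in> ?B \<Longrightarrow> \<tau> r = \<one>"
      using cyclic_summand_hom[OF bc(3) c B ht is_group bc(3) c] by metis
    interpret \<tau>: group_hom G G \<tau> using \<tau>(1) by unfold_locales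
    \<comment> \<open>\<open>\<tau>\<close> isolates the \<open>c\<close>-part of a socle element.
      Being killed by \<open>p\<close>, it is a multiple of \<open>p^h c = v + b\<close>, which lies
      in \<open>P\<close>; the remainder is in the socle of the old span.\<close>
    have "x \<in> P" if x: "x \<in> generate G (insert c T)" and xp: "x [^] p = \<one>" for x
    proof -
      obtain b' j where b': "b' \<in> ?B" "x = b' \<otimes> c [^] (j::int)"
        using generate_insert[OF bc(3) Tc x] .
      have xc: "x \<in> carrier G" using b' Bc bc(3) by simp
      have "\<tau> x = c [^] j" using b' Bc bc(3) \<tau>(2) \<tau>(3)[OF b'(1)] by (simp add: \<tau>.hom_int_pow)
      then have "(c [^] j) [^] p = \<one>" using \<tau>.hom_nat_pow[OF xc, of p] xp by simp
      then have "c [^] (j * int p) = \<one>"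
        using bc(3) int_pow_int[of G "c [^] j" p] by (simp add: int_pow_pow)
      moreover have "c [^] (p ^ h) \<noteq> \<one>" using vb[OF bc(1)] bc(4) by simp
      ultimately have "int p ^ Suc h dvd j * int p" using int_pow_eq_one_iff[OF bc(3) _ c] by blast
      then have "int p ^ h dvd j" using prime by (simp add: prime_gt_0_nat)
      then obtain i where i: "j = int (p ^ h) * i" by auto
      have "c [^] j = (v \<otimes> b) [^] i"
        using bc(3,4) int_pow_pow[OF bc(3), of "int (p ^ h)" i] int_pow_int[of G c "p ^ h"] by (simp add: i)
      then have cj: "c [^] j \<in> P" using subgroup_int_pow_closed[OF P(1) vbP] by simp
      have "b' = x \<otimes> inv (c [^] j)" using b' Bc bc(3) by (simp add: m_assoc)
      then have "b' [^] p = \<one>" using xp xc P(2) cj Pc[OF cj] by (simp add: nat_pow_distrib nat_pow_inv)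
      then have "b' \<in> P" using T(2) b'(1) by blast
      then show ?thesis using subgroup.m_closed[OF P(1) _ cj] b'(2) by simp
    qed
    then have "c \<in> T" using T(3) PI by blast
    then have "c [^] (p ^ h) \<in> ?B" by (intro subgroup_nat_pow_closed[OF B] generate.incl)
    then have "v \<otimes> b \<otimes> inv b \<in> ?B"
      using bc(1,4) subgroup.m_closed[OF B] subgroup.m_inv_closed[OF B] by metis
    then show False using v Pc Bc[OF bc(1)] by (simp add: m_assoc)
  qed
  then show thesis using that T by blast
qed

text \<open>Sets are extended step by step so that the socle of the \<open>n\<close>-th span is
  exactly \<open>P n\<close>; their union is pure independent and its span contains the whole
  socle.\<close>

lemma kulikov_generators:
  assumes P: "\<forall>n. subgroup (P n) G \<and> P n \<subseteq> P (Suc n) \<and>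
      (\<exists>k. \<forall>x\<in>carrier G. x [^] (p ^ k) \<in> P n \<longrightarrow> x [^] (p ^ k) = \<one>)"
    and UP: "(\<Union>n. P n) = {x \<in> carrier G. x [^] p = \<one>}"
  obtains S where "pure_independent p G S" "generate G S = carrier G"
proof -
  have Psoc: "\<forall>x\<in>P n. x [^] p = \<one>" for n using UP by blast
  let ?R = "\<lambda>n T. pure_independent p G T \<and> (\<forall>x\<in>generate G T. x [^] p = \<one> \<longrightarrow> x \<in> P n) \<and>
      P n \<subseteq> generate G T"
  have ext: "\<exists>T. ?R n T \<and> S \<subseteq> T"
    if S: "pure_independent p G S" "\<forall>x\<in>generate G S. x [^] p = \<one> \<longrightarrow> x \<in> P n" for S n
  proof -
    obtain k where k: "\<forall>x\<in>carrier G. x [^] (p ^ k) \<in> P n \<longrightarrow> x [^] (p ^ k) = \<one>" using P by blast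
    have "subgroup (P n) G" using P by blast
    from pure_independent_extend_socle[OF S this Psoc k] show ?thesis by metis
  qed
  have "\<exists>T. \<forall>n. ?R n (T n) \<and> T n \<subseteq> T (Suc n)"
  proof (rule dependent_nat_choice)
    have "pure_independent p G {}" by (simp add: pure_independent_def)
    moreover have "\<forall>x\<in>generate G {}. x [^] p = \<one> \<longrightarrow> x \<in> P 0"
      using P subgroup.one_closed[of "P 0" G] by (auto simp: generate_empty)
    ultimately show "\<exists>T. ?R 0 T" using ext by blast
    show "\<exists>T'. ?R (Suc n) T' \<and> T \<subseteq> T'" if "?R n T" for T n
      by (rule ext) (use that P in blast)+
  qed
  then obtain T where T: "\<And>n. ?R n (T n)" "\<And>n. T n \<subseteq> T (Suc n)" by blast
  have mono: "T m \<subseteq> T n" if "m \<le> n" for m n using that lift_Suc_mono_le[of T] T(2) by blast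
  let ?S = "\<Union>n. T n"
  have S: "pure_independent p G ?S"
  proof (rule pure_independent_finite[THEN iffD2], intro allI impI)
    fix F assume F: "finite F" "F \<subseteq> ?S"
    then have "\<exists>n. F \<subseteq> T n"
    proof (induction F)
      case (insert x F)
      then obtain m n where "F \<subseteq> T m" "x \<in> T n" by blast
      then have "insert x F \<subseteq> T (max m n)" using mono[of m "max m n"] mono[of n "max m n"] by auto
      then show ?case by blast
    qed simp
    then show "pure_independent p G F" using T(1) pure_independent_subset by blast
  qed
  have Sc: "?S \<subseteq> carrier G" using S by (rule pure_independent_carrier)
  have B: "subgroup (generate G ?S) G" by (rule generate_is_subgroup[OF Sc])
  have socle: "x \<in> generate G ?S" if x: "x \<in> carrier G" "x [^] p = \<one>" for x
  proof -
    obtain n where "x \<in> P n" using UP x by blast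
    then have "x \<in> generate G (T n)" using T(1) by blast
    then show ?thesis by (rule generate_mono) blast
  qed
  \<comment> \<open>A pure subgroup containing the socle is everything: \<open>p^j x\<close> is in
    the socle, purity replaces it by \<open>p^j b\<close>, and \<open>x - b\<close> has smaller
    exponent.\<close>
  have "x \<in> generate G ?S" if "x \<in> carrier G" "x [^] (p ^ j) = \<one>" for x j
    using that
  proof (induction j arbitrary: x)
    case 0
    then show ?case by (simp add: generate.one)
  next
    case (Suc j)
    have "(x [^] (p ^ j)) [^] p = \<one>" using Suc.prems by (simp add: nat_pow_pow mult.commute)
    then have "x [^] (p ^ j) \<in> generate G ?S" using socle Suc.prems(1) by simp
    then obtain b where b: "b \<in> generate G ?S" "b [^] (p ^ j) = x [^] (p ^ j)"
      using pure_independent_pure[OF S Suc.prems(1)] by metis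
    have bc: "b \<in> carrier G" using subgroup.mem_carrier[OF B b(1)] .
    have "(x \<otimes> inv b) [^] (p ^ j) = \<one>"
      using Suc.prems(1) b(2) bc by (simp add: nat_pow_distrib nat_pow_inv)
    then have "x \<otimes> inv b \<in> generate G ?S" using Suc.IH Suc.prems(1) bc by simp
    then have "x \<otimes> inv b \<otimes> b \<in> generate G ?S" using subgroup.m_closed[OF B _ b(1)] by blast
    then show ?case using Suc.prems(1) bc by (simp add: m_assoc)
  qed
  then have "carrier G \<subseteq> generate G ?S" using torsion by blast
  then show thesis using that S subgroup.subset[OF B] by blast
qed

text \<open>Direct sums of cyclic groups are projective relative to maps along which torsion
  elements lift without increasing their order: each generator then lifts to an admissible target
  for its cyclic summand, and the coordinate lifts add up.\<close>

lemma pure_independent_lift: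
  assumes S: "pure_independent p G S" "generate G S = carrier G"
    and K: "comm_group K" and \<pi>: "group_hom K M \<pi>" and q: "group_hom G M q"
    and lift: "\<And>x n. x \<in> carrier G \<Longrightarrow> x [^] (p ^ n) = \<one> \<Longrightarrow>
      \<exists>y\<in>carrier K. y [^]\<^bsub>K\<^esub> (p ^ n) = \<one>\<^bsub>K\<^esub> \<and> \<pi> y = q x"
  obtains \<theta> where "\<theta> \<in> hom G K" "\<forall>x\<in>carrier G. \<pi> (\<theta> x) = q x"
proof -
  interpret K: comm_group K by fact
  interpret \<pi>: group_hom K M \<pi> by fact
  interpret q: group_hom G M q by fact
  have Sc: "S \<subseteq> carrier G" using S(1) by (rule pure_independent_carrier)
  have "\<forall>s\<in>S. \<exists>\<theta>. \<theta> \<in> hom G K \<and> \<pi> (\<theta> s) = q s \<and> (\<forall>r\<in>generate G (S - {s}). \<theta> r = \<one>\<^bsub>K\<^esub>)"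
  proof
    fix s assume s: "s \<in> S"
    then have sc: "s \<in> carrier G" "s \<noteq> \<one>" using S(1) by (auto simp: pure_independent_def)
    obtain m where m: "s [^] (p ^ m) \<noteq> \<one>" "s [^] (p ^ Suc m) = \<one>" using ex_order[OF sc] .
    obtain y where y: "y \<in> carrier K" "y [^]\<^bsub>K\<^esub> (p ^ Suc m) = \<one>\<^bsub>K\<^esub>" "\<pi> y = q s"
      using lift[OF sc(1) m(2)] by blast
    have yn: "y [^]\<^bsub>K\<^esub> (p ^ n) = \<one>\<^bsub>K\<^esub>" if "s [^] (p ^ n) = \<one>" for n
    proof -
      have "\<not> n \<le> m" using pow_prime_power_mono[OF sc(1) that] m(1) by blast
      then have "p ^ n = p ^ Suc m * p ^ (n - Suc m)" by (simp flip: power_add power_Suc)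
      then have "y [^]\<^bsub>K\<^esub> (p ^ n) = (y [^]\<^bsub>K\<^esub> (p ^ Suc m)) [^]\<^bsub>K\<^esub> (p ^ (n - Suc m))"
        using y(1) by (simp only: K.nat_pow_pow)
      then show ?thesis using y(2) by simp
    qed
    from pure_independent_hom[OF S(1) s K.is_group y(1) yn]
    obtain \<theta> where "\<theta> \<in> hom G K" "\<theta> s = y" "\<And>r. r \<in> generate G (S - {s}) \<Longrightarrow> \<theta> r = \<one>\<^bsub>K\<^esub>"
      by metis
    then show "\<exists>\<theta>. \<theta> \<in> hom G K \<and> \<pi> (\<theta> s) = q s \<and> (\<forall>r\<in>generate G (S - {s}). \<theta> r = \<one>\<^bsub>K\<^esub>)"
      using y(3) by blast
  qed
  then obtain \<theta> where \<theta>: "\<And>s. s \<in> S \<Longrightarrow> \<theta> s \<in> hom G K" "\<And>s. s \<in> S \<Longrightarrow> \<pi> (\<theta> s s) = q s"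
    "\<And>s r. s \<in> S \<Longrightarrow> r \<in> generate G (S - {s}) \<Longrightarrow> \<theta> s r = \<one>\<^bsub>K\<^esub>"
    unfolding bchoice_iff by blast
  interpret \<theta>: orthogonal_homs G K S \<theta>
    by unfold_locales (use Sc \<theta>(1) \<theta>(3)[OF _ generate.incl] in auto)
  have hom: "\<theta>.\<Theta> \<in> hom G K" using \<theta>.sum_hom S(2) by simp
  have "\<pi> (\<theta>.\<Theta> x) = q x" if x: "x \<in> carrier G" for x
  proof (rule hom_eq_on_generate[OF _ q Sc])
    have "(\<lambda>x. \<pi> (\<theta>.\<Theta> x)) \<in> hom G M"
      using hom \<pi>.homh by (auto simp: hom_def Pi_iff)
    then show "group_hom G M (\<lambda>x. \<pi> (\<theta>.\<Theta> x))" by unfold_locales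
  qed (use \<theta>.sum_apply \<theta>(2) S(2) x in simp_all)
  then show thesis using that hom by blast
qed

end

section \<open>Lifting multiplication by the prime\<close>

definition extension ::
    "('a, 'b) monoid_scheme \<Rightarrow> ('x, 'y) monoid_scheme \<Rightarrow> ('a \<times> 'a \<Rightarrow> 'x) \<Rightarrow> ('x \<times> 'a) monoid"
  where "extension G X f = \<lparr>carrier = carrier X \<times> carrier G,
    monoid.mult = (\<lambda>(x, a) (y, b). (x \<otimes>\<^bsub>X\<^esub> y \<otimes>\<^bsub>X\<^esub> f (a, b), a \<otimes>\<^bsub>G\<^esub> b)),
    one = (\<one>\<^bsub>X\<^esub>, \<one>\<^bsub>G\<^esub>)\<rparr>"

lemma extension_simps:
  "carrier (extension G X f) = carrier X \<times> carrier G"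
  "(x, a) \<otimes>\<^bsub>extension G X f\<^esub> (y, b) = (x \<otimes>\<^bsub>X\<^esub> y \<otimes>\<^bsub>X\<^esub> f (a, b), a \<otimes>\<^bsub>G\<^esub> b)"
  "\<one>\<^bsub>extension G X f\<^esub> = (\<one>\<^bsub>X\<^esub>, \<one>\<^bsub>G\<^esub>)"
  by (simp_all add: extension_def)

locale factor_set = G: comm_group G + X: comm_group X for G (structure) and X (structure) +
  fixes f
  assumes f: "f \<in> cocycles G X"
begin

abbreviation Y where "Y \<equiv> extension G X f"

lemma f_closed: "a \<in> carrier G \<Longrightarrow> b \<in> carrier G \<Longrightarrow> f (a, b) \<in> carrier X"
  using cocycle_closed[OF f] .

lemma f_one: "a \<in> carrier G \<Longrightarrow> f (a, \<one>\<^bsub>G\<^esub>) = \<one>\<^bsub>X\<^esub>" "a \<in> carrier G \<Longrightarrow> f (\<one>\<^bsub>G\<^esub>, a) = \<one>\<^bsub>X\<^esub>"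
  using f by (auto simp: mem_cocycles)

lemma f_assoc:
  assumes "a \<in> carrier G" "b \<in> carrier G" "c \<in> carrier G"
  shows "f (a, b) \<otimes>\<^bsub>X\<^esub> f (a \<otimes>\<^bsub>G\<^esub> b, c) = f (b, c) \<otimes>\<^bsub>X\<^esub> f (a, b \<otimes>\<^bsub>G\<^esub> c)"
  using f assms unfolding mem_cocycles by blast

lemma f_comm: "a \<in> carrier G \<Longrightarrow> b \<in> carrier G \<Longrightarrow> f (a, b) = f (b, a)"
  using f unfolding mem_cocycles by blast

sublocale Y: comm_group Y
proof (rule comm_groupI)
  fix u v w assume "u \<in> carrier Y" "v \<in> carrier Y" "w \<in> carrier Y"
  then obtain x a y b z c where u: "u = (x, a)" "x \<in> carrier X" "a \<in> carrier G"
    and v: "v = (y, b)" "y \<in> carrier X" "b \<in> carrier G"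
    and w: "w = (z, c)" "z \<in> carrier X" "c \<in> carrier G"
    by (auto simp: extension_simps)
  have "x \<otimes>\<^bsub>X\<^esub> y \<otimes>\<^bsub>X\<^esub> f (a, b) \<otimes>\<^bsub>X\<^esub> z \<otimes>\<^bsub>X\<^esub> f (a \<otimes>\<^bsub>G\<^esub> b, c)
      = x \<otimes>\<^bsub>X\<^esub> y \<otimes>\<^bsub>X\<^esub> z \<otimes>\<^bsub>X\<^esub> (f (a, b) \<otimes>\<^bsub>X\<^esub> f (a \<otimes>\<^bsub>G\<^esub> b, c))"
    using u v w by (simp add: f_closed X.m_ac)
  also have "\<dots> = x \<otimes>\<^bsub>X\<^esub> y \<otimes>\<^bsub>X\<^esub> z \<otimes>\<^bsub>X\<^esub> (f (b, c) \<otimes>\<^bsub>X\<^esub> f (a, b \<otimes>\<^bsub>G\<^esub> c))"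
    using u v w by (simp add: f_assoc)
  also have "\<dots> = x \<otimes>\<^bsub>X\<^esub> (y \<otimes>\<^bsub>X\<^esub> z \<otimes>\<^bsub>X\<^esub> f (b, c)) \<otimes>\<^bsub>X\<^esub> f (a, b \<otimes>\<^bsub>G\<^esub> c)"
    using u v w by (simp add: f_closed X.m_ac)
  finally show "u \<otimes>\<^bsub>Y\<^esub> v \<otimes>\<^bsub>Y\<^esub> w = u \<otimes>\<^bsub>Y\<^esub> (v \<otimes>\<^bsub>Y\<^esub> w)"
    using u v w by (simp add: extension_simps f_closed G.m_assoc)
next
  fix u assume "u \<in> carrier Y"
  then obtain x a where u: "u = (x, a)" "x \<in> carrier X" "a \<in> carrier G"
    by (auto simp: extension_simps)
  let ?v = "(inv\<^bsub>X\<^esub> x \<otimes>\<^bsub>X\<^esub> inv\<^bsub>X\<^esub> f (inv\<^bsub>G\<^esub> a, a), inv\<^bsub>G\<^esub> a)"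
  have "inv\<^bsub>X\<^esub> x \<otimes>\<^bsub>X\<^esub> inv\<^bsub>X\<^esub> f (inv\<^bsub>G\<^esub> a, a) \<otimes>\<^bsub>X\<^esub> x \<otimes>\<^bsub>X\<^esub> f (inv\<^bsub>G\<^esub> a, a) =
      (inv\<^bsub>X\<^esub> x \<otimes>\<^bsub>X\<^esub> x) \<otimes>\<^bsub>X\<^esub> (inv\<^bsub>X\<^esub> f (inv\<^bsub>G\<^esub> a, a) \<otimes>\<^bsub>X\<^esub> f (inv\<^bsub>G\<^esub> a, a))"
    using u by (simp only: X.m_ac f_closed X.inv_closed G.inv_closed X.m_closed)
  then have "?v \<otimes>\<^bsub>Y\<^esub> u = \<one>\<^bsub>Y\<^esub>" using u by (simp add: extension_simps f_closed)
  then show "\<exists>v\<in>carrier Y. v \<otimes>\<^bsub>Y\<^esub> u = \<one>\<^bsub>Y\<^esub>"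
    using u by (intro bexI[of _ ?v]) (auto simp: extension_simps f_closed)
qed (auto simp: extension_simps f_closed f_one f_comm X.m_comm G.m_comm)

lemma snd_hom: "group_hom Y G snd"
  by unfold_locales (auto simp: hom_def extension_simps)

lemma snd_pow: "u \<in> carrier Y \<Longrightarrow> snd (u [^]\<^bsub>Y\<^esub> (n::nat)) = snd u [^]\<^bsub>G\<^esub> n"
  using group_hom.hom_nat_pow[OF snd_hom] by blast

lemma kernel_pow: "x \<in> carrier X \<Longrightarrow> (x, \<one>\<^bsub>G\<^esub>) [^]\<^bsub>Y\<^esub> (n::nat) = (x [^]\<^bsub>X\<^esub> n, \<one>\<^bsub>G\<^esub>)"
  by (induction n) (simp_all add: extension_simps f_one)

text \<open>Changing the section by \<open>g\<close> turns the factor set into an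
  \<open>N\<close>-fold one. Hence \<open>N\<close> times the new representative of \<open>a\<close>
  is \<open>N x\<close> with \<open>x\<close> in the kernel \<open>X\<close>, and subtracting
  \<open>x\<close> gives a lift killed by \<open>N\<close>.\<close>

lemma lift_torsion:
  assumes g: "g \<in> cochains G X" and h: "h \<in> cocycles G X"
    and fgh: "\<And>a b. a \<in> carrier G \<Longrightarrow> b \<in> carrier G \<Longrightarrow>
      f (a, b) = coboundary G X g (a, b) \<otimes>\<^bsub>X\<^esub> h (a, b) [^]\<^bsub>X\<^esub> (N::nat)"
    and a: "a \<in> carrier G" "a [^]\<^bsub>G\<^esub> N = \<one>\<^bsub>G\<^esub>"
  shows "\<exists>y\<in>carrier Y. y [^]\<^bsub>Y\<^esub> N = \<one>\<^bsub>Y\<^esub> \<and> snd y = a"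
proof -
  note gc = cochain_closed[OF g] and hc = cocycle_closed[OF h]
  have g1: "g \<one>\<^bsub>G\<^esub> = \<one>\<^bsub>X\<^esub>" using g by (simp add: cochains_def)
  let ?u = "(inv\<^bsub>X\<^esub> g a, a)"
  have cancel: "inv\<^bsub>X\<^esub> A \<otimes>\<^bsub>X\<^esub> (A \<otimes>\<^bsub>X\<^esub> B) = B" if "A \<in> carrier X" "B \<in> carrier X" for A B
    using that by (simp add: X.m_assoc[symmetric])
  have u: "?u \<in> carrier Y" using a gc by (simp add: extension_simps)
  \<comment> \<open>Each further addition of \<open>?u\<close> contributes one value of
    \<open>f\<close>; its coboundary part only updates the \<open>g\<close>-term, and its other part
    is an \<open>N\<close>-th power.\<close>
  have pows: "\<exists>x\<in>carrier X. ?u [^]\<^bsub>Y\<^esub> k = (x [^]\<^bsub>X\<^esub> N \<otimes>\<^bsub>X\<^esub> inv\<^bsub>X\<^esub> g (a [^]\<^bsub>G\<^esub> k), a [^]\<^bsub>G\<^esub> k)" for k :: nat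
  proof (induction k)
    case 0
    then show ?case by (intro bexI[of _ "\<one>\<^bsub>X\<^esub>"]) (auto simp: extension_simps g1)
  next
    case (Suc k)
    then obtain x where x: "x \<in> carrier X"
      "?u [^]\<^bsub>Y\<^esub> k = (x [^]\<^bsub>X\<^esub> N \<otimes>\<^bsub>X\<^esub> inv\<^bsub>X\<^esub> g (a [^]\<^bsub>G\<^esub> k), a [^]\<^bsub>G\<^esub> k)" by blast
    let ?b = "a [^]\<^bsub>G\<^esub> k"
    have b: "?b \<in> carrier G" using a by simp
    have "?u [^]\<^bsub>Y\<^esub> Suc k = (x [^]\<^bsub>X\<^esub> N \<otimes>\<^bsub>X\<^esub> inv\<^bsub>X\<^esub> g ?b \<otimes>\<^bsub>X\<^esub> inv\<^bsub>X\<^esub> g a \<otimes>\<^bsub>X\<^esub> f (?b, a), ?b \<otimes>\<^bsub>G\<^esub> a)"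
      using x(2) by (simp add: extension_simps)
    also have "x [^]\<^bsub>X\<^esub> N \<otimes>\<^bsub>X\<^esub> inv\<^bsub>X\<^esub> g ?b \<otimes>\<^bsub>X\<^esub> inv\<^bsub>X\<^esub> g a \<otimes>\<^bsub>X\<^esub> f (?b, a)
        = (x \<otimes>\<^bsub>X\<^esub> h (?b, a)) [^]\<^bsub>X\<^esub> N \<otimes>\<^bsub>X\<^esub> inv\<^bsub>X\<^esub> g (?b \<otimes>\<^bsub>G\<^esub> a)"
    proof -
      have "f (?b, a) = (g ?b \<otimes>\<^bsub>X\<^esub> g a) \<otimes>\<^bsub>X\<^esub> (inv\<^bsub>X\<^esub> g (?b \<otimes>\<^bsub>G\<^esub> a) \<otimes>\<^bsub>X\<^esub> h (?b, a) [^]\<^bsub>X\<^esub> N)"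
        using fgh[OF b a(1)] a(1) b gc hc by (simp add: coboundary_apply X.m_assoc)
      then have "inv\<^bsub>X\<^esub> (g ?b \<otimes>\<^bsub>X\<^esub> g a) \<otimes>\<^bsub>X\<^esub> f (?b, a) = inv\<^bsub>X\<^esub> g (?b \<otimes>\<^bsub>G\<^esub> a) \<otimes>\<^bsub>X\<^esub> h (?b, a) [^]\<^bsub>X\<^esub> N"
        using cancel a(1) b gc hc by simp
      then have "x [^]\<^bsub>X\<^esub> N \<otimes>\<^bsub>X\<^esub> (inv\<^bsub>X\<^esub> (g ?b \<otimes>\<^bsub>X\<^esub> g a) \<otimes>\<^bsub>X\<^esub> f (?b, a))
        = (x [^]\<^bsub>X\<^esub> N \<otimes>\<^bsub>X\<^esub> h (?b, a) [^]\<^bsub>X\<^esub> N) \<otimes>\<^bsub>X\<^esub> inv\<^bsub>X\<^esub> g (?b \<otimes>\<^bsub>G\<^esub> a)"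
        using a(1) b gc hc x(1) by (simp add: X.m_ac)
      then show ?thesis
        using a(1) b gc hc x(1) by (simp add: X.inv_mult X.m_assoc X.nat_pow_distrib f_closed)
    qed
    finally show ?case using x(1) hc[OF b a(1)] by (intro bexI[of _ "x \<otimes>\<^bsub>X\<^esub> h (?b, a)"]) auto
  qed
  obtain x where x: "x \<in> carrier X" "?u [^]\<^bsub>Y\<^esub> N = (x [^]\<^bsub>X\<^esub> N, \<one>\<^bsub>G\<^esub>)"
    using pows[of N] by (auto simp: a(2) g1)
  let ?y = "?u \<otimes>\<^bsub>Y\<^esub> (inv\<^bsub>X\<^esub> x, \<one>\<^bsub>G\<^esub>)"
  have i: "(inv\<^bsub>X\<^esub> x, \<one>\<^bsub>G\<^esub>) \<in> carrier Y" using x by (simp add: extension_simps)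
  have "?y [^]\<^bsub>Y\<^esub> N = (x [^]\<^bsub>X\<^esub> N, \<one>\<^bsub>G\<^esub>) \<otimes>\<^bsub>Y\<^esub> (inv\<^bsub>X\<^esub> x [^]\<^bsub>X\<^esub> N, \<one>\<^bsub>G\<^esub>)"
    using Y.nat_pow_distrib[OF u i] x by (simp add: kernel_pow)
  also have "\<dots> = \<one>\<^bsub>Y\<^esub>" using x by (simp add: extension_simps f_one X.nat_pow_inv)
  finally have "?y [^]\<^bsub>Y\<^esub> N = \<one>\<^bsub>Y\<^esub>" .
  moreover have "?y \<in> carrier Y" using u i by simp
  moreover have "snd ?y = a" using a by (simp add: extension_simps)
  ultimately show ?thesis by blast
qed

text \<open>Both the \<open>p\<close>-fold of the standard representative of \<open>a\<close> and
  \<open>\<theta> a\<close> lie over \<open>p a\<close>. Their difference in \<open>X\<close> is the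
  cochain that trivializes \<open>p f\<close>.\<close>

lemma pow_coboundary:
  assumes \<theta>: "\<theta> \<in> hom G Y" and snd: "\<And>a. a \<in> carrier G \<Longrightarrow> snd (\<theta> a) = a [^]\<^bsub>G\<^esub> (p::nat)"
  shows "\<exists>k\<in>cochains G X. \<forall>a\<in>carrier G. \<forall>b\<in>carrier G. f (a, b) [^]\<^bsub>X\<^esub> p = coboundary G X k (a, b)"
proof -
  interpret \<theta>: group_hom G Y \<theta> using \<theta> by unfold_locales
  define m where "m a = fst ((\<one>\<^bsub>X\<^esub>, a) [^]\<^bsub>Y\<^esub> p)" for a
  define t where "t a = fst (\<theta> a)" for a
  have u: "(\<one>\<^bsub>X\<^esub>, a) \<in> carrier Y" if "a \<in> carrier G" for a using that by (simp add: extension_simps)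
  have m: "(\<one>\<^bsub>X\<^esub>, a) [^]\<^bsub>Y\<^esub> p = (m a, a [^]\<^bsub>G\<^esub> p)" "m a \<in> carrier X" if "a \<in> carrier G" for a
    using snd_pow[OF u[OF that], of p] Y.nat_pow_closed[OF u[OF that], of p]
    by (auto simp: m_def extension_simps prod_eq_iff)
  have t: "\<theta> a = (t a, a [^]\<^bsub>G\<^esub> p)" "t a \<in> carrier X" if "a \<in> carrier G" for a
    using snd[OF that] \<theta>.hom_closed[OF that] by (auto simp: t_def extension_simps prod_eq_iff)
  have eq: "f (a, b) [^]\<^bsub>X\<^esub> p \<otimes>\<^bsub>X\<^esub> (m (a \<otimes>\<^bsub>G\<^esub> b) \<otimes>\<^bsub>X\<^esub> inv\<^bsub>X\<^esub> t (a \<otimes>\<^bsub>G\<^esub> b))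
      = (m a \<otimes>\<^bsub>X\<^esub> inv\<^bsub>X\<^esub> t a) \<otimes>\<^bsub>X\<^esub> (m b \<otimes>\<^bsub>X\<^esub> inv\<^bsub>X\<^esub> t b)" if ab: "a \<in> carrier G" "b \<in> carrier G" for a b
  proof -
    let ?c = "f (a [^]\<^bsub>G\<^esub> p, b [^]\<^bsub>G\<^esub> p)"
    have c: "?c \<in> carrier X" using ab by (simp add: f_closed)
    have "(\<one>\<^bsub>X\<^esub>, a) \<otimes>\<^bsub>Y\<^esub> (\<one>\<^bsub>X\<^esub>, b) = (f (a, b), \<one>\<^bsub>G\<^esub>) \<otimes>\<^bsub>Y\<^esub> (\<one>\<^bsub>X\<^esub>, a \<otimes>\<^bsub>G\<^esub> b)"
      using ab by (simp add: extension_simps f_closed f_one)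
    moreover have "(f (a, b), \<one>\<^bsub>G\<^esub>) \<in> carrier Y" using ab by (simp add: extension_simps f_closed)
    ultimately have "(\<one>\<^bsub>X\<^esub>, a) [^]\<^bsub>Y\<^esub> p \<otimes>\<^bsub>Y\<^esub> (\<one>\<^bsub>X\<^esub>, b) [^]\<^bsub>Y\<^esub> p
        = (f (a, b), \<one>\<^bsub>G\<^esub>) [^]\<^bsub>Y\<^esub> p \<otimes>\<^bsub>Y\<^esub> (\<one>\<^bsub>X\<^esub>, a \<otimes>\<^bsub>G\<^esub> b) [^]\<^bsub>Y\<^esub> p"
      using ab u by (metis G.m_closed Y.nat_pow_distrib)
    then have 1: "m a \<otimes>\<^bsub>X\<^esub> m b \<otimes>\<^bsub>X\<^esub> ?c = f (a, b) [^]\<^bsub>X\<^esub> p \<otimes>\<^bsub>X\<^esub> m (a \<otimes>\<^bsub>G\<^esub> b)"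
      using ab m by (simp add: kernel_pow f_closed extension_simps f_one)
    have 2: "t (a \<otimes>\<^bsub>G\<^esub> b) = t a \<otimes>\<^bsub>X\<^esub> t b \<otimes>\<^bsub>X\<^esub> ?c"
      using \<theta>.hom_mult[OF ab] ab t by (simp add: extension_simps)
    have "f (a, b) [^]\<^bsub>X\<^esub> p \<otimes>\<^bsub>X\<^esub> (m (a \<otimes>\<^bsub>G\<^esub> b) \<otimes>\<^bsub>X\<^esub> inv\<^bsub>X\<^esub> t (a \<otimes>\<^bsub>G\<^esub> b))
        = (m a \<otimes>\<^bsub>X\<^esub> m b \<otimes>\<^bsub>X\<^esub> ?c) \<otimes>\<^bsub>X\<^esub> inv\<^bsub>X\<^esub> (t a \<otimes>\<^bsub>X\<^esub> t b \<otimes>\<^bsub>X\<^esub> ?c)"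
      using 1 2 ab m t by (simp add: f_closed X.m_assoc)
    also have "\<dots> = (inv\<^bsub>X\<^esub> ?c \<otimes>\<^bsub>X\<^esub> (inv\<^bsub>X\<^esub> t a \<otimes>\<^bsub>X\<^esub> inv\<^bsub>X\<^esub> t b)) \<otimes>\<^bsub>X\<^esub> (?c \<otimes>\<^bsub>X\<^esub> (m a \<otimes>\<^bsub>X\<^esub> m b))"
      using ab m t c by (simp add: X.inv_mult X.m_ac)
    also have "\<dots> = (m a \<otimes>\<^bsub>X\<^esub> inv\<^bsub>X\<^esub> t a) \<otimes>\<^bsub>X\<^esub> (m b \<otimes>\<^bsub>X\<^esub> inv\<^bsub>X\<^esub> t b)"
      using ab m t c by (subst X.mult_inv_cancel) (simp_all add: X.m_ac)
    finally show ?thesis .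
  qed
  define k where "k = (\<lambda>a\<in>carrier G. m a \<otimes>\<^bsub>X\<^esub> inv\<^bsub>X\<^esub> t a)"
  have kc: "k a \<in> carrier X" if "a \<in> carrier G" for a using that m t by (simp add: k_def)
  have "m \<one>\<^bsub>G\<^esub> = \<one>\<^bsub>X\<^esub>" by (simp add: m_def kernel_pow)
  moreover have "t \<one>\<^bsub>G\<^esub> = \<one>\<^bsub>X\<^esub>" by (simp add: t_def extension_simps)
  ultimately have "k \<in> cochains G X" using kc by (auto simp: cochains_def k_def)
  moreover have "f (a, b) [^]\<^bsub>X\<^esub> p = coboundary G X k (a, b)" if "a \<in> carrier G" "b \<in> carrier G" for a b
    using eq[OF that] that kc f_closed
    by (simp add: coboundary_apply k_def X.inv_solve_right)
  ultimately show ?thesis by blast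
qed

end

context primary_comm_group
begin

text \<open>The images of the \<open>Q n\<close> in \<open>G/E\<close> meet Kulikov's criterion;
  \<open>E \<subseteq> Q n\<close> makes membership independent of the representative of a
  coset.\<close>

lemma kulikov_chain_factor:
  assumes ch: "kulikov_chain p G E Q"
  obtains S where "primary_comm_group (G Mod E) p" "pure_independent p (G Mod E) S"
    "generate (G Mod E) S = carrier (G Mod E)"
proof -
  have E: "subgroup E G" and Q: "\<And>n. subgroup (Q n) G" "\<And>n. E \<subseteq> Q n" "\<And>n. Q n \<subseteq> Q (Suc n)"
    and bd: "\<And>n. \<exists>k. \<forall>x\<in>carrier G. x [^] (p ^ k) \<in> Q n \<longrightarrow> x [^] (p ^ k) \<in> E"
    and UQ: "(\<Union>n. Q n) = {x \<in> carrier G. x [^] p \<in> E}"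
    using ch by (simp_all add: kulikov_chain_def)
  interpret E: normal E G by (rule subgroup_imp_normal[OF E])
  let ?H = "G Mod E"
  have pow: "(E #> x) [^]\<^bsub>?H\<^esub> (n::nat) = E #> x [^] n" if "x \<in> carrier G" for x n
    using E.FactGroup_pow[OF that] .
  have one_iff: "E #> x = \<one>\<^bsub>?H\<^esub> \<longleftrightarrow> x \<in> E" if "x \<in> carrier G" for x
    using that coset_join1[of E x] coset_join2[of x E] E by auto
  have H: "comm_group ?H" using abelian_FactGroup[OF E] .
  then interpret H: comm_group ?H .
  have "primary_group p ?H"
    unfolding primary_group_def
  proof
    fix X assume "X \<in> carrier ?H"
    then obtain x where x: "x \<in> carrier G" "X = E #> x" by (auto simp: carrier_FactGroup)
    obtain n where "x [^] (p ^ n) = \<one>" using torsion[OF x(1)] .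
    then have "X [^]\<^bsub>?H\<^esub> (p ^ n) = \<one>\<^bsub>?H\<^esub>" using x pow one_iff E.one_closed by simp
    then show "\<exists>n. X [^]\<^bsub>?H\<^esub> (p ^ n) = \<one>\<^bsub>?H\<^esub>" by blast
  qed
  then have prim: "primary_comm_group ?H p"
    using H prime by (simp add: primary_comm_group_def primary_comm_group_axioms_def)
  then interpret H: primary_comm_group ?H p .
  define P where "P n = (\<lambda>x. E #> x) ` Q n" for n
  have hom: "group_hom G ?H (\<lambda>x. E #> x)" using E.r_coset_hom_Mod by unfold_locales
  have QP: "x \<in> Q n" if x: "x \<in> carrier G" "E #> x \<in> P n" for x n
  proof -
    obtain y where y: "y \<in> Q n" "E #> x = E #> y" using x(2) by (auto simp: P_def)
    then have "x \<in> E #> y" using rcos_self[OF x(1) E] by simp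
    then obtain e where "e \<in> E" "x = e \<otimes> y" by (auto simp: r_coset_def)
    then show ?thesis using y(1) Q(2)[of n] subgroup.m_closed[OF Q(1)] by blast
  qed
  have cond: "subgroup (P n) ?H \<and> P n \<subseteq> P (Suc n) \<and>
      (\<exists>k. \<forall>X\<in>carrier ?H. X [^]\<^bsub>?H\<^esub> (p ^ k) \<in> P n \<longrightarrow> X [^]\<^bsub>?H\<^esub> (p ^ k) = \<one>\<^bsub>?H\<^esub>)" for n
  proof (intro conjI)
    show "subgroup (P n) ?H"
      unfolding P_def by (rule group_hom.subgroup_img_is_subgroup[OF hom Q(1)])
    show "P n \<subseteq> P (Suc n)" using Q(3) by (auto simp: P_def)
    obtain k where k: "\<forall>x\<in>carrier G. x [^] (p ^ k) \<in> Q n \<longrightarrow> x [^] (p ^ k) \<in> E" using bd by blast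
    have "X [^]\<^bsub>?H\<^esub> (p ^ k) = \<one>\<^bsub>?H\<^esub>" if X: "X \<in> carrier ?H" "X [^]\<^bsub>?H\<^esub> (p ^ k) \<in> P n" for X
    proof -
      obtain x where x: "x \<in> carrier G" "X = E #> x" using X(1) by (auto simp: carrier_FactGroup)
      then have "x [^] (p ^ k) \<in> Q n" using X(2) QP[of "x [^] (p ^ k)"] pow by simp
      then show ?thesis using k x pow one_iff by simp
    qed
    then show "\<exists>k. \<forall>X\<in>carrier ?H. X [^]\<^bsub>?H\<^esub> (p ^ k) \<in> P n \<longrightarrow> X [^]\<^bsub>?H\<^esub> (p ^ k) = \<one>\<^bsub>?H\<^esub>"
      by blast
  qed
  have "(\<Union>n. P n) = {X \<in> carrier ?H. X [^]\<^bsub>?H\<^esub> p = \<one>\<^bsub>?H\<^esub>}"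
  proof -
    have "(\<Union>n. P n) = (\<lambda>x. E #> x) ` {x \<in> carrier G. x [^] p \<in> E}"
      unfolding UQ[symmetric] P_def by blast
    also have "\<dots> = {X \<in> carrier ?H. X [^]\<^bsub>?H\<^esub> p = \<one>\<^bsub>?H\<^esub>}"
    proof -
      have "(E #> x) [^]\<^bsub>?H\<^esub> p = \<one>\<^bsub>?H\<^esub> \<longleftrightarrow> x [^] p \<in> E" if "x \<in> carrier G" for x
        unfolding pow[OF that] using that by (intro one_iff) simp
      then show ?thesis unfolding carrier_FactGroup by blast
    qed
    finally show ?thesis .
  qed
  then obtain S where "pure_independent p ?H S" "generate ?H S = carrier ?H"
    using H.kulikov_generators[of P] cond by blast
  then show thesis using that prim by blast
qed

lemma kulikov_chain_imp_projective:
  assumes ch: "kulikov_chain p G E Q"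
  shows "p_omega_plus_1_projective p G"
  unfolding p_omega_plus_1_projective_def
proof (intro allI impI)
  fix X :: "('a \<times> int) list monoid"
  assume X: "comm_group X"
  show "p_omega_plus_1 p (Ext G X) = {\<one>\<^bsub>Ext G X\<^esub>}"
    unfolding p_omega_plus_1_Ext_iff[OF comm_group_axioms X]
  proof (intro allI impI)
    fix f h g
    assume f: "f \<in> cocycles G X"
      and hg: "\<forall>n::nat. h n \<in> cocycles G X \<and> g n \<in> cochains G X \<and>
        (\<forall>a\<in>carrier G. \<forall>b\<in>carrier G.
          f (a, b) = coboundary G X (g n) (a, b) \<otimes>\<^bsub>X\<^esub> h n (a, b) [^]\<^bsub>X\<^esub> (p ^ n))"
    interpret factor_set G X f
      using f X comm_group_axioms by (simp add: factor_set_def factor_set_axioms_def)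
    have E: "subgroup E G" and Ep: "\<And>e. e \<in> E \<Longrightarrow> e [^] p = \<one>"
      using ch by (simp_all add: kulikov_chain_def)
    interpret E: normal E G by (rule subgroup_imp_normal[OF E])
    obtain S where prim: "primary_comm_group (G Mod E) p" and S: "pure_independent p (G Mod E) S"
      "generate (G Mod E) S = carrier (G Mod E)"
      using kulikov_chain_factor[OF ch] .
    interpret H: primary_comm_group "G Mod E" p by (rule prim)
    \<comment> \<open>Since \<open>p E = 0\<close>, multiplication by \<open>p\<close> factors
      through \<open>G/E\<close> as \<open>q\<close>.\<close>
    have "x [^] p = y [^] p" if xy: "x \<in> carrier G" "y \<in> carrier G" "E #> x = E #> y" for x y
    proof -
      have "x \<in> E #> y" using rcos_self[OF xy(1) E] xy(3) by simp
      then obtain e where "e \<in> E" "x = e \<otimes> y" by (auto simp: r_coset_def)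
      then show ?thesis using Ep xy(2) by (simp add: nat_pow_distrib)
    qed
    then obtain q where q: "q \<in> hom (G Mod E) G" "\<And>x. x \<in> carrier G \<Longrightarrow> q (E #> x) = x [^] p"
      using FactGroup_universal[OF group_hom.homh[OF nat_pow_group_hom[of p]] E.normal_axioms] by metis
    interpret q: group_hom "G Mod E" G q using q(1) by unfold_locales
    obtain \<theta> where \<theta>: "\<theta> \<in> hom (G Mod E) Y" "\<forall>Z\<in>carrier (G Mod E). snd (\<theta> Z) = q Z"
    proof (rule H.pure_independent_lift[OF S Y.comm_group_axioms snd_hom q.group_hom_axioms])
      fix Z n assume Z: "Z \<in> carrier (G Mod E)" "Z [^]\<^bsub>G Mod E\<^esub> (p ^ n) = \<one>\<^bsub>G Mod E\<^esub>"
      \<comment> \<open>This is where divisibility by every \<open>p^n\<close> in Ext is used: the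
        order of each element to be lifted selects its own \<open>n\<close>.\<close>
      have "q Z [^] (p ^ n) = \<one>" using Z q.hom_nat_pow[OF Z(1), of "p ^ n"] q.hom_one by metis
      then show "\<exists>y\<in>carrier Y. y [^]\<^bsub>Y\<^esub> (p ^ n) = \<one>\<^bsub>Y\<^esub> \<and> snd y = q Z"
        using lift_torsion[of "g n" "h n" "p ^ n" "q Z"] hg Z(1) by simp
    qed
    have hom: "(\<lambda>x. \<theta> (E #> x)) \<in> hom G Y"
      using E.r_coset_hom_Mod \<theta>(1) by (auto simp: hom_def Pi_iff)
    show "\<exists>k\<in>cochains G X. \<forall>a\<in>carrier G. \<forall>b\<in>carrier G. f (a, b) [^]\<^bsub>X\<^esub> p = coboundary G X k (a, b)"
      by (rule pow_coboundary[OF hom]) (use \<theta>(2) q(2) in \<open>auto simp: carrier_FactGroup\<close>)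
  qed
qed

end

section \<open>The test extension\<close>

definition sequence_group :: "('d, 'e) monoid_scheme \<Rightarrow> (nat \<Rightarrow> 'd) monoid"
  where "sequence_group D = \<lparr>carrier = {x. \<forall>i. x i \<in> carrier D},
    monoid.mult = (\<lambda>x y i. x i \<otimes>\<^bsub>D\<^esub> y i), one = (\<lambda>i. \<one>\<^bsub>D\<^esub>)\<rparr>"

lemma sequence_group_simps:
  "x \<in> carrier (sequence_group D) \<longleftrightarrow> (\<forall>i. x i \<in> carrier D)"
  "(x \<otimes>\<^bsub>sequence_group D\<^esub> y) i = x i \<otimes>\<^bsub>D\<^esub> y i"
  "\<one>\<^bsub>sequence_group D\<^esub> i = \<one>\<^bsub>D\<^esub>"
  by (simp_all add: sequence_group_def)

lemma sequence_group_pow: "(x [^]\<^bsub>sequence_group D\<^esub> (n::nat)) i = x i [^]\<^bsub>D\<^esub> n"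
  by (induction n) (simp_all add: sequence_group_simps)

lemma (in comm_group) comm_group_sequence: "comm_group (sequence_group G)"
proof (rule comm_groupI)
  show "\<exists>y\<in>carrier (sequence_group G). y \<otimes>\<^bsub>sequence_group G\<^esub> x = \<one>\<^bsub>sequence_group G\<^esub>"
    if "x \<in> carrier (sequence_group G)" for x
    using that by (intro bexI[of _ "\<lambda>i. inv (x i)"]) (auto simp: sequence_group_simps fun_eq_iff)
qed (auto simp: sequence_group_simps fun_eq_iff m_ac)

lemma (in comm_group) sequence_group_inv:
  assumes "x \<in> carrier (sequence_group G)"
  shows "(inv\<^bsub>sequence_group G\<^esub> x) i = inv (x i)"
proof -
  interpret P: comm_group "sequence_group G" by (rule comm_group_sequence)
  have "inv\<^bsub>sequence_group G\<^esub> x = (\<lambda>i. inv (x i))"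
    using assms by (intro P.inv_equality) (auto simp: sequence_group_simps fun_eq_iff)
  then show ?thesis by simp
qed

lemma cocycles_subgroup:
  assumes "f \<in> cocycles G P" "\<And>a b. a \<in> carrier G \<Longrightarrow> b \<in> carrier G \<Longrightarrow> f (a, b) \<in> M"
  shows "f \<in> cocycles G (P\<lparr>carrier := M\<rparr>)"
proof -
  have "f \<in> carrier G \<times> carrier G \<rightarrow>\<^sub>E M"
    using assms by (auto simp: mem_cocycles PiE_iff)
  then show ?thesis using assms(1) by (simp add: mem_cocycles)
qed

lemma coboundary_subgroup:
  assumes "comm_group P" "subgroup M P" "comm_group G" "\<And>a. a \<in> carrier G \<Longrightarrow> g a \<in> M"
    and "a \<in> carrier G" "b \<in> carrier G"
  shows "coboundary G (P\<lparr>carrier := M\<rparr>) g (a, b) = coboundary G P g (a, b)"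
proof -
  interpret P: comm_group P by fact
  interpret G: comm_group G by fact
  show ?thesis using assms by (simp add: coboundary_apply)
qed

lemma (in comm_group) coboundary_telescope:
  assumes "x \<in> carrier G" "y \<in> carrier G" "z \<in> carrier G" "u \<in> carrier G" "v \<in> carrier G" "w \<in> carrier G"
  shows "x \<otimes> y \<otimes> inv z = ((x \<otimes> inv u) \<otimes> (y \<otimes> inv v) \<otimes> inv (z \<otimes> inv w)) \<otimes> (u \<otimes> v \<otimes> inv w)"
proof -
  have "((x \<otimes> inv u) \<otimes> (y \<otimes> inv v) \<otimes> inv (z \<otimes> inv w)) \<otimes> (u \<otimes> v \<otimes> inv w)
      = (x \<otimes> y \<otimes> inv z) \<otimes> ((inv u \<otimes> u) \<otimes> (inv v \<otimes> v) \<otimes> (inv w \<otimes> w))"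
    using assms by (simp only: inv_mult inv_inv m_ac m_closed inv_closed)
  then show ?thesis using assms by simp
qed

lemma (in comm_group) quotient_swap:
  assumes "x \<otimes> inv z = u \<otimes> inv w"
    and "x \<in> carrier G" "z \<in> carrier G" "u \<in> carrier G" "w \<in> carrier G"
  shows "x \<otimes> inv u = z \<otimes> inv w"
proof -
  have "x \<otimes> inv u = (x \<otimes> inv z) \<otimes> (z \<otimes> inv u)"
    using mult_inv_cancel[of z x "inv u"] assms by (simp add: m_comm[of "inv z" x])
  also have "\<dots> = (inv u \<otimes> z) \<otimes> (u \<otimes> inv w)" unfolding assms(1) using assms by (simp add: m_ac)
  also have "\<dots> = z \<otimes> inv w" using assms by (intro mult_inv_cancel) simp_all
  finally show ?thesis .
qed

text \<open>The test extension. Let \<open>X\<close> be the direct sum of the groups \<open>D[p\<^sup>i]\<close>. Then \<open>\<phi>\<close>, the coboundary of a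
  cochain \<open>\<epsilon>\<close> with values in the direct sum of copies of \<open>D\<close>, is a factor set with values in \<open>X\<close>.\<close>

locale height_omega_embedding = primary_comm_group G p + D: comm_group D
  for G (structure) and p and D (structure) +
  fixes j
  assumes j: "j \<in> hom G D" and inj: "inj_on j (carrier G)"
    and roots: "a \<in> carrier G \<Longrightarrow> \<exists>d\<in>carrier D. d [^]\<^bsub>D\<^esub> (p ^ n) = j a"
begin

sublocale j: group_hom G D j using j by unfold_locales

abbreviation P where "P \<equiv> sequence_group D"

sublocale P: comm_group P by (rule D.comm_group_sequence)

definition M where
  "M = {x. (\<forall>i. x i \<in> carrier D \<and> x i [^]\<^bsub>D\<^esub> (p ^ i) = \<one>\<^bsub>D\<^esub>) \<and> (\<exists>n. \<forall>i\<ge>n. x i = \<one>\<^bsub>D\<^esub>)}"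

abbreviation X where "X \<equiv> P\<lparr>carrier := M\<rparr>"

lemma M: "subgroup M P"
proof (rule P.subgroupI)
  show "M \<subseteq> carrier P" by (auto simp: M_def sequence_group_simps)
  have "(\<lambda>i. \<one>\<^bsub>D\<^esub>) \<in> M" by (simp add: M_def)
  then show "M \<noteq> {}" by blast
  fix x assume x: "x \<in> M"
  then have "x \<in> carrier P" by (simp add: M_def sequence_group_simps)
  then show "inv\<^bsub>P\<^esub> x \<in> M"
    using x by (auto simp: M_def D.sequence_group_inv D.nat_pow_inv)
  fix y assume y: "y \<in> M"
  obtain m n where "\<forall>i\<ge>m. x i = \<one>\<^bsub>D\<^esub>" "\<forall>i\<ge>n. y i = \<one>\<^bsub>D\<^esub>" using x y by (auto simp: M_def)
  then have "\<exists>n. \<forall>i\<ge>n. x i \<otimes>\<^bsub>D\<^esub> y i = \<one>\<^bsub>D\<^esub>" by (intro exI[of _ "max m n"]) simp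
  then show "x \<otimes>\<^bsub>P\<^esub> y \<in> M"
    using x y by (simp add: M_def sequence_group_simps D.nat_pow_distrib)
qed

lemma X: "comm_group X"
proof (rule group.group_comm_groupI[OF P.subgroup_imp_group[OF M]])
  fix x y assume "x \<in> carrier X" "y \<in> carrier X"
  then show "x \<otimes>\<^bsub>X\<^esub> y = y \<otimes>\<^bsub>X\<^esub> x"
    using P.m_comm subgroup.mem_carrier[OF M] by simp
qed

lemma coboundary_P:
  assumes "\<And>a. a \<in> carrier G \<Longrightarrow> c a \<in> carrier P" "a \<in> carrier G" "b \<in> carrier G"
  shows "coboundary G P c (a, b) i = c a i \<otimes>\<^bsub>D\<^esub> c b i \<otimes>\<^bsub>D\<^esub> inv\<^bsub>D\<^esub> (c (a \<otimes>\<^bsub>G\<^esub> b) i)"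
  using assms by (simp add: coboundary_apply sequence_group_simps D.sequence_group_inv)

lemma coboundary_X:
  assumes "\<And>a. a \<in> carrier G \<Longrightarrow> c a \<in> M" "a \<in> carrier G" "b \<in> carrier G"
  shows "coboundary G X c (a, b) i = c a i \<otimes>\<^bsub>D\<^esub> c b i \<otimes>\<^bsub>D\<^esub> inv\<^bsub>D\<^esub> (c (a \<otimes>\<^bsub>G\<^esub> b) i)"
proof -
  have "c a \<in> carrier P" if "a \<in> carrier G" for a using subgroup.mem_carrier[OF M assms(1)[OF that]] .
  then show ?thesis
    using coboundary_subgroup[OF P.comm_group_axioms M comm_group_axioms] assms coboundary_P
    by simp
qed

text \<open>The cochain takes values in \<open>D\<close>, not in \<open>p^i\<close>-torsion; but
  \<open>p^i\<close> times its component \<open>i\<close> is a homomorphism, whose coboundary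
  vanishes, so the coboundary itself is killed by \<open>p^i\<close>.\<close>

lemma coboundary_cocycle_X:
  assumes c: "\<And>a i. a \<in> carrier G \<Longrightarrow> c a i \<in> carrier D" "\<And>i. c \<one> i = \<one>\<^bsub>D\<^esub>" "c \<in> extensional (carrier G)"
    and supp: "\<And>a. a \<in> carrier G \<Longrightarrow> \<exists>n. \<forall>i\<ge>n. c a i = \<one>\<^bsub>D\<^esub>"
    and t: "\<And>i. \<exists>t\<in>hom G D. \<forall>a\<in>carrier G. c a i [^]\<^bsub>D\<^esub> (p ^ i) = t a"
  shows "coboundary G P c \<in> cocycles G X"
proof (rule cocycles_subgroup)
  have cP: "c a \<in> carrier P" if "a \<in> carrier G" for a using c that by (simp add: sequence_group_simps)
  have "c \<one> = \<one>\<^bsub>P\<^esub>" using c(2) by (simp add: fun_eq_iff sequence_group_simps)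
  then have "c \<in> cochains G P" using cP c(3) by (simp add: cochains_def PiE_iff)
  then show "coboundary G P c \<in> cocycles G P"
    by (rule coboundary_cocycle[OF comm_group_axioms P.comm_group_axioms])
  fix a b assume ab: "a \<in> carrier G" "b \<in> carrier G"
  have "coboundary G P c (a, b) i [^]\<^bsub>D\<^esub> (p ^ i) = \<one>\<^bsub>D\<^esub>" for i
  proof -
    obtain t where t: "t \<in> hom G D" "\<forall>a\<in>carrier G. c a i [^]\<^bsub>D\<^esub> (p ^ i) = t a" using t by blast
    interpret t: group_hom G D t using t(1) by unfold_locales
    have "coboundary G P c (a, b) i [^]\<^bsub>D\<^esub> (p ^ i) = t a \<otimes>\<^bsub>D\<^esub> t b \<otimes>\<^bsub>D\<^esub> inv\<^bsub>D\<^esub> t (a \<otimes> b)"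
      using ab t(2) c(1) by (simp add: coboundary_P[OF cP] D.nat_pow_distrib D.nat_pow_inv)
    then show ?thesis using ab by simp
  qed
  moreover have "\<exists>n. \<forall>i\<ge>n. coboundary G P c (a, b) i = \<one>\<^bsub>D\<^esub>"
  proof -
    obtain k l m where "\<forall>i\<ge>k. c a i = \<one>\<^bsub>D\<^esub>" "\<forall>i\<ge>l. c b i = \<one>\<^bsub>D\<^esub>" "\<forall>i\<ge>m. c (a \<otimes> b) i = \<one>\<^bsub>D\<^esub>"
      using supp[OF ab(1)] supp[OF ab(2)] supp[OF m_closed[OF ab]] by blast
    then show ?thesis
      by (intro exI[of _ "max k (max l m)"]) (simp add: coboundary_P[OF cP] ab)
  qed
  ultimately show "coboundary G P c (a, b) \<in> M"
    using ab c(1) by (simp add: M_def coboundary_P[OF cP])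
qed

lemma j_pow: "a \<in> carrier G \<Longrightarrow> j a [^]\<^bsub>D\<^esub> (n::nat) = j (a [^] n)"
  by (simp add: j.hom_nat_pow)

text \<open>A set-theoretic lift of \<open>p^i a\<close> along multiplication by \<open>p^i\<close>
  in component \<open>i\<close>. The obvious lift \<open>j a\<close> is replaced by zero as soon as
  \<open>p^i a = 0\<close>; this is still a lift and makes the support finite.\<close>

definition \<epsilon> where "\<epsilon> = (\<lambda>a\<in>carrier G. \<lambda>i. if a [^] (p ^ i) = \<one> then \<one>\<^bsub>D\<^esub> else j a)"

definition \<phi> where "\<phi> = coboundary G P \<epsilon>"

lemma \<epsilon>_closed: "a \<in> carrier G \<Longrightarrow> \<epsilon> a i \<in> carrier D"
  by (simp add: \<epsilon>_def)

lemma \<epsilon>_one: "\<epsilon> \<one> i = \<one>\<^bsub>D\<^esub>"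
  by (simp add: \<epsilon>_def)

lemma \<epsilon>_pow: "a \<in> carrier G \<Longrightarrow> \<epsilon> a i [^]\<^bsub>D\<^esub> (p ^ i) = j a [^]\<^bsub>D\<^esub> (p ^ i)"
  by (simp add: \<epsilon>_def j_pow)

lemma \<epsilon>_support:
  assumes "a \<in> carrier G" obtains n where "\<forall>i\<ge>n. \<epsilon> a i = \<one>\<^bsub>D\<^esub>"
proof -
  obtain n where "a [^] (p ^ n) = \<one>" using torsion[OF assms] .
  then have "\<forall>i\<ge>n. \<epsilon> a i = \<one>\<^bsub>D\<^esub>"
    using pow_prime_power_mono[OF assms] assms by (simp add: \<epsilon>_def)
  then show thesis using that by blast
qed

lemma \<phi>_cocycle: "\<phi> \<in> cocycles G X"
  unfolding \<phi>_def
proof (rule coboundary_cocycle_X)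
  show "\<epsilon> \<in> extensional (carrier G)" by (simp add: \<epsilon>_def)
  show "\<exists>n. \<forall>i\<ge>n. \<epsilon> a i = \<one>\<^bsub>D\<^esub>" if "a \<in> carrier G" for a using \<epsilon>_support[OF that] by blast
  show "\<exists>t\<in>hom G D. \<forall>a\<in>carrier G. \<epsilon> a i [^]\<^bsub>D\<^esub> (p ^ i) = t a" for i
  proof (intro bexI ballI)
    show "(\<lambda>a. j a [^]\<^bsub>D\<^esub> (p ^ i)) \<in> hom G D" by (auto simp: hom_def D.nat_pow_distrib)
  qed (rule \<epsilon>_pow)
qed (simp_all add: \<epsilon>_closed \<epsilon>_one)

lemma \<phi>_apply:
  assumes "a \<in> carrier G" "b \<in> carrier G"
  shows "\<phi> (a, b) i = \<epsilon> a i \<otimes>\<^bsub>D\<^esub> \<epsilon> b i \<otimes>\<^bsub>D\<^esub> inv\<^bsub>D\<^esub> (\<epsilon> (a \<otimes> b) i)"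
  unfolding \<phi>_def
proof (rule coboundary_P[OF _ assms])
  show "\<epsilon> a \<in> carrier P" if "a \<in> carrier G" for a
    unfolding sequence_group_simps using \<epsilon>_closed[OF that] by blast
qed

text \<open>Modulo coboundaries, \<open>\<phi>\<close> can be divided by \<open>p\<^sup>n\<close>: a \<open>p\<^sup>n\<close>-th root \<open>r a\<close> of \<open>a\<close> in \<open>D\<close> divides the
  components \<open>i \<ge> n\<close>, and the homomorphism \<open>j\<close> splits the finitely many others.\<close>

lemma \<phi>_omega:
  "\<exists>h\<in>cocycles G X. \<exists>g\<in>cochains G X. \<forall>a\<in>carrier G. \<forall>b\<in>carrier G.
    \<phi> (a, b) = coboundary G X g (a, b) \<otimes>\<^bsub>X\<^esub> h (a, b) [^]\<^bsub>X\<^esub> (p ^ n)"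
proof -
  have "\<forall>a\<in>carrier G. \<exists>d. d \<in> carrier D \<and> d [^]\<^bsub>D\<^esub> (p ^ n) = j a" using roots by blast
  then obtain r where r: "\<And>a. a \<in> carrier G \<Longrightarrow> r a \<in> carrier D"
    "\<And>a. a \<in> carrier G \<Longrightarrow> r a [^]\<^bsub>D\<^esub> (p ^ n) = j a"
    unfolding bchoice_iff by blast
  \<comment> \<open>The analogue of \<open>\<epsilon>\<close> one level down: component
    \<open>i\<close> lifts \<open>p^(i-n) a\<close> along \<open>p^i\<close>, using the root
    \<open>r a\<close> in place of \<open>j a\<close>, and vanishes when
    \<open>p^(i-n) a = 0\<close>.\<close>
  define \<kappa> where "\<kappa> = (\<lambda>a\<in>carrier G. \<lambda>i. if i < n \<or> a [^] (p ^ (i - n)) = \<one> then \<one>\<^bsub>D\<^esub> else r a)"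
  have \<kappa>c: "\<kappa> a i \<in> carrier D" if "a \<in> carrier G" for a i using that r by (simp add: \<kappa>_def)
  have \<kappa>1: "\<kappa> \<one> i = \<one>\<^bsub>D\<^esub>" for i by (simp add: \<kappa>_def)
  have \<kappa>_pow: "\<kappa> a i [^]\<^bsub>D\<^esub> (p ^ i) = j a [^]\<^bsub>D\<^esub> (p ^ (i - n))" if a: "a \<in> carrier G" and i: "n \<le> i" for a i
  proof -
    have "r a [^]\<^bsub>D\<^esub> (p ^ i) = (r a [^]\<^bsub>D\<^esub> (p ^ n)) [^]\<^bsub>D\<^esub> (p ^ (i - n))"
      using r(1)[OF a] i by (simp add: D.nat_pow_pow flip: power_add)
    then show ?thesis using a i r(2) by (auto simp: \<kappa>_def j_pow)
  qed
  have \<kappa>_supp: "\<exists>m. \<forall>i\<ge>m. \<kappa> a i = \<one>\<^bsub>D\<^esub>" if a: "a \<in> carrier G" for a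
  proof -
    obtain m where "a [^] (p ^ m) = \<one>" using torsion[OF a] .
    then have "\<forall>i\<ge>m + n. \<kappa> a i = \<one>\<^bsub>D\<^esub>"
      using pow_prime_power_mono[OF a] a by (simp add: \<kappa>_def)
    then show ?thesis by blast
  qed
  let ?h = "coboundary G P \<kappa>"
  have h: "?h \<in> cocycles G X"
  proof (rule coboundary_cocycle_X[where c = \<kappa>, OF \<kappa>c \<kappa>1 _ \<kappa>_supp])
    show "\<exists>t\<in>hom G D. \<forall>a\<in>carrier G. \<kappa> a i [^]\<^bsub>D\<^esub> (p ^ i) = t a" for i
    proof (cases "n \<le> i")
      case True
      have "(\<lambda>a. j a [^]\<^bsub>D\<^esub> (p ^ (i - n))) \<in> hom G D" by (auto simp: hom_def D.nat_pow_distrib)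
      then show ?thesis by (rule rev_bexI) (simp add: \<kappa>_pow True)
    next
      case False
      have "(\<lambda>a. \<one>\<^bsub>D\<^esub>) \<in> hom G D" by (auto simp: hom_def)
      then show ?thesis by (rule rev_bexI) (use False in \<open>simp add: \<kappa>_def\<close>)
    qed
  qed (auto simp: \<kappa>_def)
  \<comment> \<open>For \<open>i < n\<close> the value \<open>j a\<close> is additive in
    \<open>a\<close> and has trivial coboundary, matching \<open>\<kappa> a i = 0\<close>. In every
    component \<open>p^i\<close> times \<open>l\<close> equals \<open>p^i j a\<close>, just as for
    \<open>\<epsilon>\<close>, so the difference \<open>g\<close> takes values in
    \<open>M\<close>.\<close>
  define l where "l a i = (if i < n then j a else \<kappa> a i [^]\<^bsub>D\<^esub> (p ^ n))" for a i
  have lc: "l a i \<in> carrier D" if "a \<in> carrier G" for a i using that \<kappa>c by (simp add: l_def)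
  define g where "g = (\<lambda>a\<in>carrier G. \<lambda>i. \<epsilon> a i \<otimes>\<^bsub>D\<^esub> inv\<^bsub>D\<^esub> (l a i))"
  have gM: "g a \<in> M" if a: "a \<in> carrier G" for a
  proof -
    have "g a i [^]\<^bsub>D\<^esub> (p ^ i) = \<one>\<^bsub>D\<^esub>" for i
    proof -
      have "l a i [^]\<^bsub>D\<^esub> (p ^ i) = j a [^]\<^bsub>D\<^esub> (p ^ i)"
      proof (cases "i < n")
        case False
        then have "l a i [^]\<^bsub>D\<^esub> (p ^ i) = (\<kappa> a i [^]\<^bsub>D\<^esub> (p ^ i)) [^]\<^bsub>D\<^esub> (p ^ n)"
          using \<kappa>c[OF a] by (simp add: l_def D.nat_pow_pow mult.commute)
        also have "\<dots> = j a [^]\<^bsub>D\<^esub> (p ^ i)"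
          using False a \<kappa>_pow by (simp add: D.nat_pow_pow flip: power_add)
        finally show ?thesis .
      qed (simp add: l_def)
      then show ?thesis
        using a \<epsilon>_closed lc \<epsilon>_pow by (simp add: g_def D.nat_pow_distrib D.nat_pow_inv)
    qed
    moreover obtain m where "\<forall>i\<ge>m. \<epsilon> a i = \<one>\<^bsub>D\<^esub>" using \<epsilon>_support[OF a] .
    moreover obtain m' where "\<forall>i\<ge>m'. \<kappa> a i = \<one>\<^bsub>D\<^esub>" using \<kappa>_supp[OF a] by blast
    ultimately have "\<forall>i\<ge>max n (max m m'). g a i = \<one>\<^bsub>D\<^esub>" "\<forall>i. g a i [^]\<^bsub>D\<^esub> (p ^ i) = \<one>\<^bsub>D\<^esub>"
      using a by (auto simp: g_def l_def)
    moreover have "\<forall>i. g a i \<in> carrier D" using a \<epsilon>_closed lc by (simp add: g_def)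
    ultimately show ?thesis unfolding M_def by blast
  qed
  have "g \<one> = \<one>\<^bsub>X\<^esub>" using \<epsilon>_one \<kappa>1 by (simp add: g_def l_def fun_eq_iff sequence_group_simps)
  then have g: "g \<in> cochains G X" using gM by (auto simp: cochains_def g_def)
  have "\<phi> (a, b) = coboundary G X g (a, b) \<otimes>\<^bsub>X\<^esub> ?h (a, b) [^]\<^bsub>X\<^esub> (p ^ n)"
    if ab: "a \<in> carrier G" "b \<in> carrier G" for a b
  proof
    fix i
    have \<kappa>P: "\<kappa> a \<in> carrier P" if "a \<in> carrier G" for a using \<kappa>c that by (simp add: sequence_group_simps)
    have "?h (a, b) i [^]\<^bsub>D\<^esub> (p ^ n) = l a i \<otimes>\<^bsub>D\<^esub> l b i \<otimes>\<^bsub>D\<^esub> inv\<^bsub>D\<^esub> (l (a \<otimes> b) i)"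
    proof (cases "i < n")
      case True
      then have "\<kappa> x i = \<one>\<^bsub>D\<^esub>" if "x \<in> carrier G" for x using that by (simp add: \<kappa>_def)
      then show ?thesis using True ab by (simp add: coboundary_P[OF \<kappa>P] l_def)
    next
      case False
      then show ?thesis
        using ab \<kappa>c by (simp add: coboundary_P[OF \<kappa>P] l_def D.nat_pow_distrib D.nat_pow_inv)
    qed
    moreover have "coboundary G X g (a, b) i = (\<epsilon> a i \<otimes>\<^bsub>D\<^esub> inv\<^bsub>D\<^esub> (l a i)) \<otimes>\<^bsub>D\<^esub> (\<epsilon> b i \<otimes>\<^bsub>D\<^esub> inv\<^bsub>D\<^esub> (l b i))
        \<otimes>\<^bsub>D\<^esub> inv\<^bsub>D\<^esub> (\<epsilon> (a \<otimes> b) i \<otimes>\<^bsub>D\<^esub> inv\<^bsub>D\<^esub> (l (a \<otimes> b) i))"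
      by (subst coboundary_X[where c = g, OF gM ab]) (simp_all add: g_def ab)
    ultimately have "coboundary G X g (a, b) i \<otimes>\<^bsub>D\<^esub> ?h (a, b) i [^]\<^bsub>D\<^esub> (p ^ n) = \<phi> (a, b) i"
      using D.coboundary_telescope[of "\<epsilon> a i" "\<epsilon> b i" "\<epsilon> (a \<otimes> b) i" "l a i" "l b i" "l (a \<otimes> b) i"]
        ab \<epsilon>_closed lc \<phi>_apply by simp
    then show "\<phi> (a, b) i = (coboundary G X g (a, b) \<otimes>\<^bsub>X\<^esub> ?h (a, b) [^]\<^bsub>X\<^esub> (p ^ n)) i"
      by (simp add: sequence_group_simps sequence_group_pow flip: P.nat_pow_consistent)
  qed
  then show ?thesis using g h by blast
qed

text \<open>If \<open>p \<phi>\<close> is the coboundary of \<open>k\<close>, then \<open>\<psi> = p \<epsilon> - k\<close> is a homomorphism, and the differences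
  \<open>\<Psi> i\<close> of its components map \<open>G\<close> into the direct sum of the \<open>D[p\<^bsup>i + 1\<^esup>]\<close> with kernel in \<open>G[p]\<close>.\<close>

lemma projective_imp_kulikov_chain:
  assumes proj: "p_omega_plus_1_projective p G"
  shows "\<exists>E Q. kulikov_chain p G E Q"
proof -
  \<comment> \<open>\<open>X\<close> lives on a type of sequences in \<open>D\<close>, not on the
    words over which the definition quantifies; independence of the type is needed here.\<close>
  have vanish: "p_omega_plus_1 p (Ext G X) = {\<one>\<^bsub>Ext G X\<^esub>}"
    by (rule p_omega_plus_1_Ext_eq_one[OF comm_group_axioms X proj])
  obtain h g where hg: "\<forall>n. h n \<in> cocycles G X \<and> g n \<in> cochains G X \<and>
      (\<forall>a\<in>carrier G. \<forall>b\<in>carrier G.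
        \<phi> (a, b) = coboundary G X (g n) (a, b) \<otimes>\<^bsub>X\<^esub> h n (a, b) [^]\<^bsub>X\<^esub> (p ^ n))"
    using \<phi>_omega unfolding Bex_def by metis
  obtain k where k: "k \<in> cochains G X"
    and \<phi>k: "\<forall>a\<in>carrier G. \<forall>b\<in>carrier G. \<phi> (a, b) [^]\<^bsub>X\<^esub> p = coboundary G X k (a, b)"
    using iffD1[OF p_omega_plus_1_Ext_iff[OF comm_group_axioms X] vanish,
        THEN spec[of _ \<phi>], THEN spec[of _ h], THEN spec[of _ g], THEN mp, OF \<phi>_cocycle, THEN mp, OF hg]
    by blast
  have kM: "k a \<in> M" if "a \<in> carrier G" for a using cochain_closed[OF k that] by simp
  have kc: "k a i \<in> carrier D" and k_pow: "k a i [^]\<^bsub>D\<^esub> (p ^ i) = \<one>\<^bsub>D\<^esub>" if "a \<in> carrier G" for a i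
    using kM[OF that] by (simp_all add: M_def)
  define \<psi> where "\<psi> i a = \<epsilon> a i [^]\<^bsub>D\<^esub> p \<otimes>\<^bsub>D\<^esub> inv\<^bsub>D\<^esub> (k a i)" for i a
  have \<psi>c: "\<psi> i a \<in> carrier D" if "a \<in> carrier G" for a i using that \<epsilon>_closed kc by (simp add: \<psi>_def)
  have \<psi>_mult: "\<psi> i (a \<otimes> b) = \<psi> i a \<otimes>\<^bsub>D\<^esub> \<psi> i b" if ab: "a \<in> carrier G" "b \<in> carrier G" for i a b
  proof -
    note cl = \<epsilon>_closed[OF ab(1), of i] \<epsilon>_closed[OF ab(2), of i] \<epsilon>_closed[OF m_closed[OF ab], of i]
      kc[OF ab(1), of i] kc[OF ab(2), of i] kc[OF m_closed[OF ab], of i]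
    have "\<phi> (a, b) i [^]\<^bsub>D\<^esub> p = coboundary G X k (a, b) i"
    proof -
      have "\<phi> (a, b) [^]\<^bsub>P\<^esub> p = coboundary G X k (a, b)"
        using \<phi>k ab by (simp flip: P.nat_pow_consistent)
      then show ?thesis by (metis sequence_group_pow)
    qed
    then have "(\<epsilon> a i [^]\<^bsub>D\<^esub> p \<otimes>\<^bsub>D\<^esub> \<epsilon> b i [^]\<^bsub>D\<^esub> p) \<otimes>\<^bsub>D\<^esub> inv\<^bsub>D\<^esub> (\<epsilon> (a \<otimes> b) i [^]\<^bsub>D\<^esub> p)
        = (k a i \<otimes>\<^bsub>D\<^esub> k b i) \<otimes>\<^bsub>D\<^esub> inv\<^bsub>D\<^esub> (k (a \<otimes> b) i)"
      using cl by (simp add: coboundary_X[where c = k, OF kM ab] \<phi>_apply[OF ab] D.nat_pow_distrib D.nat_pow_inv)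
    then have "(\<epsilon> a i [^]\<^bsub>D\<^esub> p \<otimes>\<^bsub>D\<^esub> \<epsilon> b i [^]\<^bsub>D\<^esub> p) \<otimes>\<^bsub>D\<^esub> inv\<^bsub>D\<^esub> (k a i \<otimes>\<^bsub>D\<^esub> k b i)
        = \<epsilon> (a \<otimes> b) i [^]\<^bsub>D\<^esub> p \<otimes>\<^bsub>D\<^esub> inv\<^bsub>D\<^esub> (k (a \<otimes> b) i)"
      by (rule D.quotient_swap) (use cl in simp_all)
    then show ?thesis using cl by (simp add: \<psi>_def D.inv_mult) (simp add: D.m_ac)
  qed
  have \<psi>_supp: "\<exists>n. \<forall>i\<ge>n. \<psi> i a = \<one>\<^bsub>D\<^esub>" if a: "a \<in> carrier G" for a
  proof -
    obtain m where "\<forall>i\<ge>m. \<epsilon> a i = \<one>\<^bsub>D\<^esub>" using \<epsilon>_support[OF a] .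
    moreover obtain m' where "\<forall>i\<ge>m'. k a i = \<one>\<^bsub>D\<^esub>" using kM[OF a] by (auto simp: M_def)
    ultimately have "\<forall>i\<ge>max m m'. \<psi> i a = \<one>\<^bsub>D\<^esub>" by (simp add: \<psi>_def)
    then show ?thesis by blast
  qed
  have \<psi>_pow: "\<psi> i a [^]\<^bsub>D\<^esub> (p ^ i) = j a [^]\<^bsub>D\<^esub> (p ^ Suc i)" if a: "a \<in> carrier G" for i a
  proof -
    have "\<psi> i a [^]\<^bsub>D\<^esub> (p ^ i) = (\<epsilon> a i [^]\<^bsub>D\<^esub> (p ^ i)) [^]\<^bsub>D\<^esub> p"
      using a \<epsilon>_closed[OF a] kc[OF a] k_pow[OF a]
      by (simp add: \<psi>_def D.nat_pow_distrib D.nat_pow_inv D.nat_pow_pow mult.commute)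
    then show ?thesis using a \<epsilon>_pow[OF a] by (simp add: D.nat_pow_pow mult.commute)
  qed
  \<comment> \<open>\<open>\<psi> (i+1)\<close> and \<open>\<psi> i\<close> have the same
    \<open>p^(i+1)\<close>-fold, namely that of \<open>p j\<close>, so their difference has image
    bounded by \<open>p^(i+1)\<close>. No single \<open>\<psi> i\<close> need have bounded
    image.\<close>
  define \<Psi> where "\<Psi> i a = \<psi> (Suc i) a \<otimes>\<^bsub>D\<^esub> inv\<^bsub>D\<^esub> (\<psi> i a)" for i a
  have \<Psi>: "group_hom G D (\<Psi> i)" for i
  proof (unfold_locales, rule homI)
    show "\<Psi> i a \<in> carrier D" if "a \<in> carrier G" for a using \<psi>c that by (simp add: \<Psi>_def)
    show "\<Psi> i (a \<otimes> b) = \<Psi> i a \<otimes>\<^bsub>D\<^esub> \<Psi> i b" if "a \<in> carrier G" "b \<in> carrier G" for a b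
      using \<psi>c that by (simp add: \<Psi>_def \<psi>_mult D.inv_mult D.m_ac)
  qed
  note \<Psi>_mult = group_hom.hom_mult[OF \<Psi>] and \<Psi>_inv = group_hom.hom_inv[OF \<Psi>]
    and \<Psi>_one = group_hom.hom_one[OF \<Psi>] and \<Psi>_nat_pow = group_hom.hom_nat_pow[OF \<Psi>]
    and \<Psi>_closed = group_hom.hom_closed[OF \<Psi>]
  have \<Psi>_pow: "\<Psi> i a [^]\<^bsub>D\<^esub> (p ^ Suc i) = \<one>\<^bsub>D\<^esub>" if a: "a \<in> carrier G" for i a
  proof -
    have "\<psi> i a [^]\<^bsub>D\<^esub> (p ^ Suc i) = (\<psi> i a [^]\<^bsub>D\<^esub> (p ^ i)) [^]\<^bsub>D\<^esub> p"
      using \<psi>c[OF a] by (simp add: D.nat_pow_pow mult.commute)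
    also have "\<dots> = \<psi> (Suc i) a [^]\<^bsub>D\<^esub> (p ^ Suc i)"
      unfolding \<psi>_pow[OF a] using a by (simp add: D.nat_pow_pow mult.commute)
    finally show ?thesis
      using \<psi>c[OF a] by (simp add: \<Psi>_def D.nat_pow_distrib D.nat_pow_inv)
  qed
  have \<Psi>_supp: "\<exists>n. \<forall>i\<ge>n. \<Psi> i a = \<one>\<^bsub>D\<^esub>" if a: "a \<in> carrier G" for a
  proof -
    obtain n where "\<forall>i\<ge>n. \<psi> i a = \<one>\<^bsub>D\<^esub>" using \<psi>_supp[OF a] by blast
    then have "\<forall>i\<ge>n. \<Psi> i a = \<one>\<^bsub>D\<^esub>" by (simp add: \<Psi>_def)
    then show ?thesis by blast
  qed
  define E where "E = {a \<in> carrier G. \<forall>i. \<Psi> i a = \<one>\<^bsub>D\<^esub>}"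
  have Ep: "a [^] p = \<one>" if "a \<in> E" for a
  proof -
    have a: "a \<in> carrier G" and \<Psi>a: "\<And>i. \<Psi> i a = \<one>\<^bsub>D\<^esub>" using that by (simp_all add: E_def)
    \<comment> \<open>On \<open>E\<close> all components coincide, and almost all vanish, so
      \<open>\<psi> 0 a\<close> is trivial. Since \<open>\<psi> 0\<close> is \<open>p j\<close>,
      injectivity of \<open>j\<close> gives \<open>p a = 0\<close>.\<close>
    have "\<psi> (Suc i) a = \<psi> i a" for i
    proof -
      have "\<psi> (Suc i) a = \<Psi> i a \<otimes>\<^bsub>D\<^esub> \<psi> i a" using \<psi>c[OF a] by (simp add: \<Psi>_def D.m_assoc)
      then show ?thesis using \<psi>c[OF a] \<Psi>a by simp
    qed
    then have "\<psi> i a = \<psi> 0 a" for i by (induction i) simp_all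
    then have "\<psi> 0 a = \<one>\<^bsub>D\<^esub>" using \<psi>_supp[OF a] by (metis order_refl)
    then have "j (a [^] p) = j \<one>" using \<psi>_pow[OF a, of 0] a by (simp add: j_pow)
    then show ?thesis by (rule inj_onD[OF inj]) (use a in simp_all)
  qed
  define Q where "Q n = {a \<in> carrier G. a [^] p \<in> E \<and> (\<forall>i\<ge>n. \<Psi> i a = \<one>\<^bsub>D\<^esub>)}" for n
  have E: "subgroup E G"
    by (rule subgroupI) (auto simp: E_def \<Psi>_mult \<Psi>_inv \<Psi>_one)
  have Q: "subgroup (Q n) G" for n
  proof (rule subgroupI)
    show "Q n \<subseteq> carrier G" by (auto simp: Q_def)
    have "\<one> \<in> Q n" using subgroup.one_closed[OF E] by (simp add: Q_def \<Psi>_one)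
    then show "Q n \<noteq> {}" by blast
    show "inv a \<in> Q n" if "a \<in> Q n" for a
      using that subgroup.m_inv_closed[OF E] by (simp add: Q_def \<Psi>_inv nat_pow_inv)
    show "a \<otimes> b \<in> Q n" if "a \<in> Q n" "b \<in> Q n" for a b
      using that subgroup.m_closed[OF E] by (simp add: Q_def \<Psi>_mult nat_pow_distrib)
  qed
  have "kulikov_chain p G E Q"
    unfolding kulikov_chain_def
  proof (intro conjI allI ballI E Q)
    show "a [^] p = \<one>" if "a \<in> E" for a using Ep[OF that] .
    show "E \<subseteq> Q n" for n
      using Ep subgroup.one_closed[OF E] by (auto simp: Q_def E_def)
    show "Q n \<subseteq> Q (Suc n)" for n by (auto simp: Q_def)
    show "\<exists>k. \<forall>x\<in>carrier G. x [^] (p ^ k) \<in> Q n \<longrightarrow> x [^] (p ^ k) \<in> E" for n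
    proof (intro exI ballI impI)
      fix x assume x: "x \<in> carrier G" "x [^] (p ^ n) \<in> Q n"
      \<comment> \<open>The height bound for \<open>Q n\<close> is \<open>n\<close> itself:
        components from \<open>n\<close> on vanish by definition of \<open>Q n\<close>, and for
        \<open>i < n\<close> the factor \<open>p^(i+1)\<close> of \<open>p^n\<close> kills the image
        of \<open>\<Psi> i\<close>.\<close>
      have "\<Psi> i (x [^] (p ^ n)) = \<one>\<^bsub>D\<^esub>" for i
      proof (cases "n \<le> i")
        case False
        then have n: "p ^ n = p ^ Suc i * p ^ (n - Suc i)" by (simp flip: power_add power_Suc)
        have "\<Psi> i (x [^] (p ^ n)) = (\<Psi> i x [^]\<^bsub>D\<^esub> (p ^ Suc i)) [^]\<^bsub>D\<^esub> (p ^ (n - Suc i))"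
          using x(1) \<Psi>_closed[OF x(1)] by (simp only: \<Psi>_nat_pow n D.nat_pow_pow)
        then show ?thesis using \<Psi>_pow[OF x(1)] by simp
      qed (use x(2) in \<open>simp add: Q_def\<close>)
      then show "x [^] (p ^ n) \<in> E" using x(1) by (simp add: E_def)
    qed
    show "(\<Union>n. Q n) = {x \<in> carrier G. x [^] p \<in> E}"
      using \<Psi>_supp by (auto simp: Q_def)
  qed
  then show ?thesis by blast
qed

end

section \<open>The divisible embedding and the conclusion\<close>

definition rational_functions :: "('a \<Rightarrow> rat) monoid"
  where "rational_functions = \<lparr>carrier = UNIV, monoid.mult = (\<lambda>u v x. u x + v x), one = (\<lambda>x. 0)\<rparr>"

lemma comm_group_rational_functions: "comm_group rational_functions"
proof (rule comm_groupI)
  show "\<exists>v\<in>carrier rational_functions. v \<otimes>\<^bsub>rational_functions\<^esub> u = \<one>\<^bsub>rational_functions\<^esub>" for u :: "'a \<Rightarrow> rat"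
    by (intro bexI[of _ "\<lambda>x. - u x"]) (auto simp: rational_functions_def)
qed (auto simp: rational_functions_def)

lemma rational_functions_pow: "(u [^]\<^bsub>rational_functions\<^esub> (n::nat)) x = of_nat n * u x"
  by (induction n) (simp_all add: rational_functions_def algebra_simps)

text \<open>Write \<open>G = F/R\<close> with \<open>F\<close> free on \<open>G\<close>. Then \<open>G\<close> embeds in the divisible group \<open>(F \<otimes> \<rat>)/R\<close>.\<close>

lemma (in comm_group) divisible_embedding:
  obtains D :: "('a \<Rightarrow> rat) set monoid" and j where "comm_group D" "j \<in> hom G D" "inj_on j (carrier G)"
    "\<forall>a\<in>carrier G. \<forall>n>0. \<exists>d\<in>carrier D. d [^]\<^bsub>D\<^esub> (n::nat) = j a"
proof -
  let ?F = "free_Abelian_group (carrier G)" and ?V = "rational_functions :: ('a \<Rightarrow> rat) monoid"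
  interpret V: comm_group ?V by (rule comm_group_rational_functions)
  obtain h where h: "h \<in> hom ?F G" "\<And>x. x \<in> carrier G \<Longrightarrow> h (frag_of x) = x"
    using free_Abelian_group_universal[of "\<lambda>x. x" "carrier G"] by auto
  interpret F: group ?F by simp
  interpret h: group_hom ?F G h by unfold_locales (rule h(1))
  let ?\<rho> = "\<lambda>c x. of_int (Poly_Mapping.lookup c x) :: rat"
  have \<rho>: "group_hom ?F ?V ?\<rho>"
    by unfold_locales (auto simp: hom_def rational_functions_def lookup_add)
  define R where "R = ?\<rho> ` kernel ?F G h"
  have R: "subgroup R ?V"
    unfolding R_def by (rule group_hom.subgroup_img_is_subgroup[OF \<rho> h.subgroup_kernel])
  interpret R: normal R ?V by (rule V.subgroup_imp_normal[OF R])
  define \<delta> where "\<delta> q x y = (if x = y then q else 0 :: rat)" for q and x y :: 'a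
  have frag: "?\<rho> (frag_of x) = \<delta> 1 x" for x by (auto simp: \<delta>_def fun_eq_iff lookup_frag_of)
  define j where "j x = R #>\<^bsub>?V\<^esub> \<delta> 1 x" for x
  have V: "u \<in> carrier ?V" for u by (simp add: rational_functions_def)
  have mem: "(\<lambda>y. u y - v y) \<in> R" if "R #>\<^bsub>?V\<^esub> u = R #>\<^bsub>?V\<^esub> v" for u v
  proof -
    have "u \<in> R #>\<^bsub>?V\<^esub> v" using V.rcos_self[OF V R, of u] that by simp
    then obtain r where "r \<in> R" "u = (\<lambda>y. r y + v y)" by (auto simp: r_coset_def rational_functions_def)
    then show ?thesis by simp
  qed
  have eqI: "R #>\<^bsub>?V\<^esub> u = R #>\<^bsub>?V\<^esub> v" if "(\<lambda>y. u y - v y) \<in> R" for u v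
  proof -
    have "u \<in> R #>\<^bsub>?V\<^esub> v" using that
      by (auto simp: r_coset_def rational_functions_def intro!: bexI[of _ "\<lambda>y. u y - v y"])
    then show ?thesis using V.repr_independence[OF _ V R] by metis
  qed
  show thesis
  proof (rule that[of "?V Mod R" j])
    show "comm_group (?V Mod R)" by (rule V.abelian_FactGroup[OF R])
    show "j \<in> hom G (?V Mod R)"
    proof (rule homI)
      show "j x \<in> carrier (?V Mod R)" for x by (auto simp: j_def carrier_FactGroup V)
      fix x y assume xy: "x \<in> carrier G" "y \<in> carrier G"
      let ?c = "frag_of (x \<otimes> y) - (frag_of x + frag_of y)"
      have cl: "frag_of x \<in> carrier ?F" "frag_of y \<in> carrier ?F" "frag_of (x \<otimes> y) \<in> carrier ?F"
        using xy by simp_all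
      have c: "?c = frag_of (x \<otimes> y) \<otimes>\<^bsub>?F\<^esub> inv\<^bsub>?F\<^esub> (frag_of x \<otimes>\<^bsub>?F\<^esub> frag_of y)"
        using xy subset_trans[OF keys_add[of "frag_of x" "frag_of y"], of "carrier G"] by simp
      have "h ?c = \<one>"
        unfolding c by (simp only: h.hom_mult h.hom_inv F.m_closed F.inv_closed cl h(2) xy m_closed r_inv)
      moreover have "?c \<in> carrier ?F" unfolding c by (intro F.m_closed F.inv_closed cl)
      ultimately have "?\<rho> ?c \<in> R" unfolding R_def kernel_def by blast
      moreover have "?\<rho> ?c = (\<lambda>z. \<delta> 1 (x \<otimes> y) z - (\<delta> 1 x z + \<delta> 1 y z))"
        using frag[THEN fun_cong] by (simp add: lookup_minus lookup_add fun_eq_iff)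
      ultimately have "R #>\<^bsub>?V\<^esub> \<delta> 1 (x \<otimes> y) = R #>\<^bsub>?V\<^esub> (\<delta> 1 x \<otimes>\<^bsub>?V\<^esub> \<delta> 1 y)"
        by (intro eqI) (simp add: rational_functions_def)
      then show "j (x \<otimes> y) = j x \<otimes>\<^bsub>?V Mod R\<^esub> j y"
        by (simp add: j_def R.rcos_sum[OF V V])
    qed
    show "inj_on j (carrier G)"
    proof (rule inj_onI)
      fix x y assume xy: "x \<in> carrier G" "y \<in> carrier G" "j x = j y"
      have cl: "frag_of x \<in> carrier ?F" "frag_of y \<in> carrier ?F" using xy by simp_all
      have "(\<lambda>z. \<delta> 1 x z - \<delta> 1 y z) \<in> R" using mem xy(3) by (simp add: j_def)
      \<comment> \<open>A relation between the images of \<open>x\<close> and \<open>y\<close> comes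
        from an integral combination \<open>c\<close> in the kernel of \<open>h\<close>. Comparing
        coefficients identifies \<open>c\<close> with the formal difference of \<open>x\<close> and
        \<open>y\<close>, so applying \<open>h\<close> gives \<open>x = y\<close>.\<close>
      then obtain c where c: "c \<in> carrier ?F" "h c = \<one>" "(\<lambda>z. \<delta> 1 x z - \<delta> 1 y z) = ?\<rho> c"
        unfolding R_def kernel_def by blast
      have "Poly_Mapping.lookup c z = Poly_Mapping.lookup (frag_of x - frag_of y) z" for z
      proof -
        have "(of_int (Poly_Mapping.lookup c z) :: rat) = of_int (Poly_Mapping.lookup (frag_of x - frag_of y) z)"
          using c(3) frag[THEN fun_cong] by (simp add: lookup_minus fun_eq_iff)
        then show ?thesis by (simp only: of_int_eq_iff)
      qed
      then have "c = frag_of x - frag_of y" by (rule poly_mapping_eqI)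
      then have "c \<otimes>\<^bsub>?F\<^esub> frag_of y = frag_of x" by simp
      then have "h (frag_of x) = h c \<otimes> h (frag_of y)" using h.hom_mult[OF c(1) cl(2)] by simp
      then show "x = y" using xy h(2) c(2) by simp
    qed
    show "\<forall>a\<in>carrier G. \<forall>n>0. \<exists>d\<in>carrier (?V Mod R). d [^]\<^bsub>?V Mod R\<^esub> (n::nat) = j a"
    proof (intro ballI allI impI)
      fix a and n :: nat assume n: "n > 0"
      let ?d = "R #>\<^bsub>?V\<^esub> \<delta> (1 / of_nat n) a"
      have "\<delta> (1 / of_nat n) a [^]\<^bsub>?V\<^esub> n = \<delta> 1 a"
        using n by (auto simp: fun_eq_iff rational_functions_pow \<delta>_def)
      then have "?d [^]\<^bsub>?V Mod R\<^esub> n = j a" using R.FactGroup_pow[OF V] by (simp add: j_def)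
      moreover have "?d \<in> carrier (?V Mod R)" by (auto simp: carrier_FactGroup V)
      ultimately show "\<exists>d\<in>carrier (?V Mod R). d [^]\<^bsub>?V Mod R\<^esub> n = j a" by blast
    qed
  qed
qed

lemma (in primary_comm_group) projective_iff_kulikov_chain:
  "p_omega_plus_1_projective p G \<longleftrightarrow> (\<exists>E Q. kulikov_chain p G E Q)"
proof
  assume proj: "p_omega_plus_1_projective p G"
  obtain D :: "('a \<Rightarrow> rat) set monoid" and j where D: "comm_group D" "j \<in> hom G D" "inj_on j (carrier G)"
    "\<forall>a\<in>carrier G. \<forall>n>0. \<exists>d\<in>carrier D. d [^]\<^bsub>D\<^esub> (n::nat) = j a"
    using divisible_embedding by metis
  interpret D: comm_group D by (rule D(1))
  interpret height_omega_embedding G p D j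
    by unfold_locales (use D prime_gt_0_nat[OF prime] in auto)
  show "\<exists>E Q. kulikov_chain p G E Q" using projective_imp_kulikov_chain[OF proj] .
qed (use kulikov_chain_imp_projective in blast)

theorem theorem8:
  fixes p :: nat and G :: "('a, 'b) monoid_scheme" and L :: "'a set"
  assumes "prime p" and "comm_group G" and "primary_group p G" and "large_subgroup L G"
  shows "p_omega_plus_1_projective p G \<longleftrightarrow> p_omega_plus_1_projective p (G\<lparr>carrier := L\<rparr>)"
proof -
  interpret primary_comm_group G p
    using assms by (simp add: primary_comm_group_def primary_comm_group_axioms_def)
  have L: "subgroup L G" using assms(4) by (simp add: large_subgroup_def fully_invariant_def)
  have "comm_group (G\<lparr>carrier := L\<rparr>)"
    using subgroup_imp_group[OF L] subgroup.mem_carrier[OF L]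
    by (intro group.group_comm_groupI) (simp_all add: m_comm)
  moreover have "primary_group p (G\<lparr>carrier := L\<rparr>)"
    using assms(3) subgroup.mem_carrier[OF L]
    by (simp add: primary_group_def flip: nat_pow_consistent)
  ultimately interpret GL: primary_comm_group "G\<lparr>carrier := L\<rparr>" p
    using assms(1) by (simp add: primary_comm_group_def primary_comm_group_axioms_def)
  show ?thesis
    unfolding projective_iff_kulikov_chain GL.projective_iff_kulikov_chain
    using kulikov_chain_subgroup[OF L] kulikov_chain_large[OF assms(4)] by blast
qed

end
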